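(* Let $K$ and $L$ be generic (finite) geometric simplicial complexes in $\mathbb{R}^d$, and let $\mu$ be Lebesgue measure on $S^{d-1}$. If $\operatorname{ECT}(K)_*(\mu)=\operatorname{ECT}(L)_*(\mu)$ (the pushforward measures on the space of Euler curves are the same), then there is some $\phi\in O(d)$ such that $L=\phi(K)$ (as subsets of $\mathbb{R}^d$).
   Context: A finite geometric simplicial complex $K$ in $\mathbb{R}^d$ is a finite set of geometric simplices (convex hulls of affinely independent points) closed under taking faces and such that any two simplices intersect in the empty set or a common face. $K$ is identified with the union of its simplices; different triangulations of the same subset are regarded as equivalent. For $v\in S^{d-1}$, the Euler curve $\operatorname{ECT}(K)(v):\mathbb{R}\to\mathbb{Z}$ is $t\mapsto\chi(\{y\in K: y\cdot v\le t\})$. $\operatorname{ECT}(K)$ is a continuous map from $S^{d-1}$ to the space of Euler curves, which consists of finite integer combinations of indicator functions of half-open intervals $[a,b)$, $b=\infty$ allowed, endowed with the $L^p$ extended metric $d_p(f,g)=(\int|f-g|^p)^{1/p}$ for a fixed $p\in[1,\infty)$ and its Borel $\sigma$-algebra. The pushforward is $\operatorname{ECT}(K)_*(\mu)(A)=\mu(\operatorname{ECT}(K)^{-1}(A))$. $K$ with vertex set $X$ is generic if (1) the Euler curves $\operatorname{ECT}(K)(v)$ are pairwise distinct for distinct $v\in S^{d-1}$, and (2) $X$ is in general position; here general position means that any set of at most $d$ points of $X$ is linearly independent. *)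

theory Defs
  imports "HOL-Analysis.Analysis"
begin

section \<open>Euler characteristic of compact polyhedra\<close>

text \<open>
  The Euler characteristic of a set that is the underlying set of some finite geometric simplicial
  complex: the alternating sum of the numbers of simplices of a triangulation, which does not
  depend on the triangulation. A nonempty \<^const>\<open>simplicial_complex\<close> always contains the empty
  simplex, which must not be counted.
\<close>

definition euler_char :: "'a::euclidean_space set \<Rightarrow> int" where
  "euler_char P = (THE n. \<exists>T. simplicial_complex T \<and> \<Union>T = P \<and>
      n = (\<Sum>S\<in>T - {{}}. (- 1) ^ nat (aff_dim S)))"

section \<open>Euler characteristic transform\<close>

definition ECT :: "'a::euclidean_space set \<Rightarrow> 'a \<Rightarrow> real \<Rightarrow> int" where
  "ECT P v = (\<lambda>t. euler_char {y \<in> P. y \<bullet> v \<le> t})"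

section \<open>The space of Euler curves\<close>

definition half_open_intervals :: "real set set" where
  "half_open_intervals = {{a..<b} | a b. a < b} \<union> {{a..} | a. True}"

definition euler_curves :: "(real \<Rightarrow> int) set" where
  "euler_curves = {f. \<exists>J c. finite J \<and> J \<subseteq> half_open_intervals \<and>
      f = (\<lambda>t. \<Sum>I\<in>J. c I * indicator I t)}"

definition Lp_edist :: "real \<Rightarrow> (real \<Rightarrow> int) \<Rightarrow> (real \<Rightarrow> int) \<Rightarrow> ennreal" where
  "Lp_edist p f g =
     (let I = (\<integral>\<^sup>+ t. ennreal (\<bar>real_of_int (f t) - real_of_int (g t)\<bar> powr p) \<partial>lborel)
      in if I = \<infinity> then \<infinity> else ennreal (enn2real I powr (1 / p)))"

definition Lp_open :: "real \<Rightarrow> (real \<Rightarrow> int) set \<Rightarrow> bool" where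
  "Lp_open p U \<longleftrightarrow> U \<subseteq> euler_curves \<and>
     (\<forall>f\<in>U. \<exists>e>0. \<forall>g\<in>euler_curves. Lp_edist p f g < ennreal e \<longrightarrow> g \<in> U)"

text \<open>Only the measurable space matters here; its measure is the zero measure.\<close>

definition euler_curve_borel :: "real \<Rightarrow> (real \<Rightarrow> int) measure" where
  "euler_curve_borel p = sigma euler_curves {U. Lp_open p U}"

lemma space_euler_curve_borel: "space (euler_curve_borel p) = euler_curves"
  by (simp add: euler_curve_borel_def space_measure_of_conv)

lemma sets_euler_curve_borel:
  "sets (euler_curve_borel p) = sigma_sets euler_curves {U. Lp_open p U}"
  unfolding euler_curve_borel_def by (rule sets_measure_of) (auto simp: Lp_open_def)

section \<open>Lebesgue measure on the unit sphere\<close>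

text \<open>
  Surface measure, normalised by polar coordinates: a Borel set \<open>A\<close> of unit vectors has measure
  \<open>d\<close> times the volume of the truncated cone \<open>{r a | a \<in> A, 0 < r \<le> 1}\<close>.
  For \<open>d = 1\<close> this is counting measure on the two unit vectors.
\<close>

definition sphere_measure :: "'a::euclidean_space measure" where
  "sphere_measure = scale_measure (of_nat DIM('a))
     (distr (restrict_space lborel (cball 0 1 - {0})) (restrict_space borel (sphere 0 1))
        (\<lambda>x. x /\<^sub>R norm x))"

lemma space_sphere_measure: "space (sphere_measure :: 'a::euclidean_space measure) = sphere 0 1"
  by (simp add: sphere_measure_def space_scale_measure space_restrict_space)

lemma sets_sphere_measure:
  "sets (sphere_measure :: 'a::euclidean_space measure) = sets (restrict_space borel (sphere 0 1))"
  by (simp add: sphere_measure_def)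

lemma emeasure_sphere_measure:
  fixes A :: "'a::euclidean_space set"
  assumes A: "A \<in> sets borel" "A \<subseteq> sphere 0 1"
  shows "emeasure sphere_measure A =
    of_nat DIM('a) * emeasure lborel {r *\<^sub>R a | r a. a \<in> A \<and> 0 < r \<and> r \<le> 1}"
proof -
  let ?B = "cball 0 1 - {0} :: 'a set"
  let ?n = "\<lambda>x::'a. x /\<^sub>R norm x"
  have m: "?n \<in> measurable (restrict_space lborel ?B) (restrict_space borel (sphere 0 1))"
    by (rule measurable_restrict_space2)
       (auto simp: space_restrict_space intro: measurable_restrict_space1)
  have "A \<in> sets (restrict_space borel (sphere 0 1))"
    using A by (auto simp: sets_restrict_space_iff)
  moreover have "?n -` A \<inter> space (restrict_space lborel ?B)
      = {r *\<^sub>R a | r a. a \<in> A \<and> 0 < r \<and> r \<le> 1}" (is "?l = ?r")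
  proof
    show "?l \<subseteq> ?r"
    proof
      fix x assume x: "x \<in> ?l"
      then have "x = norm x *\<^sub>R ?n x" "?n x \<in> A" "0 < norm x" "norm x \<le> 1"
        by (auto simp: space_restrict_space)
      then show "x \<in> ?r" by blast
    qed
    show "?r \<subseteq> ?l"
      using A(2) by (force simp: space_restrict_space)
  qed
  moreover have "emeasure (restrict_space lborel ?B) ?r = emeasure lborel ?r"
    using A(2) by (intro emeasure_restrict_space) auto
  ultimately show ?thesis
    unfolding sphere_measure_def using m by (simp add: emeasure_distr)
qed

section \<open>Generic complexes\<close>

text \<open>A nonempty \<^const>\<open>simplicial_complex\<close> is allowed to (and does) contain the empty simplex;
  its vertices are the points spanning a zero-dimensional simplex.\<close>

definition complex_vertices :: "'a set set \<Rightarrow> 'a set" where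
  "complex_vertices K = {x. {x} \<in> K}"

text \<open>General position is linear rather than affine: hyperplanes through the origin.\<close>

definition general_position :: "'a::euclidean_space set \<Rightarrow> bool" where
  "general_position X \<longleftrightarrow> (\<forall>A\<subseteq>X. finite A \<and> card A \<le> DIM('a) \<longrightarrow> independent A)"

definition generic :: "'a::euclidean_space set set \<Rightarrow> bool" where
  "generic K \<longleftrightarrow> inj_on (ECT (\<Union>K)) (sphere 0 1) \<and> general_position (complex_vertices K)"

end

theory Submission
  imports Defs
begin

text \<open>
  Write the indicator function of \<open>\<Union>K\<close> as an integer combination of indicators of hulls of vertex
  sets (Moebius inversion over faces). Additivity of the Euler characteristic turns the Euler curve
  in direction \<open>v\<close> into the sum over these vertex sets of weighted steps at their minimal heights,
  and the same additivity, applied to polar sets, shows that the curves determine the polyhedron.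

  As the surface measure charges every nonempty open set and the curves depend injectively and
  continuously on the direction, equality of the push-forwards yields a norm-preserving,
  positively homogeneous homeomorphism \<open>H\<close> of the whole space that preserves Lebesgue measure and
  matches the curves of \<open>K\<close> at \<open>v\<close> with those of \<open>L\<close> at \<open>H v\<close>. Injectivity forces at least
  \<open>d - 1\<close> jumps of the curve at almost every \<open>v\<close>; matching jumps gives \<open>y\<^sub>i \<bullet> H v = x\<^sub>i \<bullet> v\<close> with
  independent vertices \<open>x\<^sub>i\<close> of \<open>K\<close> and \<open>y\<^sub>i\<close> of \<open>L\<close>. These \<open>d - 1\<close> equations and the norm
  determine \<open>H\<close> locally up to sign, but do not make it linear: that comes from
  preservation of volume. So \<open>H\<close> is a continuous selection from finitely many orthogonal maps,
  as is its inverse; hence both are 1-Lipschitz along segments and \<open>H\<close> is an isometry.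
\<close>

section \<open>Additivity of the Euler characteristic\<close>

text \<open>Equality of push-forwards says nothing about a single direction, so partners are
  extracted from open sets of curves; compactness of the sphere makes the set of all curves of
  \<open>L\<close> closed, so its complement is such an open set. The resulting map is extended from
  the sphere to all vectors because volumes of boxes are easier to compare than surface areas.

  In linear coordinates built from matched vertices and a unit normal, equality of norms becomes
  \<open>(G u $ k)\<^sup>2 = (u $ k)\<^sup>2 + Q u\<close>, where the quadratic form
  \<open>Q\<close> ignores coordinate \<open>k\<close> and the other coordinates are fixed by
  \<open>G\<close>. Formally the Jacobian is \<open>u $ k / G u $ k\<close>. It has to be constant
  because the map preserves volume up to the change of coordinates, and this forces
  \<open>Q = 0\<close>. Boxes are used instead of derivatives, since \<open>G\<close> is known only
  to be continuous.\<close>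

lemma finite_gap_right:
  fixes Z :: "real set"
  assumes "finite Z"
  obtains s where "\<beta> < s" "\<And>z. z \<in> Z \<Longrightarrow> \<beta> < z \<Longrightarrow> s < z"
proof -
  let ?Z = "insert (\<beta> + 1) {z \<in> Z. \<beta> < z}"
  have Z: "finite ?Z" "\<beta> < Min ?Z" using assms by auto
  define s where "s = (\<beta> + Min ?Z) / 2"
  have "\<beta> < s" "s < Min ?Z" using Z(2) unfolding s_def by (simp_all only: field_simps)
  then show thesis
    using that[of s] Z(1) by (metis (no_types, lifting) Min_le insertCI less_le_trans mem_Collect_eq)
qed

text \<open>Compare the vanishing sum at a right endpoint \<beta> with its value at a point just
  after it: only the intervals ending at \<beta> change, and they drop out. So the weights with a
  common right endpoint cancel.\<close>

lemma interval_weights_sum: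
  fixes a b :: "'i \<Rightarrow> real" and c :: "'i \<Rightarrow> int"
  assumes "finite I" and ab: "\<And>i. i \<in> I \<Longrightarrow> a i \<le> b i"
    and z: "\<And>t. (\<Sum>i\<in>I. c i * indicator {a i..b i} t) = 0"
  shows "sum c I = 0"
proof -
  have "(\<Sum>i\<in>{i\<in>I. b i = \<beta>}. c i) = 0" for \<beta>
  proof -
    have "finite (a ` I \<union> b ` I)" using assms(1) by auto
    then obtain s where s: "\<beta> < s" "\<And>z. z \<in> a ` I \<union> b ` I \<Longrightarrow> \<beta> < z \<Longrightarrow> s < z"
      using finite_gap_right[of _ \<beta>] by metis
    have "c i * of_bool (b i = \<beta>) = c i * indicator {a i..b i} \<beta> - c i * indicator {a i..b i} s"
      if "i \<in> I" for i
    proof -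
      have "a i \<le> \<beta> \<longleftrightarrow> a i \<le> s" "b i > \<beta> \<longleftrightarrow> b i \<ge> s"
        using s(1) s(2)[of "a i"] s(2)[of "b i"] that by force+
      then show ?thesis
        using ab[OF that] s(1) by (auto simp: indicator_def)
    qed
    then have "(\<Sum>i\<in>I. c i * of_bool (b i = \<beta>))
        = (\<Sum>i\<in>I. c i * indicator {a i..b i} \<beta>) - (\<Sum>i\<in>I. c i * indicator {a i..b i} s)"
      by (simp add: sum_subtractf)
    then show ?thesis
      using assms(1) by (simp add: z sum.inter_filter of_bool_def if_distrib cong: if_cong)
  qed
  moreover have "sum c I = (\<Sum>\<beta>\<in>b ` I. \<Sum>i\<in>{i\<in>I. b i = \<beta>}. c i)"
    using assms(1) by (rule sum.image_gen)
  ultimately show ?thesis by simp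
qed

text \<open>Hadwiger's slicing argument. At each level \<open>t\<close> the weights of the sets
  meeting the hyperplane sum to zero by induction on dimension. A set meets it exactly when
  \<open>t\<close> lies in the interval onto which the set projects, so the interval case
  applies.\<close>

lemma compact_convex_weights_sum:
  fixes P :: "'i \<Rightarrow> 'a::euclidean_space set" and c :: "'i \<Rightarrow> int"
  assumes "finite I" and "\<And>i. i \<in> I \<Longrightarrow> compact (P i)" "\<And>i. i \<in> I \<Longrightarrow> convex (P i)"
    "\<And>i. i \<in> I \<Longrightarrow> P i \<noteq> {}"
    and "\<And>x. (\<Sum>i\<in>I. c i * indicator (P i) x) = 0"
  shows "sum c I = 0"
proof -
  \<comment> \<open>\<open>D\<close> holds the coordinates still free and \<open>s\<close>
    prescribes the others; slicing thus lowers the dimension without changing the type.\<close>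
  have *: "sum c I = 0"
    if "finite D" "D \<subseteq> Basis" "finite I" "\<And>i. i \<in> I \<Longrightarrow> compact (P i) \<and> convex (P i) \<and> P i \<noteq> {}"
    "\<And>x. (\<Sum>i\<in>I. c i * indicator (P i) x) = 0"
    "\<And>i. i \<in> I \<Longrightarrow> P i \<subseteq> {x. \<forall>j\<in>Basis - D. x \<bullet> j = s j}"
    for D s I and P :: "'i \<Rightarrow> 'a set"
    using that
  proof (induction D arbitrary: I P s rule: finite_induct)
    case empty
    define p where "p = (\<Sum>j\<in>Basis. s j *\<^sub>R j)"
    have "x = p" if "i \<in> I" "x \<in> P i" for i x
    proof (rule euclidean_eqI)
      fix j :: 'a assume "j \<in> Basis"
      then show "x \<bullet> j = p \<bullet> j"
        using empty(5)[OF that(1)] that(2) by (auto simp: p_def)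
    qed
    then have "p \<in> P i" if "i \<in> I" for i
      using empty(3)[OF that] that by auto
    then show ?case
      using empty(4)[of p] by simp
  next
    case (insert j D)
    define a where "a i = Inf ((\<lambda>x. x \<bullet> j) ` P i)" for i
    define b where "b i = Sup ((\<lambda>x. x \<bullet> j) ` P i)" for i
    have im: "(\<lambda>x. x \<bullet> j) ` P i = {a i..b i}" "a i \<le> b i" if "i \<in> I" for i
    proof -
      let ?Q = "(\<lambda>x. x \<bullet> j) ` P i"
      have Q: "compact ?Q" "?Q \<noteq> {}"
        using insert.prems(3)[OF that] by (auto intro!: compact_continuous_image continuous_intros)
      have "connected ?Q"
        using insert.prems(3)[OF that]
        by (intro connected_continuous_image convex_connected) (auto intro!: continuous_intros)
      then obtain u v where uv: "?Q = {u..v}"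
        using Q connected_compact_interval_1 by blast
      then have "u \<le> v" using Q by auto
      with uv show "?Q = {a i..b i}" "a i \<le> b i" by (auto simp: a_def b_def)
    qed
    have slice: "(\<Sum>i\<in>I. c i * indicator {a i..b i} t) = 0" for t
    proof -
      let ?J = "{i\<in>I. t \<in> {a i..b i}}"
      let ?P = "\<lambda>i. P i \<inter> {x. x \<bullet> j = t}"
      have "sum c ?J = 0"
      proof (rule insert.IH)
        show "D \<subseteq> Basis" "finite ?J" using insert by auto
        show "compact (?P i) \<and> convex (?P i) \<and> ?P i \<noteq> {}" if "i \<in> ?J" for i
        proof (intro conjI)
          have "closed {x. x \<bullet> j = t}" using closed_hyperplane[of j t] by (simp add: inner_commute)
          moreover have "convex {x. x \<bullet> j = t}" using convex_hyperplane[of j t] by (simp add: inner_commute)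
          ultimately show "compact (?P i)" "convex (?P i)"
            using insert.prems(3)[of i] that by (auto intro: convex_Int)
          have "t \<in> (\<lambda>x. x \<bullet> j) ` P i" using im(1)[of i] that by auto
          then show "?P i \<noteq> {}" by auto
        qed
        show "?P i \<subseteq> {x. \<forall>k\<in>Basis - D. x \<bullet> k = (s(j := t)) k}" if "i \<in> ?J" for i
          using insert.prems(5)[of i] that by auto
        show "(\<Sum>i\<in>?J. c i * indicator (?P i) x) = 0" for x
        proof (cases "x \<bullet> j = t")
          case True
          have "t \<in> {a i..b i}" if "i \<in> I" "x \<in> P i" for i
            using im(1)[OF that(1)] that(2) True by blast
          then have "(\<Sum>i\<in>?J. c i * indicator (?P i) x) = (\<Sum>i\<in>I. c i * indicator (P i) x)"
            using True insert.prems(2)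
            by (intro sum.mono_neutral_cong_left) (auto simp: indicator_def)
          then show ?thesis using insert.prems(4) by simp
        qed (simp add: indicator_def)
      qed
      then show ?thesis
        using insert.prems(2)
        by (simp add: sum.inter_filter indicator_def of_bool_def if_distrib cong: if_cong)
    qed
    show ?case
      using insert.prems(2) im(2) slice by (rule interval_weights_sum)
  qed
  show ?thesis
    by (rule *[of Basis I P]) (use assms in auto)
qed

section \<open>Moebius inversion over the faces of a complex\<close>

text \<open>Toggling one element of \<open>B - A\<close> is a sign-reversing involution, so all
  terms cancel unless the interval is a single set.\<close>

lemma sum_alternating_interval:
  assumes "finite B" "A \<subseteq> B"
  shows "(\<Sum>F\<in>{F. A \<subseteq> F \<and> F \<subseteq> B}. (-1) ^ card F) = (if A = B then (-1) ^ card A else (0::int))"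
proof (cases "A = B")
  case True
  then have "{F. A \<subseteq> F \<and> F \<subseteq> B} = {A}" by auto
  with True show ?thesis by simp
next
  case False
  with assms obtain b where b: "b \<in> B" "b \<notin> A" by auto
  let ?S = "{F. A \<subseteq> F \<and> F \<subseteq> B}"
  let ?T = "\<lambda>F. if b \<in> F then F - {b} else insert b F"
  have "(\<Sum>F\<in>?S. (-1) ^ card F) = (\<Sum>F\<in>?S. - ((-1::int) ^ card F))"
  proof (rule sum.reindex_bij_witness[where i = ?T and j = ?T])
    fix F assume F: "F \<in> ?S"
    then have "finite F" using assms finite_subset by auto
    with F b show "?T F \<in> ?S" by auto
    show "- ((-1::int) ^ card (?T F)) = (-1) ^ card F"
    proof (cases "b \<in> F")
      case True
      then have "card F = Suc (card (F - {b}))"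
        using \<open>finite F\<close> by (metis card.remove)
      then show ?thesis using True by (simp del: card_Diff_insert)
    qed (use \<open>finite F\<close> in simp)
  qed (use b in \<open>auto split: if_splits\<close>)
  then show ?thesis using False by (simp add: sum_negf)
qed

text \<open>A polyhedron enters all later arguments only through such a combination. Its total
  weight will be the Euler characteristic.\<close>

definition hull_weights :: "'a::euclidean_space set \<Rightarrow> 'a set set \<Rightarrow> ('a set \<Rightarrow> int) \<Rightarrow> bool" where
  "hull_weights P \<B> c \<longleftrightarrow> finite \<B> \<and> (\<forall>B\<in>\<B>. finite B \<and> B \<noteq> {}) \<and>
     (\<forall>x. indicator P x = (\<Sum>B\<in>\<B>. c B * indicator (convex hull B) x))"

text \<open>Passage to the abstract complex: a simplex is encoded by its extreme points. Affine
  independence makes the vertex set of a face unique, which turns intersections of simplices into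
  intersections of vertex sets.\<close>

lemma simplicial_complex_vertex_sets:
  assumes T: "simplicial_complex T"
  obtains \<B> where "finite \<B>" "bij_betw (\<lambda>B. convex hull B) \<B> (T - {{}})"
    "\<forall>B\<in>\<B>. \<not> affine_dependent B \<and> finite B \<and> B \<noteq> {}"
    "\<forall>B\<in>\<B>. \<forall>C\<subseteq>B. C \<noteq> {} \<longrightarrow> C \<in> \<B>"
    "\<forall>B\<in>\<B>. \<forall>C\<in>\<B>. convex hull B \<inter> convex hull C = convex hull (B \<inter> C)"
proof -
  define V where "V S = {x. x extreme_point_of S}" for S :: "'a set"
  have V: "V (convex hull B) = B" if "\<not> affine_dependent B" for B
    using extreme_point_of_convex_hull_affine_independent[OF that] by (auto simp: V_def)
  define \<B> where "\<B> = V ` (T - {{}})"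
  have finT: "finite T" and simp: "\<And>S. S \<in> T \<Longrightarrow> \<exists>n. n simplex S"
    and face: "\<And>F S. S \<in> T \<Longrightarrow> F face_of S \<Longrightarrow> F \<in> T"
    and int: "\<And>S S'. S \<in> T \<Longrightarrow> S' \<in> T \<Longrightarrow> S \<inter> S' face_of S"
    using T unfolding simplicial_complex_def by blast+
  have VS: "\<not> affine_dependent (V S) \<and> convex hull (V S) = S" if "S \<in> T" for S
  proof -
    obtain n C where "\<not> affine_dependent C" "S = convex hull C"
      using simp[OF \<open>S \<in> T\<close>] unfolding simplex_def by blast
    then show ?thesis using V by auto
  qed
  have B: "B \<in> \<B> \<longleftrightarrow> \<not> affine_dependent B \<and> convex hull B \<in> T - {{}}" for B
  proof
    assume "B \<in> \<B>"
    then obtain S where "S \<in> T - {{}}" "B = V S" by (auto simp: \<B>_def)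
    then show "\<not> affine_dependent B \<and> convex hull B \<in> T - {{}}" using VS by auto
  next
    assume "\<not> affine_dependent B \<and> convex hull B \<in> T - {{}}"
    then show "B \<in> \<B>" unfolding \<B>_def using V[of B] by blast
  qed
  show thesis
  proof (rule that; (intro ballI allI impI)?)
    show "finite \<B>" using finT by (simp add: \<B>_def)
    show "bij_betw (\<lambda>B. convex hull B) \<B> (T - {{}})"
      by (rule bij_betw_byWitness[where f' = V]) (use B V VS in \<open>auto simp: \<B>_def\<close>)
    show "\<not> affine_dependent B \<and> finite B \<and> B \<noteq> {}" if "B \<in> \<B>" for B
      using that B aff_independent_finite by auto
    show "C \<in> \<B>" if "B \<in> \<B>" "C \<subseteq> B" "C \<noteq> {}" for B C
    proof -
      have "convex hull C face_of convex hull B"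
        using that B face_of_convex_hull_affine_independent by blast
      then have "convex hull C \<in> T - {{}}" using face B that by auto
      then show ?thesis using B that affine_dependent_subset by blast
    qed
    show "convex hull B \<inter> convex hull C = convex hull (B \<inter> C)" if BC: "B \<in> \<B>" "C \<in> \<B>" for B C
    proof -
      let ?I = "convex hull B \<inter> convex hull C"
      have "?I face_of convex hull B" "?I face_of convex hull C"
        using int[of "convex hull B" "convex hull C"] int[of "convex hull C" "convex hull B"] BC B
        by (auto simp: Int_commute)
      then obtain D D' where D: "D \<subseteq> B" "?I = convex hull D" "D' \<subseteq> C" "?I = convex hull D'"
        using BC B face_of_convex_hull_affine_independent by metis
      have "D = D'"
        using V[of D] V[of D'] D BC B affine_dependent_subset by metis
      then have "?I \<subseteq> convex hull (B \<inter> C)"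
        using D by (metis hull_mono le_infI)
      then show ?thesis by (simp add: hull_mono subset_antisym)
    qed
  qed
qed

text \<open>After exchanging sums, the value at \<open>x\<close> is a signed sum over pairs
  \<open>M \<subseteq> F \<subseteq> A\<close>, with \<open>M\<close> the vertices of the smallest
  simplex containing \<open>x\<close>; only \<open>A = M\<close> survives. The same exchange without
  \<open>x\<close> leaves one sign per simplex, the one prescribed by its dimension.\<close>

lemma hull_weights_simplicial_complex:
  assumes T: "simplicial_complex T"
  obtains \<B> c where "hull_weights (\<Union>T) \<B> c" "\<Union>\<B> \<subseteq> complex_vertices T"
    "sum c \<B> = (\<Sum>S\<in>T - {{}}. (- 1) ^ nat (aff_dim S))"
proof -
  obtain \<B> where fin: "finite \<B>" and bij: "bij_betw (\<lambda>B. convex hull B) \<B> (T - {{}})"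
    and B': "\<forall>B\<in>\<B>. \<not> affine_dependent B \<and> finite B \<and> B \<noteq> {}"
    and sub': "\<forall>B\<in>\<B>. \<forall>C\<subseteq>B. C \<noteq> {} \<longrightarrow> C \<in> \<B>"
    and int': "\<forall>B\<in>\<B>. \<forall>C\<in>\<B>. convex hull B \<inter> convex hull C = convex hull (B \<inter> C)"
    by (rule simplicial_complex_vertex_sets[OF T]) (rule that)
  note B = bspec[OF B'] and sub = sub'[rule_format] and int = int'[rule_format]
  \<comment> \<open>The Moebius sign for the pair of \<open>F\<close> and \<open>B\<close>, split
    into two powers so that no difference of cardinalities is needed.\<close>
  define c :: "'a set \<Rightarrow> int" where
    "c F = (\<Sum>B | B \<in> \<B> \<and> F \<subseteq> B. (-1) ^ card B * (-1) ^ card F)" for F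
  have swap: "(\<Sum>F\<in>\<B>. c F * g F) =
      (\<Sum>B\<in>\<B>. (-1) ^ card B * (\<Sum>F | F \<in> \<B> \<and> F \<subseteq> B. (-1) ^ card F * g F))" for g :: "'a set \<Rightarrow> int"
  proof -
    have "(\<Sum>F\<in>\<B>. c F * g F) = (\<Sum>F\<in>\<B>. \<Sum>B | B \<in> \<B> \<and> F \<subseteq> B. (-1) ^ card B * ((-1) ^ card F * g F))"
      by (simp add: c_def sum_distrib_right mult.assoc)
    also have "\<dots> = (\<Sum>B\<in>\<B>. \<Sum>F | F \<in> \<B> \<and> F \<subseteq> B. (-1) ^ card B * ((-1) ^ card F * g F))"
      using fin fin by (rule sum.swap_restrict)
    finally show ?thesis by (simp add: sum_distrib_left)
  qed
  show thesis
  proof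
    show "\<Union>\<B> \<subseteq> complex_vertices T"
    proof
      fix x assume "x \<in> \<Union>\<B>"
      then have "{x} \<in> \<B>" using sub by auto
      then have "convex hull {x} \<in> T" using bij_betwE[OF bij] by blast
      then show "x \<in> complex_vertices T" by (simp add: complex_vertices_def)
    qed
    have "sum c \<B> = (\<Sum>B\<in>\<B>. (-1) ^ card B * (\<Sum>F | F \<in> \<B> \<and> F \<subseteq> B. (-1) ^ card F))"
      using swap[of "\<lambda>_. 1"] by simp
    also have "\<dots> = (\<Sum>B\<in>\<B>. (-1) ^ nat (aff_dim (convex hull B)))"
    proof (rule sum.cong)
      fix A assume A: "A \<in> \<B>"
      then have fA: "finite A" "A \<noteq> {}" "\<not> affine_dependent A" using B by auto
      \<comment> \<open>The empty face completes the Boolean interval, whose alternating sum is 0;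
        the empty face contributes 1, so the proper terms give -1.\<close>
      have "{F. {} \<subseteq> F \<and> F \<subseteq> A} = insert {} {F \<in> \<B>. F \<subseteq> A}"
        using sub[OF A] by auto
      moreover have "{} \<notin> {F \<in> \<B>. F \<subseteq> A}" using B by auto
      ultimately have "(\<Sum>F\<in>{F. {} \<subseteq> F \<and> F \<subseteq> A}. (-1) ^ card F)
          = 1 + (\<Sum>F | F \<in> \<B> \<and> F \<subseteq> A. (-1::int) ^ card F)"
        using fin by simp
      then have *: "(\<Sum>F | F \<in> \<B> \<and> F \<subseteq> A. (-1::int) ^ card F) = -1"
        using sum_alternating_interval[OF fA(1), of "{}"] fA(2) by auto
      have "aff_dim (convex hull A) = int (card A) - 1"
        using fA by (simp add: aff_dim_convex_hull aff_dim_affine_independent)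
      moreover have "card A = Suc (card A - 1)"
        using fA by (simp add: card_gt_0_iff)
      ultimately have "(-1::int) ^ card A = - ((-1) ^ nat (aff_dim (convex hull A)))"
        by (cases "card A") auto
      then show "(-1) ^ card A * (\<Sum>F | F \<in> \<B> \<and> F \<subseteq> A. (-1) ^ card F)
          = (-1::int) ^ nat (aff_dim (convex hull A))"
        using * by simp
    qed simp
    also have "\<dots> = (\<Sum>S\<in>T - {{}}. (- 1) ^ nat (aff_dim S))"
      by (rule sum.reindex_bij_betw[OF bij])
    finally show "sum c \<B> = (\<Sum>S\<in>T - {{}}. (- 1) ^ nat (aff_dim S))" .
    show "hull_weights (\<Union>T) \<B> c"
      unfolding hull_weights_def
    proof (intro conjI allI ballI)
      show "finite \<B>" by fact
      show "finite A" "A \<noteq> {}" if "A \<in> \<B>" for A using B[OF that] by auto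
      fix x
      have UT: "\<Union>T = (\<Union>B\<in>\<B>. convex hull B)"
        using bij unfolding bij_betw_def by auto
      show "indicator (\<Union>T) x = (\<Sum>B\<in>\<B>. c B * indicator (convex hull B) x)"
      proof (cases "x \<in> \<Union>T")
        case False
        then show ?thesis using UT by (auto simp: indicator_def intro!: sum.neutral[symmetric])
      next
        case True
        define \<X> where "\<X> = {B \<in> \<B>. x \<in> convex hull B}"
        have X: "finite \<X>" "\<X> \<noteq> {}" using True UT fin by (auto simp: \<X>_def)
        have closed: "A \<inter> C \<in> \<X>" if "A \<in> \<X>" "C \<in> \<X>" for A C
        proof -
          have x: "x \<in> convex hull (A \<inter> C)" using int that by (auto simp: \<X>_def)
          then have "A \<inter> C \<noteq> {}" by auto
          then show ?thesis using x sub[of A "A \<inter> C"] that by (auto simp: \<X>_def)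
        qed
        \<comment> \<open>The vertex set of the carrier of \<open>x\<close>; it exists because the
          simplices containing \<open>x\<close> are closed under intersection.\<close>
        define M where "M = \<Inter>\<X>"
        have "M \<in> \<X>"
        proof -
          have "\<Inter>Y \<in> \<X>" if "finite Y" "Y \<noteq> {}" "Y \<subseteq> \<X>" for Y
            using that by (induction Y rule: finite_ne_induct) (auto intro: closed)
          then show ?thesis using X by (auto simp: M_def)
        qed
        then have M: "M \<in> \<B>" "x \<in> convex hull M" by (auto simp: \<X>_def)
        have iff: "x \<in> convex hull A \<longleftrightarrow> M \<subseteq> A" if "A \<in> \<B>" for A
          using that M hull_mono[of M A convex] by (auto simp: M_def \<X>_def)
        have "(\<Sum>F | F \<in> \<B> \<and> F \<subseteq> A. (-1::int) ^ card F * indicator (convex hull F) x)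
            = (if A = M then (-1) ^ card M else 0)" if A: "A \<in> \<B>" for A
        proof -
          have fA: "finite A" using B[OF A] by simp
          have "(\<Sum>F | F \<in> \<B> \<and> F \<subseteq> A. (-1::int) ^ card F * indicator (convex hull F) x)
              = (\<Sum>F | M \<subseteq> F \<and> F \<subseteq> A. (-1) ^ card F)"
          proof (rule sum.mono_neutral_cong_right)
            show "finite {F \<in> \<B>. F \<subseteq> A}" using fin by simp
            show "{F. M \<subseteq> F \<and> F \<subseteq> A} \<subseteq> {F \<in> \<B>. F \<subseteq> A}"
              using sub[OF A] B[OF M(1)] by blast
          qed (use iff sub[OF A] B[OF M(1)] in \<open>auto simp: indicator_def\<close>)
          also have "\<dots> = (if A = M then (-1) ^ card M else 0)"
          proof (cases "M \<subseteq> A")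
            case True
            then show ?thesis using sum_alternating_interval[OF fA True] by auto
          next
            case False
            then have "{F. M \<subseteq> F \<and> F \<subseteq> A} = {}" "A \<noteq> M" by auto
            then show ?thesis by (simp only: sum.empty if_False)
          qed
          finally show ?thesis .
        qed
        then have "(\<Sum>F\<in>\<B>. c F * indicator (convex hull F) x)
            = (\<Sum>A\<in>\<B>. (-1) ^ card A * (if A = M then (-1) ^ card M else 0))"
          unfolding swap by (intro sum.cong) auto
        also have "\<dots> = (\<Sum>A\<in>\<B>. if A = M then 1 else 0)"
          by (intro sum.cong) (auto simp: power_mult_distrib[symmetric])
        also have "\<dots> = 1" using M(1) fin by simp
        finally show ?thesis using True by simp
      qed
    qed
  qed
qed

section \<open>Euler characteristics of sublevel sets\<close>

lemma compact_convex_weights_eq: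
  fixes P :: "'i \<Rightarrow> 'a::euclidean_space set" and Q :: "'j \<Rightarrow> 'a set" and c d :: "_ \<Rightarrow> int"
  assumes "finite I" "\<And>i. i \<in> I \<Longrightarrow> compact (P i) \<and> convex (P i) \<and> P i \<noteq> {}"
    and "finite J" "\<And>j. j \<in> J \<Longrightarrow> compact (Q j) \<and> convex (Q j) \<and> Q j \<noteq> {}"
    and "\<And>x. (\<Sum>i\<in>I. c i * indicator (P i) x) = (\<Sum>j\<in>J. d j * indicator (Q j) x)"
  shows "sum c I = sum d J"
proof -
  have "sum (case_sum c (\<lambda>j. - d j)) (I <+> J) = 0"
  proof (rule compact_convex_weights_sum)
    show "finite (I <+> J)" using assms by simp
    show "(\<Sum>k\<in>I <+> J. case_sum c (\<lambda>j. - d j) k * indicator (case_sum P Q k) x) = 0" for x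
      using assms(5)[of x] by (subst sum.Plus[OF assms(1,3)]) (simp only: sum.case o_def sum_negf mult_minus_left add.right_inverse)
  qed (use assms in auto)
  then show ?thesis
    using assms by (simp add: sum.Plus sum_negf)
qed

text \<open>This justifies the definite description in \<open>euler_char\<close>: each triangulation
  yields a combination whose total is its alternating sum, and by additivity any two combinations
  for the same set have equal totals.\<close>

lemma euler_char_eq_sum_weights:
  assumes T: "simplicial_complex T" "\<Union>T = P"
    and Q: "finite I" "\<And>i. i \<in> I \<Longrightarrow> compact (Q i) \<and> convex (Q i) \<and> Q i \<noteq> {}"
    and eq: "\<And>x. indicator P x = (\<Sum>i\<in>I. c i * indicator (Q i) x)"
  shows "euler_char P = sum c I"
proof -
  have *: "(\<Sum>S\<in>T - {{}}. (- 1) ^ nat (aff_dim S)) = sum c I"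
    if T: "simplicial_complex T" "\<Union>T = P" for T
  proof -
    obtain \<B> d where d: "hull_weights (\<Union>T) \<B> d"
      "sum d \<B> = (\<Sum>S\<in>T - {{}}. (- 1) ^ nat (aff_dim S))"
      using hull_weights_simplicial_complex[OF T(1)] by metis
    have "sum d \<B> = sum c I"
    proof (rule compact_convex_weights_eq)
      show "compact (convex hull B) \<and> convex (convex hull B) \<and> convex hull B \<noteq> {}"
        if "B \<in> \<B>" for B
        using d(1) that by (auto simp: hull_weights_def finite_imp_compact_convex_hull)
      show "(\<Sum>B\<in>\<B>. d B * indicator (convex hull B) x) = (\<Sum>i\<in>I. c i * indicator (Q i) x)" for x
        using d(1) eq T(2) unfolding hull_weights_def by metis
    qed (use d(1) Q in \<open>auto simp: hull_weights_def\<close>)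
    then show ?thesis using d(2) by simp
  qed
  show ?thesis
    unfolding euler_char_def by (rule the_equality) (use T * in auto)
qed

text \<open>Supplies the triangulation that evaluating \<open>euler_char\<close> on a sublevel set
  requires. The simplices cut by the halfspace meet face to face, as a slice of a face is a face of
  the slice, and such a polytopal complex can be subdivided.\<close>

lemma simplicial_complex_sublevel_triangulable:
  fixes v :: "'a::euclidean_space"
  assumes K: "simplicial_complex K"
  obtains T where "simplicial_complex T" "\<Union>T = {y \<in> \<Union>K. y \<bullet> v \<le> t}"
proof -
  define H where "H = {y. y \<bullet> v \<le> t}"
  have H: "H = {y. v \<bullet> y \<le> t}" by (simp add: H_def inner_commute)
  have K': "finite K" "\<And>S. S \<in> K \<Longrightarrow> polytope S" "\<And>S S'. S \<in> K \<Longrightarrow> S' \<in> K \<Longrightarrow> S \<inter> S' face_of S"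
    using K simplex_imp_polytope unfolding simplicial_complex_def by blast+
  have "\<exists>T. simplicial_complex T \<and> \<Union>T = \<Union>((\<lambda>S. S \<inter> H) ` K)"
  proof (rule simplicial_subdivision_of_cell_complex[of "(\<lambda>S. S \<inter> H) ` K"])
    show "finite ((\<lambda>S. S \<inter> H) ` K)" using K' by simp
    show "polytope C" if "C \<in> (\<lambda>S. S \<inter> H) ` K" for C
      using that K'(2) by (auto simp: H intro!: polytope_Int_polyhedron polyhedron_halfspace_le)
    show "C1 \<inter> C2 face_of C1" if C: "C1 \<in> (\<lambda>S. S \<inter> H) ` K" "C2 \<in> (\<lambda>S. S \<inter> H) ` K" for C1 C2
    proof -
      obtain S1 S2 where S: "S1 \<in> K" "S2 \<in> K" "C1 = S1 \<inter> H" "C2 = S2 \<inter> H" using C by auto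
      have "(S1 \<inter> S2) \<inter> H face_of S1 \<inter> H"
        using K'(3)[OF S(1,2)] by (rule face_of_slice) (simp add: H convex_halfspace_le)
      then show ?thesis using S by (simp add: Int_ac)
    qed
  qed blast
  moreover have "\<Union>((\<lambda>S. S \<inter> H) ` K) = {y \<in> \<Union>K. y \<bullet> v \<le> t}"
    by (auto simp: H_def)
  ultimately show thesis using that by auto
qed

lemma convex_hull_meets_halfspace:
  "(\<exists>y\<in>convex hull B. y \<bullet> v \<le> t) \<longleftrightarrow> (\<exists>y\<in>B. y \<bullet> v \<le> t)"
proof
  assume "\<exists>y\<in>convex hull B. y \<bullet> v \<le> t"
  moreover have "convex hull B \<subseteq> {y. v \<bullet> y > t}" if "\<not> (\<exists>y\<in>B. y \<bullet> v \<le> t)"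
    using that by (intro hull_minimal convex_halfspace_gt) (auto simp: inner_commute not_le)
  ultimately show "\<exists>y\<in>B. y \<bullet> v \<le> t" by (force simp: inner_commute)
qed (use hull_inc in fastforce)

text \<open>A hull cut by the halfspace stays compact and convex, so it contributes its weight once
  if it is nonempty; it is nonempty exactly when some point of \<open>B\<close> lies in the
  halfspace.\<close>

lemma ECT_hull_weights:
  assumes K: "simplicial_complex K" and c: "hull_weights (\<Union>K) \<B> c"
  shows "ECT (\<Union>K) v t = (\<Sum>B\<in>\<B>. c B * of_bool (\<exists>y\<in>B. y \<bullet> v \<le> t))"
proof -
  let ?P = "{y \<in> \<Union>K. y \<bullet> v \<le> t}" and ?H = "{y. y \<bullet> v \<le> t}"
  let ?\<B> = "{B \<in> \<B>. \<exists>y\<in>B. y \<bullet> v \<le> t}"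
  have H: "closed ?H" "convex ?H"
    using closed_halfspace_le[of v t] convex_halfspace_le[of v t] by (simp_all add: inner_commute)
  have \<B>: "finite \<B>" "\<And>B. B \<in> \<B> \<Longrightarrow> finite B"
    and ind: "\<And>x. indicator (\<Union>K) x = (\<Sum>B\<in>\<B>. c B * indicator (convex hull B) x)"
    using c unfolding hull_weights_def by auto
  obtain T where T: "simplicial_complex T" "\<Union>T = ?P"
    using simplicial_complex_sublevel_triangulable[OF K] by blast
  have "euler_char ?P = sum c ?\<B>"
  proof (rule euler_char_eq_sum_weights[OF T])
    show "finite ?\<B>" using \<B> by simp
    show "compact (convex hull B \<inter> ?H) \<and> convex (convex hull B \<inter> ?H) \<and> convex hull B \<inter> ?H \<noteq> {}"
      if "B \<in> ?\<B>" for B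
    proof (intro conjI)
      show "compact (convex hull B \<inter> ?H)"
        using that \<B> H by (auto intro!: compact_Int_closed finite_imp_compact_convex_hull)
      show "convex (convex hull B \<inter> ?H)" using H by (intro convex_Int) auto
      show "convex hull B \<inter> ?H \<noteq> {}"
        using that convex_hull_meets_halfspace[of B v t] by auto
    qed
    show "indicator ?P x = (\<Sum>B\<in>?\<B>. c B * indicator (convex hull B \<inter> ?H) x)" for x
    proof (cases "x \<bullet> v \<le> t")
      case True
      have "(\<Sum>B\<in>?\<B>. c B * indicator (convex hull B \<inter> ?H) x) = (\<Sum>B\<in>\<B>. c B * indicator (convex hull B) x)"
      proof (rule sum.mono_neutral_cong_left)
        show "\<forall>B\<in>\<B> - ?\<B>. c B * indicator (convex hull B) x = 0"
          using convex_hull_meets_halfspace[of _ v t] True by (auto simp: indicator_def)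
      qed (use True \<B> in \<open>auto simp: indicator_def\<close>)
      also have "\<dots> = indicator (\<Union>K) x" using ind by simp
      finally show ?thesis using True by (simp add: indicator_def)
    qed (simp add: indicator_def)
  qed
  then show ?thesis
    using \<B> by (simp add: ECT_def sum.inter_filter of_bool_def if_distrib cong: if_cong)
qed

section \<open>Recovering a polyhedron from its curves\<close>

text \<open>Curves test only non-strict inequalities. Over finitely many heights, a strict bound is
  a non-strict bound at a slightly lower level.\<close>

lemma finite_threshold:
  fixes Z :: "real set"
  assumes "finite Z"
  obtains s where "s < \<tau>" "\<forall>z\<in>Z. z < \<tau> \<longleftrightarrow> z \<le> s"
proof -
  obtain s where "- \<tau> < s" "\<And>z. z \<in> uminus ` Z \<Longrightarrow> - \<tau> < z \<Longrightarrow> s < z"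
    using finite_gap_right[of "uminus ` Z" "- \<tau>"] assms by auto
  then show thesis
    by (intro that[of "- s"]) force+
qed

text \<open>At a point \<open>x\<close>, the functionals that separate \<open>x\<close> strictly from a hull form, after
  normalisation, a closed convex set, which is empty precisely when \<open>x\<close> lies in the hull.\<close>

lemma hull_weights_inversion:
  fixes B :: "'i \<Rightarrow> 'a::euclidean_space set" and c :: "'i \<Rightarrow> int"
  assumes I: "finite I" and B: "\<And>i. i \<in> I \<Longrightarrow> finite (B i) \<and> B i \<noteq> {}"
    and zero: "\<And>w t. norm w = 1 \<Longrightarrow> (\<Sum>i\<in>I. c i * of_bool (\<exists>y\<in>B i. y \<bullet> w \<le> t)) = 0"
  shows "(\<Sum>i\<in>I. c i * indicator (convex hull (B i)) x) = 0"
proof -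
  have finU: "finite (\<Union>i\<in>I. B i)" using I B by auto
  \<comment> \<open>At a level above all vertex heights every condition holds, so the vanishing
    curve reads off the total.\<close>
  have total: "sum c I = 0"
  proof -
    obtain w :: 'a where w: "norm w = 1" using vector_choose_size[of 1] by auto
    obtain M where M: "\<And>y. y \<in> (\<Union>i\<in>I. B i) \<Longrightarrow> norm y \<le> M"
      using finite_imp_bounded[OF finU] by (auto simp: bounded_iff)
    have "\<exists>y\<in>B i. y \<bullet> w \<le> M" if i: "i \<in> I" for i
    proof -
      obtain y where y: "y \<in> B i" using B[OF i] by auto
      have "y \<bullet> w \<le> norm y * norm w" by (rule norm_cauchy_schwarz)
      also have "\<dots> \<le> M" using w M y i by auto
      finally show ?thesis using y by auto
    qed
    then show ?thesis using zero[OF w, of M] by simp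
  qed
  define Q where "Q i = {v. \<forall>y\<in>B i. v \<bullet> (y - x) \<ge> 1}" for i
  define J where "J = {i \<in> I. x \<notin> convex hull (B i)}"
  have Q_closed: "closed (Q i)" "convex (Q i)" for i
  proof -
    have "Q i = (\<Inter>y\<in>B i. {v. (y - x) \<bullet> v \<ge> 1})" by (auto simp: Q_def inner_commute)
    then show "closed (Q i)" "convex (Q i)"
      by (auto intro!: closed_halfspace_ge convex_INT convex_halfspace_ge)
  qed
  have Q_empty: "Q i = {}" if "x \<in> convex hull (B i)" for i
  proof -
    have "v \<notin> Q i" for v
    proof
      assume "v \<in> Q i"
      then have "convex hull (B i) \<subseteq> {y. v \<bullet> y \<ge> 1 + v \<bullet> x}"
        by (intro hull_minimal convex_halfspace_ge) (auto simp: Q_def inner_diff_right)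
      with that show False by auto
    qed
    then show ?thesis by auto
  qed
  have "\<exists>v. v \<in> Q i" if i: "i \<in> J" for i
  proof -
    have "closed (convex hull (B i))" "x \<notin> convex hull (B i)"
      using i B by (auto simp: J_def finite_imp_compact_convex_hull compact_imp_closed)
    then obtain a b where ab: "a \<bullet> x < b" "\<And>y. y \<in> convex hull (B i) \<Longrightarrow> a \<bullet> y > b"
      using separating_hyperplane_closed_point[of "convex hull (B i)" x] by auto
    have "(a /\<^sub>R (b - a \<bullet> x)) \<bullet> (y - x) \<ge> 1" if "y \<in> B i" for y
    proof -
      have "(a /\<^sub>R (b - a \<bullet> x)) \<bullet> (y - x) = (a \<bullet> y - a \<bullet> x) / (b - a \<bullet> x)"
        by (simp add: inner_diff_right divide_inverse algebra_simps)
      then show ?thesis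
        using ab(1) ab(2)[OF hull_inc[OF that]] by simp
    qed
    then have "a /\<^sub>R (b - a \<bullet> x) \<in> Q i" unfolding Q_def by blast
    then show ?thesis ..
  qed
  then obtain q where q: "\<And>i. i \<in> J \<Longrightarrow> q i \<in> Q i" by metis
  \<comment> \<open>A ball meeting each nonempty \<open>Q i\<close> restores the compactness needed
    for additivity.\<close>
  have "finite J" using I by (simp add: J_def)
  then have "bounded (q ` J)" by (simp add: finite_imp_bounded)
  then obtain R where R: "\<And>i. i \<in> J \<Longrightarrow> norm (q i) \<le> R"
    by (auto simp: bounded_iff)
  have "sum c J = 0"
  proof (rule compact_convex_weights_sum)
    show "finite J" by fact
    show "compact (Q i \<inter> cball 0 R)" "convex (Q i \<inter> cball 0 R)" for i
      using Q_closed by (auto intro: closed_Int_compact convex_Int)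
    show "Q i \<inter> cball 0 R \<noteq> {}" if "i \<in> J" for i
      using q[OF that] R[OF that] by (auto intro!: exI[of _ "q i"] simp flip: ex_in_conv)
    show "(\<Sum>i\<in>J. c i * indicator (Q i \<inter> cball 0 R) v) = 0" for v
    proof (cases "v = 0 \<or> norm v > R")
      case True
      then have "v \<notin> Q i \<inter> cball 0 R" if "i \<in> J" for i
        using B[of i] that by (auto simp: Q_def J_def)
      then show ?thesis by (auto simp: indicator_def intro!: sum.neutral)
    next
      case False
      define w where "w = v /\<^sub>R norm v"
      \<comment> \<open>Dividing by the norm of \<open>v\<close>, membership in \<open>Q i\<close>
        says that all heights of \<open>B i\<close> in direction \<open>w\<close> are at least
        \<tau>. Its negation is strict, which is why the level \<open>s\<close> is
        introduced.\<close>
      define \<tau> where "\<tau> = (1 + v \<bullet> x) / norm v"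
      have w: "norm w = 1" using False by (simp add: w_def)
      obtain s where s: "\<forall>z\<in>(\<lambda>y. y \<bullet> w) ` (\<Union>i\<in>I. B i). z < \<tau> \<longleftrightarrow> z \<le> s"
        by (rule finite_threshold[OF finite_imageI[OF finU]])
      have iff: "v \<in> Q i \<longleftrightarrow> \<not> (\<exists>y\<in>B i. y \<bullet> w \<le> s)" if "i \<in> I" for i
      proof -
        have "v \<bullet> (y - x) \<ge> 1 \<longleftrightarrow> \<not> y \<bullet> w < \<tau>" for y
          using False by (auto simp: w_def \<tau>_def inner_diff_right field_simps inner_commute)
        then show ?thesis using s that by (auto simp: Q_def)
      qed
      have "(\<Sum>i\<in>J. c i * indicator (Q i \<inter> cball 0 R) v) = (\<Sum>i\<in>I. c i * indicator (Q i \<inter> cball 0 R) v)"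
        using I Q_empty by (intro sum.mono_neutral_left) (auto simp: J_def indicator_def)
      also have "\<dots> = (\<Sum>i\<in>I. c i - c i * of_bool (\<exists>y\<in>B i. y \<bullet> w \<le> s))"
        using False iff by (intro sum.cong) (auto simp: indicator_def)
      also have "\<dots> = 0" using total zero[OF w] by (simp add: sum_subtractf)
      finally show ?thesis .
    qed
  qed
  moreover have "(\<Sum>i\<in>I. c i * indicator (convex hull (B i)) x) = sum c I - sum c J"
    using I by (simp add: J_def sum.inter_filter sum_subtractf[symmetric] indicator_def of_bool_def if_distrib cong: if_cong)
       (auto intro!: sum.cong)
  ultimately show ?thesis using total by simp
qed

section \<open>Topology of Euler curves\<close>

text \<open>The interval is open at \<open>s\<close>, so \<open>s\<close> itself may be a break
  point: this encodes right continuity.\<close>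

lemma euler_curve_break_points:
  assumes "f \<in> euler_curves"
  obtains Z where "finite Z" "\<And>s t. s \<le> t \<Longrightarrow> {s<..t} \<inter> Z = {} \<Longrightarrow> f s = f t"
proof -
  obtain J c where J: "finite J" "J \<subseteq> half_open_intervals" and f: "f = (\<lambda>t. \<Sum>I\<in>J. c I * indicator I t)"
    using assms unfolding euler_curves_def by auto
  have "\<exists>z. finite z \<and> (\<forall>s t. s \<le> t \<longrightarrow> {s<..t} \<inter> z = {} \<longrightarrow> (s \<in> I \<longleftrightarrow> t \<in> I))" if "I \<in> J" for I
  proof -
    from J(2) that consider a b where "I = {a..<b}" | a where "I = {a..}"
      unfolding half_open_intervals_def by auto
    then show ?thesis
    proof cases
      case (1 a b)
      then show ?thesis by (intro exI[of _ "{a, b}"]) auto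
    next
      case (2 a)
      then show ?thesis by (intro exI[of _ "{a}"]) auto
    qed
  qed
  then obtain z where z: "\<And>I. I \<in> J \<Longrightarrow> finite (z I)"
    "\<And>I s t. I \<in> J \<Longrightarrow> s \<le> t \<Longrightarrow> {s<..t} \<inter> z I = {} \<Longrightarrow> s \<in> I \<longleftrightarrow> t \<in> I"
    by metis
  show thesis
  proof
    show "finite (\<Union>I\<in>J. z I)" using J z by auto
    show "f s = f t" if "s \<le> t" "{s<..t} \<inter> (\<Union>I\<in>J. z I) = {}" for s t
      unfolding f
    proof (rule sum.cong)
      fix I assume "I \<in> J"
      then have "s \<in> I \<longleftrightarrow> t \<in> I" using z(2)[of I s t] that by auto
      then show "c I * indicator I s = c I * indicator I t" by (simp add: indicator_def)
    qed simp
  qed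
qed

lemma euler_curve_measurable:
  assumes "f \<in> euler_curves"
  shows "(\<lambda>t. real_of_int (f t)) \<in> borel_measurable borel"
proof -
  obtain J c where J: "finite J" "J \<subseteq> half_open_intervals" and f: "f = (\<lambda>t. \<Sum>I\<in>J. c I * indicator I t)"
    using assms unfolding euler_curves_def by auto
  have [measurable]: "I \<in> sets borel" if "I \<in> J" for I
    using J(2) that unfolding half_open_intervals_def by auto
  have "(\<lambda>t. real_of_int (f t)) = (\<lambda>t. \<Sum>I\<in>J. real_of_int (c I) * indicator I t)"
    by (auto simp: f indicator_def intro!: sum.cong)
  also have "\<dots> \<in> borel_measurable borel" by measurable
  finally show ?thesis .
qed

lemma euler_curve_neq_sets:
  assumes "f \<in> euler_curves" "g \<in> euler_curves"
  shows "{t. f t \<noteq> g t} \<in> sets borel"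
proof -
  note [measurable] = euler_curve_measurable[OF assms(1)] euler_curve_measurable[OF assms(2)]
  have "{t. f t \<noteq> g t} = {t \<in> space borel. real_of_int (f t) \<noteq> real_of_int (g t)}" by simp
  also have "\<dots> \<in> sets borel" by measurable
  finally show ?thesis .
qed

text \<open>By right continuity a disagreement at \<open>t\<close> persists on some
  \<open>{t..s}\<close> with \<open>t < s\<close>, which has positive measure.\<close>

lemma euler_curves_eqI:
  assumes f: "f \<in> euler_curves" and g: "g \<in> euler_curves"
    and null: "emeasure lborel {t. f t \<noteq> g t} = 0"
  shows "f = g"
proof
  fix t
  obtain Z where Z: "finite Z" "\<And>s t. s \<le> t \<Longrightarrow> {s<..t} \<inter> Z = {} \<Longrightarrow> f s = f t"
    using euler_curve_break_points[OF f] by metis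
  obtain Y where Y: "finite Y" "\<And>s t. s \<le> t \<Longrightarrow> {s<..t} \<inter> Y = {} \<Longrightarrow> g s = g t"
    using euler_curve_break_points[OF g] by metis
  obtain s where s: "t < s" "\<And>z. z \<in> Z \<union> Y \<Longrightarrow> t < z \<Longrightarrow> s < z"
    using finite_gap_right[of "Z \<union> Y" t] Z(1) Y(1) by auto
  show "f t = g t"
  proof (rule ccontr)
    assume neq: "f t \<noteq> g t"
    have "{t..s} \<subseteq> {t. f t \<noteq> g t}"
    proof safe
      fix r assume r: "r \<in> {t..s}" "f r = g r"
      have "f t = f r" using r s(2) by (intro Z(2)) force+
      moreover have "g t = g r" using r s(2) by (intro Y(2)) force+
      ultimately show False using neq r by simp
    qed
    then have "emeasure lborel {t..s} \<le> emeasure lborel {t. f t \<noteq> g t}"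
      using euler_curve_neq_sets[OF f g] by (intro emeasure_mono) auto
    then show False using null s(1) by simp
  qed
qed

text \<open>Distinct integers differ by at least 1, so the integrand dominates the indicator of the
  disagreement set. From here on the exponent matters only through the radius.\<close>

lemma Lp_edist_neq_measure:
  assumes fg: "f \<in> euler_curves" "g \<in> euler_curves" and p: "1 \<le> p" and e: "0 < e"
    and d: "Lp_edist p f g < ennreal e"
  shows "emeasure lborel {t. f t \<noteq> g t} < ennreal (e powr p)"
proof -
  define I where "I = (\<integral>\<^sup>+ t. ennreal (\<bar>real_of_int (f t) - real_of_int (g t)\<bar> powr p) \<partial>lborel)"
  have "I \<noteq> \<infinity>" using d by (auto simp: Lp_edist_def I_def[symmetric] Let_def)
  then have fin: "I < \<infinity>" by (simp add: less_top)
  have "enn2real I powr (1 / p) < e"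
    using d \<open>I \<noteq> \<infinity>\<close> e by (simp add: Lp_edist_def I_def[symmetric] Let_def ennreal_less_iff)
  then have "(enn2real I powr (1 / p)) powr p < e powr p"
    using p by (intro powr_less_mono2) auto
  then have "enn2real I < e powr p" using p by (simp add: powr_powr)
  then have I: "I < ennreal (e powr p)"
    using fin by (subst ennreal_enn2real[symmetric]) (auto simp: ennreal_less_iff)
  have "emeasure lborel {t. f t \<noteq> g t} = (\<integral>\<^sup>+ t. indicator {t. f t \<noteq> g t} t \<partial>lborel)"
    using euler_curve_neq_sets[OF fg] by simp
  also have "\<dots> \<le> I"
    unfolding I_def
  proof (rule nn_integral_mono)
    fix t
    show "indicator {t. f t \<noteq> g t} t \<le> ennreal (\<bar>real_of_int (f t) - real_of_int (g t)\<bar> powr p)"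
    proof (cases "f t = g t")
      case False
      then have "1 \<le> \<bar>real_of_int (f t) - real_of_int (g t)\<bar>" by linarith
      then have "1 \<le> \<bar>real_of_int (f t) - real_of_int (g t)\<bar> powr p"
        using p by (intro ge_one_powr_ge_zero) auto
      then show ?thesis using False by (simp add: ennreal_leI flip: ennreal_1)
    qed simp
  qed
  finally show ?thesis using I by (rule le_less_trans)
qed

text \<open>The converse estimate. A disagreement set of small measure forces a small distance only
  when the size of the difference is bounded, hence \<open>M\<close>.\<close>

lemma Lp_edist_less:
  assumes fg: "f \<in> euler_curves" "g \<in> euler_curves" and p: "1 \<le> p" and e: "0 < e"
    and M: "0 < M" "\<And>t. \<bar>real_of_int (f t) - real_of_int (g t)\<bar> \<le> M"
    and d: "emeasure lborel {t. f t \<noteq> g t} < ennreal ((e / M) powr p)"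
  shows "Lp_edist p f g < ennreal e"
proof -
  define I where "I = (\<integral>\<^sup>+ t. ennreal (\<bar>real_of_int (f t) - real_of_int (g t)\<bar> powr p) \<partial>lborel)"
  define D where "D = emeasure lborel {t. f t \<noteq> g t}"
  have "I \<le> (\<integral>\<^sup>+ t. ennreal (M powr p) * indicator {t. f t \<noteq> g t} t \<partial>lborel)"
    unfolding I_def
  proof (rule nn_integral_mono)
    fix t
    show "ennreal (\<bar>real_of_int (f t) - real_of_int (g t)\<bar> powr p)
        \<le> ennreal (M powr p) * indicator {t. f t \<noteq> g t} t"
    proof (cases "f t = g t")
      case False
      have "\<bar>real_of_int (f t) - real_of_int (g t)\<bar> powr p \<le> M powr p"
        using M(2) p by (intro powr_mono2) auto
      then show ?thesis using False by (simp add: ennreal_leI)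
    qed (use p in simp)
  qed
  also have "\<dots> = ennreal (M powr p) * D"
    using euler_curve_neq_sets[OF fg] by (simp add: nn_integral_cmult_indicator D_def)
  finally have "I \<le> ennreal (M powr p) * D" .
  also have "\<dots> < ennreal (M powr p) * ennreal ((e / M) powr p)"
    using d M(1) by (intro ennreal_mult_strict_left_mono) (auto simp: D_def)
  also have "\<dots> = ennreal (e powr p)"
    using M e by (simp add: ennreal_mult'[symmetric] powr_mult[symmetric])
  finally have I: "I < ennreal (e powr p)" .
  then have "I \<noteq> \<infinity>" by auto
  then have "enn2real I < e powr p"
    using I by (subst (asm) ennreal_enn2real[symmetric]) (auto simp: less_top ennreal_less_iff)
  then have "enn2real I powr (1 / p) < (e powr p) powr (1 / p)"
    using p by (intro powr_less_mono2) auto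
  then have "enn2real I powr (1 / p) < e" using p e by (simp add: powr_powr)
  then show ?thesis
    using \<open>I \<noteq> \<infinity>\<close> e by (simp add: Lp_edist_def I_def[symmetric] Let_def ennreal_less_iff)
qed

section \<open>Curves of weighted vertex sets\<close>

locale vertex_weights =
  fixes \<B> :: "'a::euclidean_space set set" and c :: "'a set \<Rightarrow> int"
  assumes finite_sets: "finite \<B>"
    and finite_set: "B \<in> \<B> \<Longrightarrow> finite B"
    and nonempty_set: "B \<in> \<B> \<Longrightarrow> B \<noteq> {}"
begin

text \<open>The negative of the support function of \<open>B\<close> at \<open>- v\<close>.\<close>

definition height :: "'a set \<Rightarrow> 'a \<Rightarrow> real" where
  "height B v = Min ((\<lambda>y. y \<bullet> v) ` B)"

definition curve :: "'a \<Rightarrow> real \<Rightarrow> int" where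
  "curve v t = (\<Sum>B\<in>\<B>. c B * of_bool (height B v \<le> t))"

lemma height_attained:
  assumes "B \<in> \<B>"
  shows "\<exists>y\<in>B. height B v = y \<bullet> v"
proof -
  have "height B v \<in> (\<lambda>y. y \<bullet> v) ` B"
    unfolding height_def using assms finite_set nonempty_set by (intro Min_in) auto
  then show ?thesis by blast
qed

lemma height_le: "B \<in> \<B> \<Longrightarrow> y \<in> B \<Longrightarrow> height B v \<le> y \<bullet> v"
  using finite_set by (simp add: height_def)

lemma height_le_iff: "B \<in> \<B> \<Longrightarrow> height B v \<le> t \<longleftrightarrow> (\<exists>y\<in>B. y \<bullet> v \<le> t)"
  using height_attained height_le by (metis order_trans)

lemma curve_alt: "curve v t = (\<Sum>B\<in>\<B>. c B * of_bool (\<exists>y\<in>B. y \<bullet> v \<le> t))"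
  unfolding curve_def by (intro sum.cong) (auto simp: height_le_iff)

lemma height_scaleR: "B \<in> \<B> \<Longrightarrow> 0 \<le> r \<Longrightarrow> height B (r *\<^sub>R v) = r * height B v"
  using height_attained[of B v] height_le[of B _ v] finite_set
  by (auto simp: height_def[of B "r *\<^sub>R v"] mult_left_mono intro!: Min_eqI)

lemma curve_scaleR: "0 < r \<Longrightarrow> curve (r *\<^sub>R v) (r * t) = curve v t"
  unfolding curve_def by (intro sum.cong) (auto simp: height_scaleR)

lemma continuous_on_height:
  assumes "B \<in> \<B>"
  shows "continuous_on S (height B)"
proof -
  have "continuous_on S (\<lambda>v. Min ((\<lambda>y. y \<bullet> v) ` B))" if "finite B" "B \<noteq> {}" for B :: "'a set"
    using that
  proof (induction B rule: finite_ne_induct)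
    case (insert x F)
    have "continuous_on S (\<lambda>v. min (x \<bullet> v) (Min ((\<lambda>y. y \<bullet> v) ` F)))"
      using insert by (intro continuous_intros)
    then show ?case using insert by simp
  qed (simp add: continuous_intros)
  then show ?thesis
    using assms finite_set nonempty_set by (simp add: height_def[abs_def])
qed

lemma curve_in_euler_curves: "curve v \<in> euler_curves"
proof -
  define J where "J = (\<lambda>B. {height B v..}) ` \<B>"
  \<comment> \<open>Several vertex sets may share a height. Their weights are merged because
    \<open>euler_curves\<close> indexes its summands by a set of intervals.\<close>
  define d where "d I = (\<Sum>B | B \<in> \<B> \<and> {height B v..} = I. c B)" for I
  have "curve v = (\<lambda>t. \<Sum>I\<in>J. d I * indicator I t)"
  proof
    fix t
    have "curve v t = (\<Sum>B\<in>\<B>. c B * indicator {height B v..} t)"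
      by (simp add: curve_def indicator_def of_bool_def)
    also have "\<dots> = (\<Sum>I\<in>J. \<Sum>B | B \<in> \<B> \<and> {height B v..} = I. c B * indicator {height B v..} t)"
      unfolding J_def by (rule sum.image_gen) (rule finite_sets)
    also have "\<dots> = (\<Sum>I\<in>J. d I * indicator I t)"
      unfolding d_def sum_distrib_right by (intro sum.cong) auto
    finally show "curve v t = (\<Sum>I\<in>J. d I * indicator I t)" .
  qed
  moreover have "finite J" "J \<subseteq> half_open_intervals"
    using finite_sets by (auto simp: J_def half_open_intervals_def)
  ultimately show ?thesis unfolding euler_curves_def by blast
qed

definition height_dist :: "'a \<Rightarrow> 'a \<Rightarrow> real" where
  "height_dist v w = (\<Sum>B\<in>\<B>. \<bar>height B v - height B w\<bar>)"

text \<open>The two curves can differ at \<open>t\<close> only if \<open>t\<close> lies between the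
  two heights of some \<open>B\<close>.\<close>

lemma emeasure_curve_neq: "emeasure lborel {t. curve v t \<noteq> curve w t} \<le> ennreal (height_dist v w)"
proof -
  let ?I = "\<lambda>B. {min (height B v) (height B w)..max (height B v) (height B w)}"
  have "emeasure lborel {t. curve v t \<noteq> curve w t} \<le> emeasure lborel (\<Union>B\<in>\<B>. ?I B)"
  proof (rule emeasure_mono)
    show "{t. curve v t \<noteq> curve w t} \<subseteq> (\<Union>B\<in>\<B>. ?I B)"
    proof (intro subsetI, rule ccontr)
      fix t assume "t \<in> {t. curve v t \<noteq> curve w t}" and t: "t \<notin> (\<Union>B\<in>\<B>. ?I B)"
      have "curve v t = curve w t"
        unfolding curve_def
      proof (rule sum.cong)
        fix B assume "B \<in> \<B>"
        with t have "t \<notin> ?I B" by blast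
        then have "height B v \<le> t \<longleftrightarrow> height B w \<le> t" by (auto simp: min_def max_def split: if_splits)
        then show "c B * of_bool (height B v \<le> t) = c B * of_bool (height B w \<le> t)" by simp
      qed simp
      with \<open>t \<in> {t. curve v t \<noteq> curve w t}\<close> show False by simp
    qed
    show "(\<Union>B\<in>\<B>. ?I B) \<in> sets lborel" using finite_sets by auto
  qed
  also have "\<dots> \<le> (\<Sum>B\<in>\<B>. emeasure lborel (?I B))"
    using finite_sets by (intro emeasure_subadditive_finite) auto
  also have "\<dots> = (\<Sum>B\<in>\<B>. ennreal \<bar>height B v - height B w\<bar>)"
    by (intro sum.cong) (auto simp: emeasure_lborel_Icc_eq min_def max_def)
  finally show ?thesis by (simp add: height_dist_def)
qed

lemma continuous_on_height_dist: "continuous_on S (\<lambda>v. height_dist v w)"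
  unfolding height_dist_def by (intro continuous_intros continuous_on_height)

text \<open>Choose ever better approximations and a limit direction \<open>l\<close> in
  \<open>F\<close>. Disagreement measure obeys the triangle inequality, and near \<open>l\<close> it
  is controlled by \<open>height_dist\<close>, so \<open>f\<close> and the curve of \<open>l\<close>
  agree almost everywhere.\<close>

lemma curve_sequentially_closed:
  assumes f: "f \<in> euler_curves" and F: "compact F"
    and lim: "\<And>e. 0 < e \<Longrightarrow> \<exists>w\<in>F. emeasure lborel {t. f t \<noteq> curve w t} < ennreal e"
  shows "f \<in> curve ` F"
proof -
  have "\<forall>n. \<exists>w\<in>F. emeasure lborel {t. f t \<noteq> curve w t} < ennreal (1 / real (Suc n))"
    using lim by simp
  then obtain w where w: "\<And>n. w n \<in> F"
    "\<And>n. emeasure lborel {t. f t \<noteq> curve (w n) t} < ennreal (1 / real (Suc n))"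
    by metis
  obtain l r where l: "l \<in> F" "strict_mono r" "(w \<circ> r) \<longlonglongrightarrow> l"
    using F w(1) unfolding compact_def by blast
  have "isCont (\<lambda>v. height_dist v l) l"
    using continuous_on_height_dist[of UNIV l] by (simp add: continuous_on_eq_continuous_at)
  then have "(\<lambda>n. height_dist ((w \<circ> r) n) l) \<longlonglongrightarrow> height_dist l l"
    using l(3) isCont_tendsto_compose by blast
  then have lim0: "(\<lambda>n. height_dist (w (r n)) l) \<longlonglongrightarrow> 0" by (simp add: height_dist_def)
  have "emeasure lborel {t. f t \<noteq> curve l t} \<le> 0 + ennreal e" if "0 < e" for e
  proof -
    have "eventually (\<lambda>n. height_dist (w (r n)) l < e / 2) sequentially"
      using lim0 \<open>0 < e\<close> by (intro order_tendstoD) auto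
    moreover have "eventually (\<lambda>n. 1 / real (Suc n) < e / 2) sequentially"
      using order_tendstoD(2)[OF LIMSEQ_inverse_real_of_nat, of "e / 2"] \<open>0 < e\<close>
      by (simp add: inverse_eq_divide)
    ultimately obtain n where n: "height_dist (w (r n)) l < e / 2" "1 / real (Suc n) < e / 2"
      by (metis (mono_tags, lifting) eventually_conj eventually_happens' sequentially_bot)
    have "1 / real (Suc (r n)) \<le> 1 / real (Suc n)"
      using seq_suble[OF l(2), of n] by (simp add: frac_le)
    then have "emeasure lborel {t. f t \<noteq> curve (w (r n)) t} \<le> ennreal (e / 2)"
      using w(2)[of "r n"] n(2) by (meson ennreal_leI less_imp_le order_trans le_less_trans)
    moreover have "emeasure lborel {t. curve (w (r n)) t \<noteq> curve l t} \<le> ennreal (e / 2)"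
      using emeasure_curve_neq[of "w (r n)" l] n(1) by (meson ennreal_leI less_imp_le order_trans)
    ultimately have "emeasure lborel {t. f t \<noteq> curve (w (r n)) t}
        + emeasure lborel {t. curve (w (r n)) t \<noteq> curve l t} \<le> ennreal (e / 2) + ennreal (e / 2)"
      by (rule add_mono)
    also have "\<dots> = ennreal e" using that by (simp flip: ennreal_plus)
    finally have le: "emeasure lborel {t. f t \<noteq> curve (w (r n)) t}
        + emeasure lborel {t. curve (w (r n)) t \<noteq> curve l t} \<le> ennreal e" .
    have S: "{t. f t \<noteq> curve (w (r n)) t} \<in> sets lborel" "{t. curve (w (r n)) t \<noteq> curve l t} \<in> sets lborel"
      using euler_curve_neq_sets f curve_in_euler_curves by auto
    have "emeasure lborel {t. f t \<noteq> curve l t}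
        \<le> emeasure lborel ({t. f t \<noteq> curve (w (r n)) t} \<union> {t. curve (w (r n)) t \<noteq> curve l t})"
      using S by (intro emeasure_mono) auto
    also have "\<dots> \<le> emeasure lborel {t. f t \<noteq> curve (w (r n)) t}
        + emeasure lborel {t. curve (w (r n)) t \<noteq> curve l t}"
      using S by (rule emeasure_subadditive)
    finally show ?thesis using le by simp
  qed
  then have "emeasure lborel {t. f t \<noteq> curve l t} \<le> 0"
    by (rule ennreal_le_epsilon)
  then have "f = curve l"
    by (intro euler_curves_eqI f curve_in_euler_curves) simp
  then show ?thesis using l(1) by auto
qed

text \<open>Images of compact sets of directions are thus closed, which makes them admissible test
  sets for the push-forwards.\<close>

lemma Lp_open_compl_curve_image:
  assumes F: "compact F" and p: "1 \<le> p"
  shows "Lp_open p (euler_curves - curve ` F)"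
  unfolding Lp_open_def
proof (intro conjI ballI)
  fix f assume f: "f \<in> euler_curves - curve ` F"
  then obtain e where e: "0 < e" "\<And>w. w \<in> F \<Longrightarrow> \<not> emeasure lborel {t. f t \<noteq> curve w t} < ennreal e"
    using curve_sequentially_closed[OF _ F, of f] by auto
  show "\<exists>e>0. \<forall>g\<in>euler_curves. Lp_edist p f g < ennreal e \<longrightarrow> g \<in> euler_curves - curve ` F"
  \<comment> \<open>The radius is the one that the \<open>p\<close>-th power in
    \<open>Lp_edist_neq_measure\<close> turns back into \<open>e\<close>.\<close>
  proof (intro exI[of _ "e powr (1 / p)"] conjI ballI impI)
    show "0 < e powr (1 / p)" using e by simp
    fix g assume g: "g \<in> euler_curves" "Lp_edist p f g < ennreal (e powr (1 / p))"
    then have "emeasure lborel {t. f t \<noteq> g t} < ennreal ((e powr (1 / p)) powr p)"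
      using f p e(1) by (intro Lp_edist_neq_measure) auto
    then have "emeasure lborel {t. f t \<noteq> g t} < ennreal e"
      using p e(1) by (simp add: powr_powr)
    then have "g \<notin> curve ` F" using e(2) by auto
    then show "g \<in> euler_curves - curve ` F" using g by simp
  qed
qed auto

lemma curve_image_sets:
  assumes F: "compact F" and p: "1 \<le> p"
  shows "curve ` F \<in> sets (euler_curve_borel p)"
proof -
  have "euler_curves - curve ` F \<in> sets (euler_curve_borel p)"
    using Lp_open_compl_curve_image[OF F p] by (simp add: sets_euler_curve_borel sigma_sets.Basic)
  then have "space (euler_curve_borel p) - (euler_curves - curve ` F) \<in> sets (euler_curve_borel p)"
    by (rule sets.compl_sets)
  moreover have "space (euler_curve_borel p) - (euler_curves - curve ` F) = curve ` F"
    using curve_in_euler_curves by (auto simp: space_euler_curve_borel)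
  ultimately show ?thesis by simp
qed

lemma abs_curve_diff_le: "\<bar>real_of_int (curve v t) - real_of_int (curve w t)\<bar> \<le> (\<Sum>B\<in>\<B>. \<bar>real_of_int (c B)\<bar>)"
proof -
  have "real_of_int (curve v t) - real_of_int (curve w t)
      = (\<Sum>B\<in>\<B>. real_of_int (c B) * (of_bool (height B v \<le> t) - of_bool (height B w \<le> t)))"
    by (simp add: curve_def sum_subtractf right_diff_distrib)
  also have "\<bar>\<dots>\<bar> \<le> (\<Sum>B\<in>\<B>. \<bar>real_of_int (c B)\<bar>)"
    by (rule order_trans[OF sum_abs]) (auto intro!: sum_mono simp: abs_mult)
  finally show ?thesis .
qed

text \<open>Continuity of the transform: nearby directions have nearby heights, hence a small
  disagreement set, and the weights bound the difference of the curves uniformly.\<close>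

lemma open_curve_vimage:
  assumes U: "Lp_open p U" and p: "1 \<le> p"
  shows "open (curve -` U)"
  unfolding open_dist
proof
  fix v assume v: "v \<in> curve -` U"
  then obtain e where e: "0 < e" "\<And>g. g \<in> euler_curves \<Longrightarrow> Lp_edist p (curve v) g < ennreal e \<Longrightarrow> g \<in> U"
    using U unfolding Lp_open_def by auto
  \<comment> \<open>The added 1 keeps the bound positive when all weights vanish.\<close>
  define M where "M = (\<Sum>B\<in>\<B>. \<bar>real_of_int (c B)\<bar>) + 1"
  have M: "0 < M" by (simp add: M_def sum_nonneg add_nonneg_pos)
  define \<epsilon> where "\<epsilon> = (e / M) powr p"
  have "0 < \<epsilon>" using e M by (simp add: \<epsilon>_def)
  have "isCont (\<lambda>w. height_dist w v) v"
    using continuous_on_height_dist[of UNIV v] by (simp add: continuous_on_eq_continuous_at)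
  then obtain d where d: "0 < d" "\<And>w. dist w v < d \<Longrightarrow> dist (height_dist w v) (height_dist v v) < \<epsilon>"
    using \<open>0 < \<epsilon>\<close> unfolding continuous_at_eps_delta dist_norm by (metis)
  show "\<exists>d>0. \<forall>w. dist w v < d \<longrightarrow> w \<in> curve -` U"
  proof (intro exI[of _ d] conjI allI impI)
    fix w assume "dist w v < d"
    then have "height_dist w v < \<epsilon>" using d(2)[of w] by (auto simp: height_dist_def dist_real_def)
    moreover have "height_dist v w = height_dist w v"
      by (simp add: height_dist_def abs_minus_commute)
    ultimately have "emeasure lborel {t. curve v t \<noteq> curve w t} < ennreal \<epsilon>"
      using emeasure_curve_neq[of v w] \<open>0 < \<epsilon>\<close> by (simp add: ennreal_lessI le_less_trans)
    then have "Lp_edist p (curve v) (curve w) < ennreal e"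
      using M e(1) p abs_curve_diff_le[THEN order_trans]
      by (intro Lp_edist_less[where M = M]) (auto simp: \<epsilon>_def M_def curve_in_euler_curves)
    then show "w \<in> curve -` U" using e(2) curve_in_euler_curves by auto
  qed (rule d(1))
qed

lemma curve_measurable:
  assumes p: "1 \<le> p"
  shows "curve \<in> measurable sphere_measure (euler_curve_borel p)"
  unfolding euler_curve_borel_def
proof (rule measurable_measure_of)
  show "{U. Lp_open p U} \<subseteq> Pow euler_curves" by (auto simp: Lp_open_def)
  show "curve \<in> space sphere_measure \<rightarrow> euler_curves" using curve_in_euler_curves by auto
  fix U assume "U \<in> {U. Lp_open p U}"
  then have "curve -` U \<in> sets borel" using open_curve_vimage p by auto
  then have "curve -` U \<inter> sphere 0 1 \<in> sets (restrict_space borel (sphere 0 1))"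
    by (auto simp: sets_restrict_space)
  then show "curve -` U \<inter> space sphere_measure \<in> sets sphere_measure"
    by (simp add: space_sphere_measure sets_sphere_measure)
qed

end

section \<open>Lebesgue measure\<close>

lemma emeasure_lborel_open_pos:
  fixes U :: "'a::euclidean_space set"
  assumes "open U" "U \<noteq> {}"
  shows "0 < emeasure lborel U"
proof -
  obtain x e where e: "0 < e" "cball x e \<subseteq> U"
    using assms open_contains_cball by blast
  have "0 < measure lborel (cball x e)" using e content_cball_pos by blast
  then have "0 < emeasure lborel (cball x e)"
    by (metis emeasure_eq_ennreal_measure ennreal_0 ennreal_less_iff emeasure_lborel_cball_finite infinity_ennreal_def less_irrefl order_refl)
  also have "\<dots> \<le> emeasure lborel U" using assms(1) e(2) by (intro emeasure_mono) auto
  finally show ?thesis .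
qed

lemma nn_integral_lborel_translate:
  fixes a :: "'a::euclidean_space"
  assumes [measurable]: "f \<in> borel_measurable borel"
  shows "(\<integral>\<^sup>+x. f (a + x) \<partial>lborel) = (\<integral>\<^sup>+x. f x \<partial>lborel)"
proof -
  have "(\<integral>\<^sup>+x. f x \<partial>lborel) = (\<integral>\<^sup>+x. f x \<partial>distr lborel borel ((+) a))"
    by (simp add: lborel_distr_plus)
  also have "\<dots> = (\<integral>\<^sup>+x. f (a + x) \<partial>lborel)"
    by (subst nn_integral_distr) auto
  finally show ?thesis by simp
qed

text \<open>Uniqueness of Haar measure: both sides of \<open>product\<close> arise from one double integral.\<close>

lemma lborel_linear_image:
  fixes f :: "'a::euclidean_space \<Rightarrow> 'a"
  assumes f: "linear f" "inj f"
  obtains c where "0 < c" "\<And>S. S \<in> sets borel \<Longrightarrow> emeasure lborel (f ` S) = ennreal c * emeasure lborel S"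
proof -
  obtain g where g: "linear g" "g \<circ> f = id" "f \<circ> g = id"
    using linear_injective_isomorphism[OF f] by (auto simp: fun_eq_iff)
  have gf: "g (f x) = x" "f (g x) = x" for x using g by (auto simp: fun_eq_iff)
  have [measurable]: "f \<in> borel_measurable borel" "g \<in> borel_measurable borel"
    using f g by (auto intro!: borel_measurable_continuous_onI linear_continuous_on linear_conv_bounded_linear[THEN iffD1])
  have im: "f ` S = g -` S" for S using gf by (auto intro!: image_eqI)
  have Nint: "emeasure lborel (f ` S) = (\<integral>\<^sup>+z. indicator S (g z) \<partial>lborel)" if [measurable]: "S \<in> sets borel" for S
  proof -
    have "(\<integral>\<^sup>+z. indicator S (g z) \<partial>lborel) = (\<integral>\<^sup>+z. indicator (f ` S) z \<partial>lborel)"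
      by (intro nn_integral_cong) (auto simp: im indicator_def)
    moreover have "f ` S \<in> sets borel"
      unfolding im using measurable_sets[of g borel borel S] by simp
    ultimately show ?thesis by simp
  qed
  have product: "emeasure lborel A * emeasure lborel (f ` uminus ` B) = emeasure lborel (f ` A) * emeasure lborel B"
    if [measurable]: "A \<in> sets borel" "B \<in> sets borel" for A B
  proof -
    \<comment> \<open>Integrating over \<open>y\<close> first replaces the factor of
      \<open>A\<close> by its volume. Substituting \<open>z\<close> by \<open>- f y + z\<close>
      first turns the kernel into \<open>indicator A (g z) * indicator B (y - g z)\<close>, and
      integrating over \<open>y\<close> then replaces the factor of \<open>B\<close> by its
      volume.\<close>
    let ?h = "\<lambda>(y, z). indicator A (y + g z) * indicator B (- g z) :: ennreal"
    have mB[measurable]: "uminus ` B \<in> sets borel"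
    proof -
      have "uminus ` B = uminus -` B" by (auto intro!: image_eqI)
      then show ?thesis using measurable_sets[of "uminus :: 'a \<Rightarrow> 'a" borel borel B] by simp
    qed
    have [measurable]: "?h \<in> borel_measurable (lborel \<Otimes>\<^sub>M lborel)" by measurable
    have "(\<integral>\<^sup>+z. (\<integral>\<^sup>+y. ?h (y, z) \<partial>lborel) \<partial>lborel) = (\<integral>\<^sup>+z. emeasure lborel A * indicator (uminus ` B) (g z) \<partial>lborel)"
    proof (rule nn_integral_cong)
      fix z
      have "(\<integral>\<^sup>+y. ?h (y, z) \<partial>lborel) = (\<integral>\<^sup>+y. indicator A (g z + y) \<partial>lborel) * indicator B (- g z)"
        by (simp add: nn_integral_multc add.commute)
      also have "(\<integral>\<^sup>+y. indicator A (g z + y) \<partial>lborel) = emeasure lborel A"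
        using nn_integral_lborel_translate[of "indicator A" "g z"] by simp
      also have "indicator B (- g z) = (indicator (uminus ` B) (g z) :: ennreal)"
        by (auto simp: indicator_def image_iff)
      finally show "(\<integral>\<^sup>+y. ?h (y, z) \<partial>lborel) = emeasure lborel A * indicator (uminus ` B) (g z)" .
    qed
    also have "\<dots> = emeasure lborel A * emeasure lborel (f ` uminus ` B)"
      by (simp add: nn_integral_cmult Nint[OF mB])
    finally have 1: "(\<integral>\<^sup>+z. (\<integral>\<^sup>+y. ?h (y, z) \<partial>lborel) \<partial>lborel) = emeasure lborel A * emeasure lborel (f ` uminus ` B)" .
    have "(\<integral>\<^sup>+y. (\<integral>\<^sup>+z. ?h (y, z) \<partial>lborel) \<partial>lborel)
        = (\<integral>\<^sup>+y. (\<integral>\<^sup>+z. indicator A (g z) * indicator B (y - g z) \<partial>lborel) \<partial>lborel)"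
    proof (rule nn_integral_cong)
      fix y
      have "(\<integral>\<^sup>+z. ?h (y, z) \<partial>lborel) = (\<integral>\<^sup>+z. ?h (y, - f y + z) \<partial>lborel)"
        by (rule nn_integral_lborel_translate[symmetric]) measurable
      also have "\<dots> = (\<integral>\<^sup>+z. indicator A (g z) * indicator B (y - g z) \<partial>lborel)"
        by (simp add: linear_diff[OF g(1)] gf)
      finally show "(\<integral>\<^sup>+z. ?h (y, z) \<partial>lborel) = (\<integral>\<^sup>+z. indicator A (g z) * indicator B (y - g z) \<partial>lborel)" .
    qed
    also have "\<dots> = (\<integral>\<^sup>+z. (\<integral>\<^sup>+y. indicator A (g z) * indicator B (y - g z) \<partial>lborel) \<partial>lborel)"
      by (rule lborel_pair.Fubini') measurable
    also have "\<dots> = (\<integral>\<^sup>+z. indicator A (g z) * emeasure lborel B \<partial>lborel)"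
    proof (rule nn_integral_cong)
      fix z
      have "(\<integral>\<^sup>+y. indicator B (y - g z) \<partial>lborel) = emeasure lborel B"
        using nn_integral_lborel_translate[of "indicator B" "- g z"] by simp
      then show "(\<integral>\<^sup>+y. indicator A (g z) * indicator B (y - g z) \<partial>lborel) = indicator A (g z) * emeasure lborel B"
        by (subst nn_integral_cmult) auto
    qed
    also have "\<dots> = emeasure lborel (f ` A) * emeasure lborel B"
      by (subst nn_integral_multc) (auto simp: Nint)
    finally have "(\<integral>\<^sup>+y. (\<integral>\<^sup>+z. ?h (y, z) \<partial>lborel) \<partial>lborel) = emeasure lborel (f ` A) * emeasure lborel B" .
    moreover have "(\<integral>\<^sup>+y. (\<integral>\<^sup>+z. ?h (y, z) \<partial>lborel) \<partial>lborel) = (\<integral>\<^sup>+z. (\<integral>\<^sup>+y. ?h (y, z) \<partial>lborel) \<partial>lborel)"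
      by (rule lborel_pair.Fubini'[symmetric]) measurable
    ultimately show ?thesis using 1 by simp
  qed
  \<comment> \<open>The ball equals its reflection and has positive finite volume, as does its
    image; so \<open>product\<close> can be solved for the scaling factor.\<close>
  let ?B = "ball 0 1 :: 'a set"
  have neg: "uminus ` ?B = ?B" by (auto simp: image_iff intro!: bexI[of _ "- _"])
  have "open (f ` ?B)" using f by (simp add: open_bijective_linear_image_eq linear_injective_imp_surjective bij_def)
  then have pos: "0 < emeasure lborel (f ` ?B)" "0 < emeasure lborel ?B"
    by (auto intro!: emeasure_lborel_open_pos)
  have fin: "emeasure lborel (f ` ?B) < \<infinity>" "emeasure lborel ?B < \<infinity>"
    using emeasure_bounded_finite[of "f ` ?B"] emeasure_bounded_finite[of ?B] f
    by (simp_all add: bounded_linear_image linear_conv_bounded_linear)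
  obtain a where a: "emeasure lborel (f ` ?B) = ennreal a" "0 < a"
    using pos(1) fin(1) by (cases "emeasure lborel (f ` ?B)") auto
  obtain b where b: "emeasure lborel ?B = ennreal b" "0 < b"
    using pos(2) fin(2) by (cases "emeasure lborel ?B") auto
  show thesis
  proof
    show "0 < a / b" using a b by simp
    fix S :: "'a set" assume "S \<in> sets borel"
    then have "emeasure lborel S * ennreal a = emeasure lborel (f ` S) * ennreal b"
      using product[of S ?B] neg a b by simp
    then have "emeasure lborel (f ` S) * (ennreal b * ennreal (1 / b)) = emeasure lborel S * (ennreal a * ennreal (1 / b))"
      by (metis mult.assoc)
    moreover have "ennreal b * ennreal (1 / b) = 1" "ennreal a * ennreal (1 / b) = ennreal (a / b)"
      using a b by (simp_all flip: ennreal_mult')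
    ultimately show "emeasure lborel (f ` S) = ennreal (a / b) * emeasure lborel S"
      by (simp add: mult.commute)
  qed
qed

text \<open>Sets given by a closed condition on the direction and a bound on the norm generate the
  Borel sets and are stable under intersection. On them the claim is the hypothesis on unit cones,
  rescaled by homogeneity.\<close>

lemma lborel_preserved_by_radial_map:
  fixes H :: "'a::euclidean_space \<Rightarrow> 'a"
  assumes cont: "continuous_on UNIV H" and norm: "\<And>x. norm (H x) = norm x"
    and homog: "\<And>r x. 0 < r \<Longrightarrow> H (r *\<^sub>R x) = r *\<^sub>R H x"
    and cones: "\<And>F. closed F \<Longrightarrow> F \<subseteq> sphere 0 1 \<Longrightarrow>
      emeasure lborel {r *\<^sub>R a | r a. a \<in> H -` F \<and> 0 < r \<and> r \<le> 1}
        = emeasure lborel {r *\<^sub>R a | r a. a \<in> F \<and> 0 < r \<and> r \<le> 1}"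
  shows "distr lborel borel H = lborel"
proof -
  have Hm[measurable]: "H \<in> borel_measurable borel" using cont by (rule borel_measurable_continuous_onI)
  \<comment> \<open>The quotient is 0 at the origin, so the origin belongs to some of these sets and
    not to others; it is a null set and is removed before comparing with cones.\<close>
  define X where "X F \<rho> = {x::'a. x /\<^sub>R norm x \<in> F \<and> norm x \<le> \<rho>}" for F \<rho>
  define E where "E = {X F \<rho> | F \<rho>. closed F}"
  have X_borel: "X F \<rho> \<in> sets borel" if "closed F" for F \<rho>
  proof -
    have [measurable]: "F \<in> sets borel" using that by simp
    have "X F \<rho> = {x \<in> space borel. x /\<^sub>R norm x \<in> F \<and> norm x \<le> \<rho>}" by (simp add: X_def)
    also have "\<dots> \<in> sets borel" by measurable
    finally show ?thesis .
  qed
  have gen: "sets borel = sigma_sets UNIV E"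
  proof
    show "sigma_sets UNIV E \<subseteq> sets borel"
      using sets.sigma_sets_subset[of E borel] X_borel by (auto simp: E_def)
    let ?M = "sigma UNIV E"
    have M: "sets ?M = sigma_sets UNIV E" "space ?M = UNIV" by (simp_all add: space_measure_of_conv)
    have EM: "X F \<rho> \<in> sets ?M" if "closed F" for F \<rho>
      using that by (auto simp: M E_def intro!: sigma_sets.Basic)
    have n: "norm \<in> borel_measurable ?M"
    proof (rule borel_measurable_iff_le[THEN iffD2], rule allI)
      fix a
      have "{w \<in> space ?M. norm w \<le> a} = X UNIV a" by (auto simp: X_def M)
      then show "{w \<in> space ?M. norm w \<le> a} \<in> sets ?M" using EM by simp
    qed
    have d: "(\<lambda>x. x /\<^sub>R norm x) \<in> measurable ?M borel"
      unfolding borel_eq_closed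
    proof (rule measurable_measure_of)
      fix F :: "'a set" assume "F \<in> Collect closed"
      then have F: "closed F" by simp
      have "(\<lambda>x. x /\<^sub>R norm x) -` F \<inter> space ?M = (\<Union>n::nat. X F (real n))"
        using real_arch_simple by (auto simp: X_def M)
      also have "\<dots> \<in> sets ?M" using EM[OF F] by (intro sets.countable_UN) blast
      finally show "(\<lambda>x. x /\<^sub>R norm x) -` F \<inter> space ?M \<in> sets ?M" .
    qed auto
    \<comment> \<open>A vector is recovered from its norm and direction, both measurable for the
      generated \<sigma>-algebra; measurability of the identity then gives all Borel sets.\<close>
    have "(\<lambda>x. norm x *\<^sub>R (x /\<^sub>R norm x)) \<in> borel_measurable ?M"
      using n d by (rule borel_measurable_scaleR)
    also have "(\<lambda>x. norm x *\<^sub>R (x /\<^sub>R norm x)) = (\<lambda>x::'a. x)"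
    proof
      show "norm x *\<^sub>R (x /\<^sub>R norm x) = x" for x :: 'a by (cases "x = 0") auto
    qed
    finally have "(\<lambda>x. x) \<in> borel_measurable ?M" .
    then show "sets borel \<subseteq> sigma_sets UNIV E"
      using measurable_sets[of "\<lambda>x. x" ?M borel] M by auto
  qed
  have eq: "emeasure lborel (H -` X F \<rho>) = emeasure lborel (X F \<rho>)" if F: "closed F" for F \<rho>
  proof -
    have HX: "H -` X F \<rho> \<in> sets borel"
      using measurable_sets[OF Hm X_borel[OF F]] by simp
    have drop0: "emeasure lborel A = emeasure lborel (A - {0})" if "A \<in> sets borel" for A :: "'a set"
      using that by (intro emeasure_Diff_null_set[symmetric]) auto
    show ?thesis
    proof (cases "0 < \<rho>")
      case False
      then have "X F \<rho> - {0} = {}" "H -` X F \<rho> - {0} = {}"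
        using norm by (auto simp: X_def) (meson norm_le_zero_iff not_less order_trans)+
      then show ?thesis
        using drop0[OF HX] drop0[OF X_borel[OF F]] by (simp only: emeasure_empty)
    next
      case True
      let ?F = "F \<inter> sphere 0 1"
      let ?T = "\<lambda>A. {r *\<^sub>R a | r a. a \<in> A \<and> 0 < r \<and> r \<le> 1}"
      have dir: "?T A = {x. x \<noteq> 0 \<and> x /\<^sub>R norm x \<in> A \<and> norm x \<le> 1}" if "A \<subseteq> sphere 0 1" for A
      proof safe
        fix x assume "x \<noteq> 0" "x /\<^sub>R norm x \<in> A" "norm x \<le> 1"
        then show "\<exists>r a. x = r *\<^sub>R a \<and> a \<in> A \<and> 0 < r \<and> r \<le> 1"
          by (intro exI[of _ "norm x"] exI[of _ "x /\<^sub>R norm x"]) auto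
      qed (use that in \<open>auto simp: subset_iff\<close>)
      have scale: "(\<lambda>x. \<rho> *\<^sub>R x) ` {x. x \<noteq> 0 \<and> x /\<^sub>R norm x \<in> A \<and> norm x \<le> 1}
          = {x. x \<noteq> 0 \<and> x /\<^sub>R norm x \<in> A \<and> norm x \<le> \<rho>}" for A
      proof (intro set_eqI iffI)
        fix x assume "x \<in> {x. x \<noteq> 0 \<and> x /\<^sub>R norm x \<in> A \<and> norm x \<le> \<rho>}"
        then show "x \<in> (\<lambda>x. \<rho> *\<^sub>R x) ` {x. x \<noteq> 0 \<and> x /\<^sub>R norm x \<in> A \<and> norm x \<le> 1}"
          using True by (intro image_eqI[of _ _ "x /\<^sub>R \<rho>"]) (auto simp: field_simps)
      next
        have cancel: "inverse \<rho> * b * \<rho> = b" for b using True by simp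
        fix x assume "x \<in> (\<lambda>x. \<rho> *\<^sub>R x) ` {x. x \<noteq> 0 \<and> x /\<^sub>R norm x \<in> A \<and> norm x \<le> 1}"
        then show "x \<in> {x. x \<noteq> 0 \<and> x /\<^sub>R norm x \<in> A \<and> norm x \<le> \<rho>}"
          using True by (auto simp: cancel mult_le_cancel_left1)
      qed
      \<comment> \<open>The scaling factor need not be computed, as it is the same for both
        cones.\<close>
      have "linear (\<lambda>x::'a. \<rho> *\<^sub>R x)" "inj (\<lambda>x::'a. \<rho> *\<^sub>R x)"
        using True by (auto simp: inj_def)
      then obtain c where c: "\<And>S. S \<in> sets borel \<Longrightarrow>
          emeasure lborel ((\<lambda>x::'a. \<rho> *\<^sub>R x) ` S) = ennreal c * emeasure lborel S"
        using lborel_linear_image by blast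
      have T_borel: "?T A \<in> sets borel" if "A \<subseteq> sphere 0 1" "closed A" for A :: "'a set"
      proof -
        have "?T A = X A 1 - {0}" unfolding dir[OF that(1)] by (auto simp: X_def)
        then show ?thesis using X_borel that by auto
      qed
      have XF: "X F \<rho> - {0} = (\<lambda>x. \<rho> *\<^sub>R x) ` ?T ?F"
        unfolding dir[OF Int_lower2] scale by (auto simp: X_def)
      have sub: "H -` ?F \<subseteq> sphere 0 1" using norm by auto
      have dirH: "H x /\<^sub>R norm (H x) = H (x /\<^sub>R norm x)" if "x \<noteq> 0" for x
        using that homog[of "inverse (norm x)" x] norm by simp
      have HXF: "H -` X F \<rho> - {0} = (\<lambda>x. \<rho> *\<^sub>R x) ` ?T (H -` ?F)"
      proof -
        have "x /\<^sub>R norm x \<in> H -` ?F \<longleftrightarrow> H x /\<^sub>R norm (H x) \<in> F" if "x \<noteq> 0" for x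
          using dirH[OF that] that norm[of "x /\<^sub>R norm x"] by simp
        then show ?thesis
          unfolding dir[OF sub] scale by (auto simp: X_def norm)
      qed
      have "closed (H -` ?F)" using cont F by (intro closed_vimage closed_Int) auto
      then show ?thesis
        using drop0[OF HX] drop0[OF X_borel[OF F]] c[OF T_borel[OF sub]] c[OF T_borel[of ?F]] cones[of ?F] F
        by (simp add: XF HXF closed_Int)
    qed
  qed
  show ?thesis
  proof (rule measure_eqI_generator_eq[where E = E and \<Omega> = UNIV and A = "\<lambda>n. X UNIV (real n)"])
    show "Int_stable E"
    proof (rule Int_stableI)
      fix A B assume "A \<in> E" "B \<in> E"
      then obtain F \<rho> G \<sigma> where "A = X F \<rho>" "B = X G \<sigma>" "closed F" "closed G" by (auto simp: E_def)
      then have "A \<inter> B = X (F \<inter> G) (min \<rho> \<sigma>)" "closed (F \<inter> G)" by (auto simp: X_def)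
      then show "A \<inter> B \<in> E" unfolding E_def by blast
    qed
    show "emeasure (distr lborel borel H) Y = emeasure lborel Y" if "Y \<in> E" for Y
      using that eq X_borel by (auto simp: E_def emeasure_distr)
    show "range (\<lambda>n. X UNIV (real n)) \<subseteq> E" by (auto simp: E_def)
    show "(\<Union>n. X UNIV (real n)) = UNIV" using real_arch_simple by (auto simp: X_def)
    show "emeasure (distr lborel borel H) (X UNIV (real n)) \<noteq> \<infinity>" for n
    proof -
      have "X UNIV (real n) = cball 0 (real n)" by (auto simp: X_def)
      moreover have "emeasure (distr lborel borel H) (X UNIV (real n)) = emeasure lborel (X UNIV (real n))"
        using eq[of UNIV] X_borel[of UNIV] by (simp add: emeasure_distr)
      ultimately show ?thesis using emeasure_lborel_cball_finite[of 0 "real n"] by (simp add: less_top)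
    qed
  qed (use gen in auto)
qed

section \<open>Rigidity from volumes of thin boxes\<close>

lemma emeasure_cbox_slab:
  fixes z :: "real ^ 'd"
  assumes "a \<le> b" "0 \<le> r"
  shows "emeasure lborel (cbox (\<chi> i. if i = k then a else z $ i - r) (\<chi> i. if i = k then b else z $ i + r))
    = ennreal ((2 * r) ^ (CARD('d) - 1) * (b - a))"
proof -
  let ?l = "\<chi> i. if i = k then a else z $ i - r" and ?u = "\<chi> i. if i = k then b else z $ i + r"
  have "emeasure lborel (cbox ?l ?u) = ennreal (measure lborel (cbox ?l ?u))"
    using emeasure_lborel_cbox_finite[of ?l ?u] by (intro emeasure_eq_ennreal_measure) (simp add: less_top)
  also have "measure lborel (cbox ?l ?u) = (\<Prod>i\<in>UNIV. ?u $ i - ?l $ i)"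
    using assms by (intro content_cbox_cart) (auto simp: interval_ne_empty_cart)
  also have "\<dots> = (?u $ k - ?l $ k) * (\<Prod>i\<in>UNIV - {k}. ?u $ i - ?l $ i)"
    by (rule prod.remove) auto
  also have "(\<Prod>i\<in>UNIV - {k}. ?u $ i - ?l $ i) = (\<Prod>i\<in>UNIV - {k}. 2 * r)"
    by (intro prod.cong) auto
  finally show ?thesis by (simp add: card_Diff_singleton mult.commute)
qed

text \<open>Comparing the volumes of thin boxes and of their images shows that \<open>s \<mapsto> sqrt (s\<^sup>2 + Q)\<close>
  is affine on an interval, which forces \<open>Q = 0\<close>.\<close>

lemma volume_scaling_imp_offset_zero:
  fixes G :: "real ^ 'd \<Rightarrow> real ^ 'd" and Q :: "real ^ 'd \<Rightarrow> real"
  assumes W: "open W" "z \<in> W" and G: "continuous_on W G"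
    and Gi: "\<And>u i. u \<in> W \<Longrightarrow> i \<noteq> k \<Longrightarrow> G u $ i = u $ i"
    and pos: "\<And>u. u \<in> W \<Longrightarrow> 0 < u $ k" "\<And>u. u \<in> W \<Longrightarrow> 0 < G u $ k"
    and sq: "\<And>u. u \<in> W \<Longrightarrow> (G u $ k)\<^sup>2 = (u $ k)\<^sup>2 + Q u"
    and Q: "continuous_on UNIV Q" "\<And>u v. (\<And>i. i \<noteq> k \<Longrightarrow> u $ i = v $ i) \<Longrightarrow> Q u = Q v"
    and \<gamma>: "0 < \<gamma>" "\<And>a b. cbox a b \<subseteq> W \<Longrightarrow> emeasure lborel (G ` cbox a b) = ennreal \<gamma> * emeasure lborel (cbox a b)"
  shows "Q z = 0"
proof -
  obtain \<delta> where \<delta>: "0 < \<delta>" "\<And>u. (\<And>i. \<bar>u $ i - z $ i\<bar> \<le> \<delta>) \<Longrightarrow> u \<in> W"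
  proof -
    obtain e where e: "0 < e" "ball z e \<subseteq> W" using W open_contains_ball by blast
    define \<delta> where "\<delta> = e / (2 * real CARD('d))"
    show thesis
    proof
      show "0 < \<delta>" using e by (simp add: \<delta>_def)
      fix u assume u: "\<And>i. \<bar>u $ i - z $ i\<bar> \<le> \<delta>"
      have "norm (u - z) \<le> (\<Sum>i\<in>UNIV. \<bar>(u - z) $ i\<bar>)" by (rule norm_le_l1_cart)
      also have "\<dots> \<le> (\<Sum>i\<in>(UNIV :: 'd set). \<delta>)" using u by (intro sum_mono) simp
      also have "\<dots> < e" using e by (simp add: \<delta>_def)
      finally show "u \<in> W" using e(2) by (auto simp: dist_norm norm_minus_commute)
    qed
  qed
  define q where "q = Q z"
  define g where "g s = sqrt (s\<^sup>2 + q)" for s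
  have sub: "0 < s" "0 < s\<^sup>2 + q" if "\<bar>s - z $ k\<bar> \<le> \<delta>" for s
  proof -
    let ?u = "\<chi> i. if i = k then s else z $ i"
    have u: "?u \<in> W" using that \<delta>(1) by (intro \<delta>(2)) auto
    moreover have "Q ?u = q" unfolding q_def by (rule Q(2)) simp
    ultimately show "0 < s" "0 < s\<^sup>2 + q"
      using pos(1)[OF u] zero_less_power[OF pos(2)[OF u], of 2] sq[OF u] by auto
  qed
  \<comment> \<open>Over the base point of \<open>z\<close>, the map sends level \<open>s\<close> to
    level \<open>g s\<close>. A box between levels \<open>s\<close> and \<open>t\<close> with small
    base has an image caught between two boxes whose levels are within \<eta> of \<open>g s\<close>
    and \<open>g t\<close>; the area of the base cancels.\<close>
  have key: "\<gamma> * (t - s) = g t - g s"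
    if st: "s < t" "\<bar>s - z $ k\<bar> \<le> \<delta>" "\<bar>t - z $ k\<bar> \<le> \<delta>" for s t
  proof -
    have approx: "\<bar>\<gamma> * (t - s) - (g t - g s)\<bar> \<le> 2 * \<eta>" if "0 < \<eta>" for \<eta>
    proof -
      have "\<exists>r>0. \<forall>u. dist u z < r \<longrightarrow> \<bar>sqrt (x\<^sup>2 + Q u) - g x\<bar> < \<eta>" for x
      proof -
        have "isCont (\<lambda>u. sqrt (x\<^sup>2 + Q u)) z"
          using Q(1) by (intro continuous_intros) (simp add: continuous_on_eq_continuous_at)
        then show ?thesis
          using \<open>0 < \<eta>\<close> unfolding continuous_at_eps_delta by (auto simp: g_def q_def dist_real_def)
      qed
      then obtain r1 r2 where r1: "0 < r1" "\<And>u. dist u z < r1 \<Longrightarrow> \<bar>sqrt (s\<^sup>2 + Q u) - g s\<bar> < \<eta>"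
        and r2: "0 < r2" "\<And>u. dist u z < r2 \<Longrightarrow> \<bar>sqrt (t\<^sup>2 + Q u) - g t\<bar> < \<eta>" by metis
      \<comment> \<open>The bound \<delta> keeps the box inside \<open>W\<close>; the other bound
        keeps \<open>Q\<close> so close to \<open>q\<close> over the base that the levels move by
        less than \<eta>.\<close>
      define r where "r = min \<delta> (min r1 r2 / (2 * real CARD('d)))"
      have r: "0 < r" "r \<le> \<delta>" using r1 r2 \<delta> by (auto simp: r_def)
      have near: "\<bar>sqrt (s\<^sup>2 + Q u) - g s\<bar> < \<eta>" "\<bar>sqrt (t\<^sup>2 + Q u) - g t\<bar> < \<eta>"
        if u: "\<And>i. i \<noteq> k \<Longrightarrow> \<bar>u $ i - z $ i\<bar> \<le> r" for u
      proof -
        let ?u = "\<chi> i. if i = k then z $ k else u $ i"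
        have "norm (?u - z) \<le> (\<Sum>i\<in>UNIV. \<bar>(?u - z) $ i\<bar>)" by (rule norm_le_l1_cart)
        also have "\<dots> \<le> (\<Sum>i\<in>(UNIV :: 'd set). r)" using u r(1) by (intro sum_mono) auto
        also have "\<dots> = real CARD('d) * r" by simp
        also have "\<dots> \<le> real CARD('d) * (min r1 r2 / (2 * real CARD('d)))"
          by (intro mult_left_mono) (auto simp: r_def)
        also have "\<dots> < min r1 r2" using r1(1) r2(1) by (simp add: min_def)
        finally have "dist ?u z < r1" "dist ?u z < r2" by (auto simp: dist_norm)
        moreover have "Q ?u = Q u" by (rule Q(2)) simp
        ultimately show "\<bar>sqrt (s\<^sup>2 + Q u) - g s\<bar> < \<eta>" "\<bar>sqrt (t\<^sup>2 + Q u) - g t\<bar> < \<eta>"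
          using r1(2)[of ?u] r2(2)[of ?u] by auto
      qed
      define box where "box a b = cbox (\<chi> i. if i = k then a else z $ i - r) (\<chi> i. if i = k then b else z $ i + r)" for a b
      have box: "u \<in> box a b \<longleftrightarrow> a \<le> u $ k \<and> u $ k \<le> b \<and> (\<forall>i. i \<noteq> k \<longrightarrow> \<bar>u $ i - z $ i\<bar> \<le> r)" for u a b
      proof -
        have split: "(\<forall>i. P i) \<longleftrightarrow> P k \<and> (\<forall>i. i \<noteq> k \<longrightarrow> P i)" for P by auto
        have "z $ i - r \<le> u $ i \<and> u $ i \<le> z $ i + r \<longleftrightarrow> \<bar>u $ i - z $ i\<bar> \<le> r" for i by linarith
        then show ?thesis unfolding box_def mem_box_cart by (subst split) simp
      qed
      have box_W: "u \<in> W" if "u \<in> box s t" for u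
      proof (rule \<delta>(2))
        fix i show "\<bar>u $ i - z $ i\<bar> \<le> \<delta>"
          using that st r(2) by (cases "i = k") (auto simp: box intro: order_trans)
      qed
      define C where "C = (2 * r) ^ (CARD('d) - 1)"
      have C: "0 < C" using r by (simp add: C_def)
      have vol: "emeasure lborel (box a b) = ennreal (C * (b - a))" if "a \<le> b" for a b
        unfolding box_def C_def using that r by (intro emeasure_cbox_slab) auto
      have "emeasure lborel (G ` box s t) = ennreal \<gamma> * emeasure lborel (box s t)"
        using box_W unfolding box_def by (intro \<gamma>(2)) auto
      then have volG: "emeasure lborel (G ` box s t) = ennreal (C * (\<gamma> * (t - s)))"
        using st(1) \<gamma>(1) C by (simp add: vol ennreal_mult'[symmetric] mult.left_commute)
      have "compact (G ` box s t)"
        using G box_W by (intro compact_continuous_image) (auto simp: box_def intro: continuous_on_subset)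
      then have GS: "G ` box s t \<in> sets lborel" by (simp add: compact_imp_closed)
      have Gk: "G u $ k = sqrt ((u $ k)\<^sup>2 + Q u)" if "u \<in> W" for u
        using sq[OF that] pos(2)[OF that] by (simp add: real_sqrt_unique)
      have s0: "0 < s" "0 < t" using sub(1)[of s] sub(1)[of t] st by auto
      have g0: "0 < g s" using sub(2)[of s] st by (simp add: g_def)
      have gst: "g s \<le> g t" using s0 st(1) by (simp add: g_def)
      have "emeasure lborel (G ` box s t) \<le> emeasure lborel (box (g s - \<eta>) (g t + \<eta>))"
      proof (rule emeasure_mono)
        show "G ` box s t \<subseteq> box (g s - \<eta>) (g t + \<eta>)"
        proof
          fix y assume "y \<in> G ` box s t"
          then obtain u where u: "u \<in> box s t" "y = G u" by auto
          have uW: "u \<in> W" using box_W u by auto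
          have n: "\<bar>sqrt (s\<^sup>2 + Q u) - g s\<bar> < \<eta>" "\<bar>sqrt (t\<^sup>2 + Q u) - g t\<bar> < \<eta>"
            using near[of u] u(1) by (auto simp: box)
          have "sqrt (s\<^sup>2 + Q u) \<le> y $ k" "y $ k \<le> sqrt (t\<^sup>2 + Q u)"
            using u s0 by (auto simp: Gk uW box intro!: power_mono)
          then show "y \<in> box (g s - \<eta>) (g t + \<eta>)"
            using n u Gi[OF uW] by (auto simp: box)
        qed
      qed (simp add: box_def)
      then have "ennreal (C * (\<gamma> * (t - s))) \<le> ennreal (C * (g t + \<eta> - (g s - \<eta>)))"
        using gst \<open>0 < \<eta>\<close> volG vol[of "g s - \<eta>" "g t + \<eta>"] by simp
      then have "C * (\<gamma> * (t - s)) \<le> C * (g t + \<eta> - (g s - \<eta>))"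
        using C gst \<open>0 < \<eta>\<close> by (subst (asm) ennreal_le_iff) auto
      then have upper: "\<gamma> * (t - s) \<le> g t - g s + 2 * \<eta>"
        using C by (simp add: mult_le_cancel_left_pos)
      have lower: "g t - g s - 2 * \<eta> \<le> \<gamma> * (t - s)"
      proof (cases "g s + \<eta> \<le> g t - \<eta>")
        case True
        have "emeasure lborel (box (g s + \<eta>) (g t - \<eta>)) \<le> emeasure lborel (G ` box s t)"
        proof (rule emeasure_mono)
          show "box (g s + \<eta>) (g t - \<eta>) \<subseteq> G ` box s t"
          proof
            fix y assume y: "y \<in> box (g s + \<eta>) (g t - \<eta>)"
            then have n: "\<bar>sqrt (s\<^sup>2 + Q y) - g s\<bar> < \<eta>" "\<bar>sqrt (t\<^sup>2 + Q y) - g t\<bar> < \<eta>"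
              using near[of y] by (auto simp: box)
            have yk: "g s + \<eta> \<le> y $ k" "y $ k \<le> g t - \<eta>" "0 < y $ k"
              using y g0 \<open>0 < \<eta>\<close> by (auto simp: box)
            have "sqrt (s\<^sup>2 + Q y) \<le> y $ k" using n(1) yk(1) by linarith
            then have lo: "s\<^sup>2 + Q y \<le> (y $ k)\<^sup>2" using yk(3) by (simp add: sqrt_le_D)
            have "y $ k \<le> sqrt (t\<^sup>2 + Q y)" using n(2) yk(2) by linarith
            then have hi: "(y $ k)\<^sup>2 \<le> t\<^sup>2 + Q y"
              using yk(3) by (metis less_imp_le real_le_rsqrt real_sqrt_le_iff real_sqrt_abs abs_of_pos order_trans)
            \<comment> \<open>The candidate for coordinate \<open>k\<close> of a preimage of
              \<open>y\<close>, found by solving the equation \<open>sq\<close> for it.\<close>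
            define x where "x = sqrt ((y $ k)\<^sup>2 - Q y)"
            have nn: "0 \<le> (y $ k)\<^sup>2 - Q y" using lo zero_le_power2[of s] by linarith
            have x2: "x\<^sup>2 = (y $ k)\<^sup>2 - Q y" using nn by (simp add: x_def)
            have "0 \<le> x" using nn by (simp add: x_def)
            have x: "s \<le> x" "x \<le> t"
              using lo hi x2 s0 \<open>0 \<le> x\<close> by (auto intro!: power2_le_imp_le[of s x] power2_le_imp_le[of x t])
            define u where "u = (\<chi> i. if i = k then x else y $ i)"
            have Qu: "Q u = Q y" by (rule Q(2)) (simp add: u_def)
            have ub: "u \<in> box s t" using x y by (auto simp: box u_def)
            have "G u = y"
              unfolding vec_eq_iff
            proof
              fix i show "G u $ i = y $ i"
              proof (cases "i = k")
                case True
                have "u $ k = x" by (simp add: u_def)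
                then have "G u $ k = sqrt (x\<^sup>2 + Q y)" using Gk[OF box_W[OF ub]] by (simp only: Qu)
                then show ?thesis using True yk(3) x2 by simp
              qed (simp add: Gi[OF box_W[OF ub]], simp add: u_def)
            qed
            then show "y \<in> G ` box s t" using ub by blast
          qed
        qed (rule GS)
        then have "ennreal (C * (g t - \<eta> - (g s + \<eta>))) \<le> ennreal (C * (\<gamma> * (t - s)))"
          using True volG vol[of "g s + \<eta>" "g t - \<eta>"] by simp
        then have "C * (g t - \<eta> - (g s + \<eta>)) \<le> C * (\<gamma> * (t - s))"
          using C \<gamma>(1) st(1) by (subst (asm) ennreal_le_iff) auto
        then show ?thesis using C by (simp add: mult_le_cancel_left_pos)
      next
        case False
        moreover have "0 \<le> \<gamma> * (t - s)" using \<gamma>(1) st(1) by simp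
        ultimately show ?thesis by linarith
      qed
      show ?thesis using upper lower by linarith
    qed
    have "\<bar>\<gamma> * (t - s) - (g t - g s)\<bar> \<le> 0"
    proof (rule field_le_epsilon)
      fix e :: real assume "0 < e"
      then show "\<bar>\<gamma> * (t - s) - (g t - g s)\<bar> \<le> 0 + e" using approx[of "e / 2"] by simp
    qed
    then show ?thesis by simp
  qed
  define a where "a = z $ k"
  have sq_g: "(g s)\<^sup>2 = s\<^sup>2 + q" if "\<bar>s - a\<bar> \<le> \<delta>" for s
    using sub(2)[of s] that by (simp add: g_def a_def)
  have up: "g (a + \<delta>) = g a + \<gamma> * \<delta>" and down: "g (a - \<delta>) = g a - \<gamma> * \<delta>"
    using key[of a "a + \<delta>"] key[of "a - \<delta>" a] \<delta>(1) by (auto simp: a_def)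
  have 1: "(g a + \<gamma> * \<delta>)\<^sup>2 = (a + \<delta>)\<^sup>2 + q" "(g a - \<gamma> * \<delta>)\<^sup>2 = (a - \<delta>)\<^sup>2 + q" "(g a)\<^sup>2 = a\<^sup>2 + q"
    using sq_g[of "a + \<delta>"] sq_g[of "a - \<delta>"] sq_g[of a] up down \<delta>(1) by auto
  \<comment> \<open>Adding the equations at \<open>a + \<delta>\<close> and
    \<open>a - \<delta>\<close> yields \<gamma> = 1; subtracting them then yields
    \<open>g a = a\<close>, that is \<open>q = 0\<close>.\<close>
  have sum: "(x + y)\<^sup>2 + (x - y)\<^sup>2 = 2 * x\<^sup>2 + 2 * y\<^sup>2" and diff: "(x + y)\<^sup>2 - (x - y)\<^sup>2 = 4 * x * y" for x y :: real
    by (simp_all add: power2_eq_square algebra_simps)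
  have "(\<gamma> * \<delta>)\<^sup>2 = \<delta>\<^sup>2" using 1 sum[of "g a" "\<gamma> * \<delta>"] sum[of a \<delta>] by linarith
  then have "\<gamma>\<^sup>2 * \<delta>\<^sup>2 = \<delta>\<^sup>2" by (simp add: power_mult_distrib)
  then have "\<gamma>\<^sup>2 = 1" using \<delta>(1) by simp
  then have "\<gamma> = 1" using \<gamma>(1) by (simp add: power2_eq_1_iff)
  then have "4 * g a * \<delta> = 4 * a * \<delta>" using 1(1,2) diff[of "g a" \<delta>] diff[of a \<delta>] by auto
  then have "g a = a" using \<delta>(1) by simp
  then show ?thesis using 1(3) by (simp add: q_def)
qed

section \<open>Jumps of Euler curves\<close>

text \<open>Left discontinuity, stated without limits. It depends on the function alone, so it
  passes from one direction to another with the same curve.\<close>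

definition jumps_at :: "(real \<Rightarrow> int) \<Rightarrow> real \<Rightarrow> bool" where
  "jumps_at f t \<longleftrightarrow> (\<forall>s<t. \<exists>s'. s \<le> s' \<and> s' < t \<and> f s' \<noteq> f t)"

text \<open>A finite signed measure on the line is determined by its distribution function: the
  difference just before and at \<open>a\<close> isolates the mass at \<open>a\<close>.\<close>

lemma weighted_points_test_function:
  fixes m :: "'i \<Rightarrow> real" and e :: "'i \<Rightarrow> real"
  assumes I: "finite I" and zero: "\<And>t. (\<Sum>i\<in>I. e i * of_bool (m i \<le> t)) = 0"
  shows "(\<Sum>i\<in>I. e i * f (m i)) = 0"
proof -
  have level: "(\<Sum>i | i \<in> I \<and> m i = a. e i) = 0" for a
  proof -
    obtain s where s: "s < a" "\<forall>z\<in>m ` I. z < a \<longleftrightarrow> z \<le> s"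
      by (rule finite_threshold[OF finite_imageI[OF I]])
    have "(\<Sum>i | i \<in> I \<and> m i = a. e i) = (\<Sum>i\<in>I. e i * of_bool (m i = a))"
      using I by (simp add: sum.inter_filter of_bool_def if_distrib cong: if_cong)
    also have "\<dots> = (\<Sum>i\<in>I. e i * of_bool (m i \<le> a) - e i * of_bool (m i \<le> s))"
      using s by (intro sum.cong) (auto simp: le_less)
    also have "\<dots> = 0" using zero by (simp add: sum_subtractf)
    finally show ?thesis .
  qed
  have "(\<Sum>i\<in>I. e i * f (m i)) = (\<Sum>a\<in>m ` I. \<Sum>i | i \<in> I \<and> m i = a. e i * f (m i))"
    using I by (rule sum.image_gen)
  also have "\<dots> = (\<Sum>a\<in>m ` I. (\<Sum>i | i \<in> I \<and> m i = a. e i) * f a)"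
    unfolding sum_distrib_right by (intro sum.cong) auto
  finally show ?thesis by (simp add: level)
qed

text \<open>Between \<open>t\<close> and the next mass point a step can be replaced by a continuous
  ramp. Equality of curves can therefore be tested by expressions continuous in the
  direction.\<close>

lemma weighted_points_zero_of_continuous:
  fixes m :: "'i \<Rightarrow> real" and e :: "'i \<Rightarrow> real"
  assumes I: "finite I" and zero: "\<And>f. continuous_on UNIV f \<Longrightarrow> (\<Sum>i\<in>I. e i * f (m i)) = 0"
  shows "(\<Sum>i\<in>I. e i * of_bool (m i \<le> t)) = 0"
proof -
  obtain s where s: "t < s" "\<And>z. z \<in> m ` I \<Longrightarrow> t < z \<Longrightarrow> s < z"
    using finite_gap_right[OF finite_imageI[OF I], of t] by metis
  define f where "f x = max 0 (min 1 ((s - x) / (s - t)))" for x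
  have "continuous_on UNIV f"
    unfolding f_def using s(1) by (intro continuous_intros) auto
  moreover have "f (m i) = of_bool (m i \<le> t)" if "i \<in> I" for i
  proof (cases "m i \<le> t")
    case True
    then have "1 \<le> (s - m i) / (s - t)" using s(1) by simp
    then show ?thesis using True by (simp add: f_def)
  next
    case False
    then have "s < m i" using s(2)[of "m i"] that by auto
    then have "(s - m i) / (s - t) \<le> 0" using s(1) by (simp add: divide_nonpos_pos)
    then show ?thesis using False by (simp add: f_def)
  qed
  ultimately show ?thesis using zero[of f] by simp
qed

context vertex_weights
begin

lemma curve_eventually_total: "\<exists>T. \<forall>t\<ge>T. curve v t = sum c \<B>"
proof -
  have "bounded ((\<lambda>B. height B v) ` \<B>)" using finite_sets by (simp add: finite_imp_bounded)
  then obtain T where "\<And>B. B \<in> \<B> \<Longrightarrow> \<bar>height B v\<bar> \<le> T" by (auto simp: bounded_iff)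
  then have "height B v \<le> t" if "T \<le> t" "B \<in> \<B>" for t B using that by force
  then show ?thesis by (intro exI[of _ T]) (auto simp: curve_def)
qed

lemma curve_zero: "curve 0 t = sum c \<B> * of_bool (0 \<le> t)"
proof -
  have "height B 0 = 0" if "B \<in> \<B>" for B using height_attained[OF that, of 0] by auto
  then show ?thesis by (simp add: curve_def sum_distrib_right)
qed

lemma curve_inj_on_norm:
  assumes inj: "inj_on curve (sphere 0 1)" and eq: "norm z = norm w" "curve z = curve w"
  shows "z = w"
proof (cases "norm w = 0")
  case False
  have "curve (z /\<^sub>R norm w) t = curve (w /\<^sub>R norm w) t" for t
    using curve_scaleR[of "inverse (norm w)" z "norm w * t"] curve_scaleR[of "inverse (norm w)" w "norm w * t"]
      False eq by (simp flip: mult.assoc)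
  then have "curve (z /\<^sub>R norm w) = curve (w /\<^sub>R norm w)" by auto
  then have "z /\<^sub>R norm w = w /\<^sub>R norm w"
    using inj False eq by (auto dest!: inj_onD)
  then show ?thesis using False by simp
qed (use eq in simp)

lemma finite_vertices: "finite (\<Union>\<B>)"
  using finite_sets finite_set by auto

lemma jumps_at_vertex:
  assumes "jumps_at (curve w) t"
  shows "\<exists>y\<in>\<Union>\<B>. y \<bullet> w = t"
proof (rule ccontr)
  assume neg: "\<not> (\<exists>y\<in>\<Union>\<B>. y \<bullet> w = t)"
  then have ne: "height B w \<noteq> t" if "B \<in> \<B>" for B using height_attained[OF that, of w] that by fastforce
  obtain s where s: "s < t" "\<forall>z\<in>(\<lambda>B. height B w) ` \<B>. z < t \<longleftrightarrow> z \<le> s"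
    by (rule finite_threshold[OF finite_imageI[OF finite_sets]])
  have "curve w s' = curve w t" if "s \<le> s'" "s' < t" for s'
    unfolding curve_def
  proof (rule sum.cong)
    fix B assume B: "B \<in> \<B>"
    then have "height B w < t \<longleftrightarrow> height B w \<le> s" using s by blast
    then have "height B w \<le> s' \<longleftrightarrow> height B w \<le> t" using that ne[OF B] by force
    then show "c B * of_bool (height B w \<le> s') = c B * of_bool (height B w \<le> t)" by simp
  qed simp
  then show False using assms s(1) unfolding jumps_at_def by blast
qed

text \<open>If fewer than \<open>d - 1\<close> vertices contribute a jump at a direction \<open>v\<close> with distinct vertex
  heights, then there is a small \<open>u\<close> orthogonal to \<open>v\<close> and to all these vertices, and
  \<open>v + u\<close> and \<open>v - u\<close> have equal norm and equal curves.\<close>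

lemma many_jumps:
  assumes inj: "inj_on curve (sphere 0 1)"
    and distinct: "inj_on (\<lambda>x. x \<bullet> v) (\<Union>\<B>)"
  obtains A where "A \<subseteq> \<Union>\<B>" "DIM('a) - 1 \<le> card A" "\<forall>x\<in>A. jumps_at (curve v) (x \<bullet> v)"
proof -
  obtain low where low: "\<And>B. B \<in> \<B> \<Longrightarrow> low B \<in> B \<and> height B v = low B \<bullet> v"
    using height_attained[of _ v] by metis
  have low_less: "low B \<bullet> v < y \<bullet> v" if "B \<in> \<B>" "y \<in> B - {low B}" for B y
  proof -
    have "low B \<bullet> v \<noteq> y \<bullet> v" using inj_onD[OF distinct, of "low B" y] low that by blast
    then show ?thesis using height_le[of B y v] low that by fastforce
  qed
  \<comment> \<open>Near \<open>v\<close> every set keeps its unique lowest vertex, so all heights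
    there are linear in the direction.\<close>
  have "eventually (\<lambda>w. \<forall>B\<in>\<B>. \<forall>y\<in>B - {low B}. low B \<bullet> w < y \<bullet> w) (nhds v)"
  proof (intro eventually_ball_finite finite_sets ballI finite_Diff finite_set)
    fix B y assume By: "B \<in> \<B>" "y \<in> B - {low B}"
    have "open {w. low B \<bullet> w < y \<bullet> w}" by (intro open_Collect_less continuous_intros)
    then show "eventually (\<lambda>w. low B \<bullet> w < y \<bullet> w) (nhds v)"
      using low_less[OF By] eventually_nhds by blast
  qed
  then obtain \<epsilon> where \<epsilon>: "0 < \<epsilon>" "\<And>w B y. dist w v < \<epsilon> \<Longrightarrow> B \<in> \<B> \<Longrightarrow> y \<in> B - {low B} \<Longrightarrow> low B \<bullet> w < y \<bullet> w"
    unfolding eventually_nhds_metric by blast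
  have height_near: "height B w = low B \<bullet> w" if "dist w v < \<epsilon>" "B \<in> \<B>" for B w
  proof -
    obtain y where y: "y \<in> B" "height B w = y \<bullet> w" using height_attained \<open>B \<in> \<B>\<close> by blast
    moreover have "height B w \<le> low B \<bullet> w" using height_le low that by blast
    ultimately show ?thesis using \<epsilon>(2)[OF that, of y] by (cases "y = low B") auto
  qed
  define X where "X = low ` \<B>"
  \<comment> \<open>The net weight at \<open>x\<close>. Weights may cancel, and only vertices with
    nonzero net weight are seen by the curves near \<open>v\<close>.\<close>
  define a where "a x = (\<Sum>B | B \<in> \<B> \<and> low B = x. c B)" for x
  have X: "X \<subseteq> \<Union>\<B>" "finite X" using low finite_sets by (auto simp: X_def)
  have curve_near: "curve w t = (\<Sum>x\<in>X. a x * of_bool (x \<bullet> w \<le> t))" if "dist w v < \<epsilon>" for w t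
  proof -
    have "curve w t = (\<Sum>B\<in>\<B>. c B * of_bool (low B \<bullet> w \<le> t))"
      unfolding curve_def using height_near[OF that] by (intro sum.cong) auto
    also have "\<dots> = (\<Sum>x\<in>X. \<Sum>B | B \<in> \<B> \<and> low B = x. c B * of_bool (low B \<bullet> w \<le> t))"
      unfolding X_def by (rule sum.image_gen) (rule finite_sets)
    also have "\<dots> = (\<Sum>x\<in>X. a x * of_bool (x \<bullet> w \<le> t))"
      unfolding a_def sum_distrib_right by (intro sum.cong) auto
    finally show ?thesis .
  qed
  define A where "A = {x \<in> X. a x \<noteq> 0}"
  have A: "A \<subseteq> X" "finite A" using X by (auto simp: A_def)
  show thesis
  proof
    show "A \<subseteq> \<Union>\<B>" using A X by blast
    show "DIM('a) - 1 \<le> card A"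
    proof (rule ccontr)
      assume "\<not> DIM('a) - 1 \<le> card A"
      \<comment> \<open>Orthogonality to \<open>v\<close> itself is what equalises the two norms; it
        costs one dimension, hence the bound \<open>DIM('a) - 1\<close>.\<close>
      then have "card (insert v A) < DIM('a)"
        using card_insert_le_m1[of "DIM('a)" A v] A(2) card_insert_if[OF A(2), of v] by auto
      moreover have "dim (span (insert v A)) \<le> card (insert v A)"
        using dim_le_card[of "insert v A" "insert v A"] A(2) by (simp add: span_superset)
      ultimately obtain u where u: "u \<noteq> 0" "\<And>y. y \<in> span (insert v A) \<Longrightarrow> orthogonal u y"
        using orthogonal_to_subspace_exists[of "insert v A"] by auto
      define u' where "u' = (\<epsilon> / (2 * norm u)) *\<^sub>R u"
      have u': "u' \<noteq> 0" "norm u' < \<epsilon>" using u(1) \<epsilon>(1) by (auto simp: u'_def)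
      have orth: "y \<bullet> u' = 0" if "y \<in> insert v A" for y
        using u(2)[OF span_base[OF that]] by (simp add: u'_def orthogonal_def inner_commute)
      have near: "dist (v + u') v < \<epsilon>" "dist (v - u') v < \<epsilon>"
        using u'(2) by (simp_all add: dist_norm)
      have "curve (v + u') t = curve (v - u') t" for t
        unfolding curve_near[OF near(1)] curve_near[OF near(2)]
      proof (rule sum.cong)
        fix x assume "x \<in> X"
        show "a x * of_bool (x \<bullet> (v + u') \<le> t) = a x * of_bool (x \<bullet> (v - u') \<le> t)"
        proof (cases "a x = 0")
          case False
          then have "x \<in> A" using \<open>x \<in> X\<close> by (simp add: A_def)
          then show ?thesis using orth[of x] by (simp add: inner_add_right inner_diff_right)
        qed simp
      qed simp
      moreover have "norm (v + u') = norm (v - u')"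
        using orth[of v] by (simp add: norm_eq inner_add inner_diff inner_commute)
      ultimately have "v + u' = v - u'" using curve_inj_on_norm[OF inj] by blast
      then have "2 *\<^sub>R u' = 0" by (simp add: scaleR_2 algebra_simps)
      then show False using u' by simp
    qed
    show "\<forall>x\<in>A. jumps_at (curve v) (x \<bullet> v)"
    proof
      fix x assume x: "x \<in> A"
      let ?t = "x \<bullet> v"
      obtain s0 where s0: "s0 < ?t" "\<forall>z\<in>(\<lambda>y. y \<bullet> v) ` X. z < ?t \<longleftrightarrow> z \<le> s0"
        by (rule finite_threshold[OF finite_imageI[OF X(2)]])
      show "jumps_at (curve v) ?t"
        unfolding jumps_at_def
      proof (intro allI impI)
        fix s assume "s < ?t"
        \<comment> \<open>At or above \<open>s\<close> and every vertex height below
          \<open>?t\<close>, so that between \<open>s'\<close> and \<open>?t\<close> only the weight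
          at \<open>x\<close> enters.\<close>
        define s' where "s' = max s s0"
        have s': "s' < ?t" using \<open>s < ?t\<close> s0 by (simp add: s'_def)
        have "curve v ?t - curve v s' = (\<Sum>y\<in>X. a y * of_bool (y \<bullet> v \<le> ?t) - a y * of_bool (y \<bullet> v \<le> s'))"
          using \<epsilon>(1) by (simp add: curve_near sum_subtractf)
        also have "\<dots> = (\<Sum>y\<in>X. if y = x then a y else 0)"
        proof (rule sum.cong)
          fix y assume y: "y \<in> X"
          have "y \<bullet> v < ?t \<longleftrightarrow> y \<bullet> v \<le> s0" using s0 y by blast
          then have "y \<bullet> v \<le> s' \<longleftrightarrow> y \<bullet> v < ?t" using s' by (auto simp: s'_def)
          moreover have "y \<bullet> v = ?t \<longleftrightarrow> y = x"
            using inj_onD[OF distinct, of y x] y x A X by blast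
          ultimately show "a y * of_bool (y \<bullet> v \<le> ?t) - a y * of_bool (y \<bullet> v \<le> s') = (if y = x then a y else 0)"
            by (auto simp: le_less)
        qed simp
        also have "\<dots> = a x" using x A X(2) by auto
        finally have "curve v s' \<noteq> curve v ?t" using x by (auto simp: A_def)
        then show "\<exists>s'. s \<le> s' \<and> s' < ?t \<and> curve v s' \<noteq> curve v ?t"
          using s' by (intro exI[of _ s']) (auto simp: s'_def)
      qed
    qed
  qed
qed

end

text \<open>The truncated cone over the set has the interior point
  \<open>(1 / 2) *\<^sub>R v\<close>.\<close>

lemma emeasure_sphere_open_pos:
  fixes U :: "'a::euclidean_space set"
  assumes U: "open U" and v: "v \<in> U" "norm v = 1"
  shows "0 < emeasure sphere_measure (U \<inter> sphere 0 1)"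
proof -
  let ?T = "{r *\<^sub>R a | r a. a \<in> U \<inter> sphere 0 1 \<and> 0 < r \<and> r \<le> 1}"
  define W where "W = (- {0}) \<inter> (\<lambda>x. x /\<^sub>R norm x) -` U"
  have W: "open W"
    unfolding W_def by (intro continuous_open_preimage continuous_intros U) auto
  have T: "?T = cball 0 1 \<inter> W"
  proof (intro set_eqI iffI)
    fix x assume "x \<in> cball 0 1 \<inter> W"
    then have "x = norm x *\<^sub>R (x /\<^sub>R norm x)" "x /\<^sub>R norm x \<in> U \<inter> sphere 0 1" "0 < norm x" "norm x \<le> 1"
      by (auto simp: W_def)
    then show "x \<in> ?T" by blast
  qed (auto simp: W_def)
  have "(1 / 2) *\<^sub>R v \<in> ball 0 1 \<inter> W" using v by (auto simp: W_def)
  then have pos: "0 < emeasure lborel (ball 0 1 \<inter> W)"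
    using emeasure_lborel_open_pos[of "ball 0 1 \<inter> W"] W by blast
  have "emeasure lborel (ball 0 1 \<inter> W) \<le> emeasure lborel ?T"
    unfolding T using W by (intro emeasure_mono) auto
  then have "0 < emeasure lborel ?T" using pos by (rule less_le_trans[rotated])
  moreover have "emeasure sphere_measure (U \<inter> sphere 0 1) = of_nat DIM('a) * emeasure lborel ?T"
    using U by (intro emeasure_sphere_measure) auto
  ultimately show ?thesis by (simp add: ennreal_zero_less_mult_iff)
qed

section \<open>Matching the directions of two complexes\<close>

text \<open>The hypotheses are symmetric in the two families, so \<open>swap\<close> makes every
  result available for the inverse map. Cartesian vectors provide the coordinates used for
  frames.\<close>

locale matched_curves = K: vertex_weights \<B> c + L: vertex_weights \<C> d
  for \<B> \<C> :: "(real ^ 'd) set set" and c d +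
  fixes p :: real
  assumes p: "1 \<le> p"
    and inj_K: "inj_on K.curve (sphere 0 1)" and inj_L: "inj_on L.curve (sphere 0 1)"
    and gp_K: "general_position (\<Union>\<B>)" and gp_L: "general_position (\<Union>\<C>)"
    and distr_eq: "distr sphere_measure (euler_curve_borel p) K.curve
      = distr sphere_measure (euler_curve_borel p) L.curve"
begin

lemma emeasure_vimage_eq:
  assumes A: "A \<in> sets (euler_curve_borel p)"
  shows "emeasure sphere_measure (K.curve -` A \<inter> sphere 0 1) = emeasure sphere_measure (L.curve -` A \<inter> sphere 0 1)"
  using arg_cong[OF distr_eq, of "\<lambda>M. emeasure M A"]
  by (simp add: emeasure_distr[OF K.curve_measurable[OF p] A] emeasure_distr[OF L.curve_measurable[OF p] A]
      space_sphere_measure)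

text \<open>Otherwise the complement of the compact curve image of \<open>L\<close> is open around
  the curve of \<open>v\<close>. Its preimage under \<open>K.curve\<close> has positive measure,
  whereas its preimage under \<open>L.curve\<close> has no unit vector.\<close>

lemma unit_partner:
  assumes v: "norm v = 1"
  shows "\<exists>w. norm w = 1 \<and> L.curve w = K.curve v"
proof (rule ccontr)
  assume neg: "\<not> ?thesis"
  define U where "U = euler_curves - L.curve ` sphere 0 1"
  have U: "Lp_open p U" unfolding U_def by (rule L.Lp_open_compl_curve_image[OF _ p]) simp
  then have sets: "U \<in> sets (euler_curve_borel p)"
    by (simp add: sets_euler_curve_borel sigma_sets.Basic)
  have "K.curve v \<in> U" using neg K.curve_in_euler_curves by (auto simp: U_def)
  then have "0 < emeasure sphere_measure (K.curve -` U \<inter> sphere 0 1)"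
    using v by (intro emeasure_sphere_open_pos[of _ v] K.open_curve_vimage[OF U p]) auto
  moreover have "L.curve -` U \<inter> sphere 0 1 = {}" by (auto simp: U_def)
  ultimately show False using emeasure_vimage_eq[OF sets] by simp
qed

lemma total_eq: "sum c \<B> = sum d \<C>"
proof -
  obtain v :: "real ^ 'd" where v: "norm v = 1" using vector_choose_size[of 1] by auto
  obtain w where w: "L.curve w = K.curve v" using unit_partner[OF v] by blast
  obtain T where T: "\<And>t. t \<ge> T \<Longrightarrow> K.curve v t = sum c \<B>" using K.curve_eventually_total by blast
  obtain T' where T': "\<And>t. t \<ge> T' \<Longrightarrow> L.curve w t = sum d \<C>" using L.curve_eventually_total by blast
  show ?thesis using T[of "max T T'"] T'[of "max T T'"] w by simp
qed

lemma partner_exists: "\<exists>w. norm w = norm v \<and> L.curve w = K.curve v"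
proof (cases "v = 0")
  case True
  then have "L.curve 0 = K.curve v" by (auto simp: K.curve_zero L.curve_zero total_eq)
  with True show ?thesis by (intro exI[of _ 0]) simp
next
  case False
  then obtain w where w: "norm w = 1" "L.curve w = K.curve (v /\<^sub>R norm v)"
    using unit_partner[of "v /\<^sub>R norm v"] by auto
  have "L.curve (norm v *\<^sub>R w) t = K.curve v t" for t
  proof -
    have t: "norm v * (t / norm v) = t" using False by simp
    have "L.curve (norm v *\<^sub>R w) t = L.curve w (t / norm v)"
      using L.curve_scaleR[of "norm v" w "t / norm v"] False t by simp
    also have "\<dots> = K.curve (norm v *\<^sub>R (v /\<^sub>R norm v)) (norm v * (t / norm v))"
      unfolding w(2) by (rule K.curve_scaleR[symmetric]) (use False in simp)
    also have "\<dots> = K.curve v t" using False by (simp add: t)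
    finally show ?thesis .
  qed
  then show ?thesis using w(1) by (intro exI[of _ "norm v *\<^sub>R w"]) auto
qed

text \<open>The norm clause gives uniqueness, since injectivity of the curves is available on each
  sphere about the origin.\<close>

definition partner :: "real ^ 'd \<Rightarrow> real ^ 'd" where
  "partner v = (THE w. norm w = norm v \<and> L.curve w = K.curve v)"

lemma partner_unique: "norm w = norm v \<Longrightarrow> L.curve w = K.curve v \<Longrightarrow> partner v = w"
  unfolding partner_def using L.curve_inj_on_norm[OF inj_L] by (intro the_equality) auto

lemma norm_partner [simp]: "norm (partner v) = norm v"
  and curve_partner: "L.curve (partner v) = K.curve v"
  using partner_exists[of v] partner_unique[of _ v] by auto

lemma partner_scaleR:
  assumes "0 < r"
  shows "partner (r *\<^sub>R v) = r *\<^sub>R partner v"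
proof (rule partner_unique)
  show "norm (r *\<^sub>R partner v) = norm (r *\<^sub>R v)" by simp
  have "L.curve (r *\<^sub>R partner v) (r * t) = K.curve (r *\<^sub>R v) (r * t)" for t
    using assms by (simp add: L.curve_scaleR K.curve_scaleR curve_partner)
  from this[of "t / r" for t] show "L.curve (r *\<^sub>R partner v) = K.curve (r *\<^sub>R v)"
    using assms by auto
qed

text \<open>Pointwise values of a curve are not continuous in the direction, but integrals against
  continuous functions are; equality thus becomes a closed condition on the pair of
  directions.\<close>

lemma curves_eq_iff:
  "K.curve v = L.curve w \<longleftrightarrow> (\<forall>f. continuous_on UNIV f \<longrightarrow>
    (\<Sum>B\<in>\<B>. real_of_int (c B) * f (K.height B v)) = (\<Sum>C\<in>\<C>. real_of_int (d C) * f (L.height C w)))"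
proof -
  let ?e = "case_sum (\<lambda>B. real_of_int (c B)) (\<lambda>C. - real_of_int (d C))"
  let ?m = "case_sum (\<lambda>B. K.height B v) (\<lambda>C. L.height C w)"
  have fin: "finite (\<B> <+> \<C>)" using K.finite_sets L.finite_sets by simp
  have sums: "(\<Sum>i\<in>\<B> <+> \<C>. ?e i * f (?m i))
      = (\<Sum>B\<in>\<B>. real_of_int (c B) * f (K.height B v)) - (\<Sum>C\<in>\<C>. real_of_int (d C) * f (L.height C w))" for f
    using K.finite_sets L.finite_sets by (simp add: sum.Plus sum_negf)
  have curves: "(\<Sum>i\<in>\<B> <+> \<C>. ?e i * of_bool (?m i \<le> t)) = real_of_int (K.curve v t) - real_of_int (L.curve w t)" for t
    using sums[of "\<lambda>x. of_bool (x \<le> t)"] by (simp add: K.curve_def L.curve_def)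
  show ?thesis
  proof (intro iffI allI impI)
    fix f :: "real \<Rightarrow> real"
    assume "K.curve v = L.curve w"
    then have "(\<Sum>i\<in>\<B> <+> \<C>. ?e i * of_bool (?m i \<le> t)) = 0" for t
      unfolding curves by simp
    then have "(\<Sum>i\<in>\<B> <+> \<C>. ?e i * f (?m i)) = 0"
      by (rule weighted_points_test_function[OF fin, where e = ?e and m = ?m])
    then show "(\<Sum>B\<in>\<B>. real_of_int (c B) * f (K.height B v)) = (\<Sum>C\<in>\<C>. real_of_int (d C) * f (L.height C w))"
      unfolding sums by simp
  next
    assume *: "\<forall>f. continuous_on UNIV f \<longrightarrow>
      (\<Sum>B\<in>\<B>. real_of_int (c B) * f (K.height B v)) = (\<Sum>C\<in>\<C>. real_of_int (d C) * f (L.height C w))"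
    have "(\<Sum>i\<in>\<B> <+> \<C>. ?e i * of_bool (?m i \<le> t)) = 0" for t
    proof (rule weighted_points_zero_of_continuous[OF fin, where e = ?e and m = ?m])
      fix f :: "real \<Rightarrow> real" assume "continuous_on UNIV f"
      then have "(\<Sum>B\<in>\<B>. real_of_int (c B) * f (K.height B v)) = (\<Sum>C\<in>\<C>. real_of_int (d C) * f (L.height C w))"
        using * by blast
      then show "(\<Sum>i\<in>\<B> <+> \<C>. ?e i * f (?m i)) = 0" unfolding sums by linarith
    qed
    then have "K.curve v t = L.curve w t" for t unfolding curves by simp
    then show "K.curve v = L.curve w" by auto
  qed
qed

text \<open>The graph is closed by \<open>curves_eq_iff\<close>, and norm preservation keeps it
  inside a product of compact balls, where a closed graph implies continuity.\<close>

lemma continuous_on_partner: "continuous_on S partner"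
proof -
  have "isCont partner x" for x
  proof -
    define R where "R = norm x + 1"
    let ?B = "cball 0 R :: (real ^ 'd) set"
    have "continuous_on ?B partner"
    proof (rule continuous_from_closed_graph[where T = ?B])
      show "partner \<in> ?B \<rightarrow> ?B" by auto
      let ?\<Gamma> = "\<lambda>f. {z :: (real ^ 'd) \<times> (real ^ 'd).
        (\<Sum>B\<in>\<B>. real_of_int (c B) * f (K.height B (fst z))) = (\<Sum>C\<in>\<C>. real_of_int (d C) * f (L.height C (snd z)))}"
      have "(\<lambda>v. (v, partner v)) ` ?B = (?B \<times> ?B) \<inter> {z. norm (fst z) = norm (snd z)}
          \<inter> (\<Inter>f\<in>{f. continuous_on UNIV f}. ?\<Gamma> f)" (is "?L = ?R")
      proof (intro set_eqI iffI)
        fix z assume "z \<in> ?L"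
        then obtain v where v: "z = (v, partner v)" "v \<in> ?B" by auto
        then show "z \<in> ?R" using curves_eq_iff[of v "partner v"] by (auto simp: curve_partner)
      next
        fix z assume z: "z \<in> ?R"
        then have "K.curve (fst z) = L.curve (snd z)" by (subst curves_eq_iff) auto
        then have "partner (fst z) = snd z" using z by (intro partner_unique) auto
        then show "z \<in> ?L" using z by (intro image_eqI[of _ _ "fst z"]) auto
      qed
      moreover have "closed (?\<Gamma> f)" if f: "continuous_on UNIV f" for f
      proof -
        have "continuous_on UNIV (\<lambda>z :: (real ^ 'd) \<times> (real ^ 'd). f (K.height B (fst z)))" if "B \<in> \<B>" for B
          using continuous_on_compose2[OF f continuous_on_compose2[OF K.continuous_on_height[OF that, of UNIV] continuous_on_fst[OF continuous_on_id]]]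
          by auto
        moreover have "continuous_on UNIV (\<lambda>z :: (real ^ 'd) \<times> (real ^ 'd). f (L.height C (snd z)))" if "C \<in> \<C>" for C
          using continuous_on_compose2[OF f continuous_on_compose2[OF L.continuous_on_height[OF that, of UNIV] continuous_on_snd[OF continuous_on_id]]]
          by auto
        ultimately show ?thesis
          by (intro closed_Collect_eq continuous_on_sum continuous_on_mult continuous_on_const) auto
      qed
      moreover have "closed {z :: (real ^ 'd) \<times> (real ^ 'd). norm (fst z) = norm (snd z)}"
        by (intro closed_Collect_eq continuous_intros)
      ultimately show "closed ?L"
        by (simp only:) (intro closed_Int closed_Times closed_cball closed_INT; blast)
    qed simp
    then have "continuous_on (ball 0 R) partner" by (rule continuous_on_subset) auto
    then show ?thesis by (simp add: continuous_on_eq_continuous_at R_def)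
  qed
  then show ?thesis by (simp add: continuous_at_imp_continuous_on)
qed

text \<open>Tested on the image of \<open>F\<close> under \<open>L.curve\<close>: injectivity pulls
  it back to \<open>F\<close> on the side of \<open>L\<close>, and to the preimage of
  \<open>F\<close> under \<open>partner\<close> on the side of \<open>K\<close>.\<close>

lemma distr_lborel_partner: "distr lborel borel partner = lborel"
proof (rule lborel_preserved_by_radial_map)
  show "continuous_on UNIV partner" by (rule continuous_on_partner)
  show "partner (r *\<^sub>R x) = r *\<^sub>R partner x" if "0 < r" for r x using that by (rule partner_scaleR)
  fix F :: "(real ^ 'd) set" assume F: "closed F" "F \<subseteq> sphere 0 1"
  have "compact F" using F by (simp add: compact_eq_bounded_closed bounded_subset[OF bounded_sphere])
  then have A: "L.curve ` F \<in> sets (euler_curve_borel p)" by (rule L.curve_image_sets[OF _ p])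
  have "L.curve -` (L.curve ` F) \<inter> sphere 0 1 = F"
    using F(2) inj_L by (auto dest!: inj_onD)
  moreover have "K.curve -` (L.curve ` F) \<inter> sphere 0 1 = partner -` F"
  proof (intro set_eqI iffI)
    fix v assume "v \<in> K.curve -` (L.curve ` F) \<inter> sphere 0 1"
    then obtain w where w: "w \<in> F" "K.curve v = L.curve w" "norm v = 1" by auto
    moreover have "norm w = norm v" using w F(2) by auto
    ultimately show "v \<in> partner -` F" using partner_unique[of w v] by auto
  next
    fix v assume v: "v \<in> partner -` F"
    then have "norm (partner v) = 1" using F(2) by auto
    moreover have "K.curve v \<in> L.curve ` F" using v curve_partner[of v] by (metis imageI vimageE)
    ultimately show "v \<in> K.curve -` (L.curve ` F) \<inter> sphere 0 1" by simp
  qed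
  ultimately have eq: "emeasure sphere_measure (partner -` F) = emeasure sphere_measure F"
    using emeasure_vimage_eq[OF A] by simp
  have "closed (partner -` F)" using F by (intro closed_vimage continuous_on_partner)
  moreover have "partner -` F \<subseteq> sphere 0 1" using F(2) by fastforce
  ultimately show "emeasure lborel {r *\<^sub>R a | r a. a \<in> partner -` F \<and> 0 < r \<and> r \<le> 1}
      = emeasure lborel {r *\<^sub>R a | r a. a \<in> F \<and> 0 < r \<and> r \<le> 1}"
    using eq F by (simp add: emeasure_sphere_measure ennreal_mult_cancel_left)
qed simp

lemma swap: "matched_curves \<C> \<B> d c p"
  by unfold_locales (use p inj_K inj_L gp_K gp_L distr_eq in auto)

end

text \<open>The vectors \<open>x i\<close> with \<open>i \<noteq> k\<close> and a unit normal \<open>n\<close> to all of them form a frame; the value \<open>x k\<close> is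
  never used.\<close>

definition frame_coords :: "'d \<Rightarrow> ('d \<Rightarrow> real ^ 'd) \<Rightarrow> real ^ 'd \<Rightarrow> real ^ 'd \<Rightarrow> real ^ 'd" where
  "frame_coords k x n w = (\<chi> i. if i = k then n \<bullet> w else x i \<bullet> w)"

text \<open>In frame coordinates, the orthogonal projection along the normal.\<close>

definition drop_coord :: "'d \<Rightarrow> real ^ 'd \<Rightarrow> real ^ 'd" where
  "drop_coord k u = (\<chi> i. if i = k then 0 else u $ i)"

lemma linear_frame_coords: "linear (frame_coords k x n)"
  by (rule linearI) (auto simp: frame_coords_def vec_eq_iff inner_add_right)

lemma linear_drop_coord: "linear (drop_coord k)"
  by (rule linearI) (auto simp: drop_coord_def vec_eq_iff)

lemma frame_normal_exists:
  fixes x :: "'d \<Rightarrow> real ^ 'd"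
  obtains n where "norm n = 1" "\<forall>i. i \<noteq> k \<longrightarrow> x i \<bullet> n = 0"
proof -
  have "dim (span (x ` (- {k}))) \<le> card (x ` (- {k}))"
    using dim_le_card[of "x ` (- {k})" "x ` (- {k})"] by (simp add: span_superset)
  also have "\<dots> \<le> card (- {k})" by (rule card_image_le) simp
  also have "\<dots> < DIM(real ^ 'd)"
    by (simp add: Compl_eq_Diff_UNIV card_Diff_singleton)
  finally obtain u where u: "u \<noteq> 0" "\<And>y. y \<in> span (x ` (- {k})) \<Longrightarrow> orthogonal u y"
    using orthogonal_to_subspace_exists[of "x ` (- {k})"] by auto
  show thesis
  proof (rule that[of "u /\<^sub>R norm u"])
    show "norm (u /\<^sub>R norm u) = 1" using u(1) by simp
    show "\<forall>i. i \<noteq> k \<longrightarrow> x i \<bullet> (u /\<^sub>R norm u) = 0"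
    proof (intro allI impI)
      fix i assume "i \<noteq> k"
      then have "x i \<in> span (x ` (- {k}))" by (intro span_base) auto
      then have "u \<bullet> x i = 0" using u(2) by (simp add: orthogonal_def)
      then show "x i \<bullet> (u /\<^sub>R norm u) = 0" by (simp add: inner_commute)
    qed
  qed
qed

text \<open>Coordinate \<open>k\<close> moves a vector along \<open>n\<close>, which is orthogonal
  to the remaining part; the last identity is Pythagoras. The vectors \<open>x i\<close> need not be
  orthogonal to each other.\<close>

lemma frame_inverse:
  fixes x :: "'d \<Rightarrow> real ^ 'd"
  assumes x: "inj_on x (- {k})" "independent (x ` (- {k}))"
    and n: "norm n = 1" "\<forall>i. i \<noteq> k \<longrightarrow> x i \<bullet> n = 0"
  obtains \<alpha> where "linear \<alpha>" "\<forall>w. \<alpha> (frame_coords k x n w) = w" "\<forall>u. frame_coords k x n (\<alpha> u) = u"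
    "\<forall>u. (norm (\<alpha> u))\<^sup>2 = (u $ k)\<^sup>2 + (norm (\<alpha> (drop_coord k u)))\<^sup>2"
proof -
  let ?S = "x ` (- {k})" and ?X = "frame_coords k x n"
  have n_orth: "orthogonal n y" if "y \<in> span ?S" for y
    using n(2) by (intro orthogonal_to_span[OF that]) (auto simp: orthogonal_def inner_commute)
  have n_notin: "n \<notin> span ?S"
    using n_orth[of n] n(1) by (auto simp: orthogonal_def)
  then have ind: "independent (insert n ?S)" using x(2) by (rule independent_insertI)
  have "n \<notin> ?S" using span_superset n_notin by (rule contra_subsetD)
  then have "card (insert n ?S) = Suc (card (- {k}))"
    by (simp only: card_insert_disjoint finite_imageI finite card_image[OF x(1)] not_False_eq_True)
  also have "\<dots> = CARD('d)"
    unfolding Compl_eq_Diff_UNIV by (rule card_Suc_Diff1) auto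
  finally have span: "UNIV \<subseteq> span (insert n ?S)"
    using ind by (intro card_ge_dim_independent) auto
  have "inj ?X"
    unfolding linear_injective_0[OF linear_frame_coords]
  proof (intro allI impI)
    fix w assume w: "?X w = 0"
    have "n \<bullet> w = 0" using w[unfolded vec_eq_iff frame_coords_def, rule_format, of k] by simp
    moreover have "x i \<bullet> w = 0" if "i \<noteq> k" for i
      using w[unfolded vec_eq_iff frame_coords_def, rule_format, of i] that by simp
    ultimately have "y \<bullet> w = 0" if "y \<in> insert n ?S" for y
      using that by (elim insertE imageE) auto
    then have "orthogonal w w"
      using span by (intro orthogonal_to_span[of w "insert n ?S"]) (auto simp: orthogonal_def inner_commute)
    then show "w = 0" by (simp add: orthogonal_self)
  qed
  then obtain \<alpha> where \<alpha>: "linear \<alpha>" "\<forall>w. \<alpha> (?X w) = w" "\<forall>u. ?X (\<alpha> u) = u"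
    using linear_injective_isomorphism[OF linear_frame_coords] by blast
  have n_axis: "\<alpha> (axis k 1) = n"
  proof -
    have "?X n = axis k 1"
      using n by (auto simp: frame_coords_def vec_eq_iff axis_def dot_square_norm)
    then show ?thesis using \<alpha>(2) by metis
  qed
  have "(norm (\<alpha> u))\<^sup>2 = (u $ k)\<^sup>2 + (norm (\<alpha> (drop_coord k u)))\<^sup>2" for u
  proof -
    let ?p = "\<alpha> (drop_coord k u)"
    have "u = drop_coord k u + (u $ k) *\<^sub>R axis k 1"
      by (auto simp: drop_coord_def vec_eq_iff axis_def)
    then have u: "\<alpha> u = ?p + (u $ k) *\<^sub>R n"
      using linear_add[OF \<alpha>(1)] linear_scale[OF \<alpha>(1)] n_axis by metis
    have "n \<bullet> ?p = ?X ?p $ k" by (simp add: frame_coords_def)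
    also have "\<dots> = 0" using \<alpha>(3) by (simp add: drop_coord_def)
    finally have "n \<bullet> ?p = 0" .
    then have "(norm (\<alpha> u))\<^sup>2 = (u $ k)\<^sup>2 * (n \<bullet> n) + (norm ?p)\<^sup>2"
      unfolding u power2_norm_eq_inner by (simp add: inner_add inner_commute power2_eq_square)
    then show ?thesis using n(1) by (simp add: dot_square_norm)
  qed
  then show thesis using that[OF \<alpha>] by blast
qed

lemma general_position_independent:
  fixes x :: "'d \<Rightarrow> real ^ 'd"
  assumes "general_position V" "x ` (- {k}) \<subseteq> V"
  shows "independent (x ` (- {k}))"
proof -
  have "card (x ` (- {k})) \<le> card (- {k})" by (rule card_image_le) simp
  also have "\<dots> \<le> DIM(real ^ 'd)" by (simp add: card_mono)
  finally show ?thesis using assms by (auto simp: general_position_def)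
qed

section \<open>From local to global: quadratic forms, finite covers, selections\<close>

text \<open>Squared norms of linear maps are quadratic forms, and a second difference at
  \<open>z\<close> with step proportional to \<open>u\<close> isolates the value at
  \<open>u\<close>.\<close>

lemma linear_norm_eq_of_open:
  fixes R R' :: "'a::euclidean_space \<Rightarrow> 'b::euclidean_space"
  assumes R: "linear R" "linear R'" and W: "open W" "z \<in> W"
    and eq: "\<And>v. v \<in> W \<Longrightarrow> norm (R v) = norm (R' v)"
  shows "norm (R u) = norm (R' u)"
proof -
  obtain e where e: "0 < e" "ball z e \<subseteq> W" using W open_contains_ball by blast
  define \<tau> where "\<tau> = e / (2 * (norm u + 1))"
  have pos: "0 < norm u + 1" by (simp add: add_nonneg_pos)
  then have \<tau>: "0 < \<tau>" using e by (simp add: \<tau>_def)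
  have "\<tau> * norm u \<le> \<tau> * (norm u + 1)" using \<tau> by simp
  also have "\<dots> = e / 2" using pos by (simp add: \<tau>_def field_simps)
  also have "\<dots> < e" using e by simp
  finally have "z + \<tau> *\<^sub>R u \<in> W" "z - \<tau> *\<^sub>R u \<in> W"
    using e(2) \<tau> by (auto simp: dist_norm subset_iff)
  then have *: "norm (R (z + \<tau> *\<^sub>R u)) = norm (R' (z + \<tau> *\<^sub>R u))"
    "norm (R (z - \<tau> *\<^sub>R u)) = norm (R' (z - \<tau> *\<^sub>R u))" "norm (R z) = norm (R' z)"
    using eq W by auto
  have expand: "(norm (A (z + \<tau> *\<^sub>R u)))\<^sup>2 + (norm (A (z - \<tau> *\<^sub>R u)))\<^sup>2
      = 2 * (norm (A z))\<^sup>2 + 2 * \<tau>\<^sup>2 * (norm (A u))\<^sup>2" if "linear A" for A :: "'a \<Rightarrow> 'b"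
    by (simp add: linear_add[OF that] linear_diff[OF that] linear_scale[OF that] power2_norm_eq_inner
        inner_add inner_diff inner_commute power2_eq_square[of \<tau>])
  have "2 * \<tau>\<^sup>2 * (norm (R u))\<^sup>2 = 2 * \<tau>\<^sup>2 * (norm (R' u))\<^sup>2"
    using expand[OF R(1)] expand[OF R(2)] * by auto
  then show ?thesis using \<tau> by simp
qed

text \<open>Baire's theorem for finite covers: either \<open>F\<close> contains \<open>D\<close>, or
  \<open>D - F\<close> is a nonempty open set covered by the other members.\<close>

lemma finite_closed_cover_interior:
  fixes D :: "'a::topological_space set"
  assumes "finite \<F>" "\<And>F. F \<in> \<F> \<Longrightarrow> closed F" "open D" "D \<noteq> {}" "D \<subseteq> \<Union>\<F>"
  shows "\<exists>F\<in>\<F>. interior F \<inter> D \<noteq> {}"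
  using assms
proof (induction \<F> arbitrary: D rule: finite_induct)
  case (insert F \<F>)
  show ?case
  proof (cases "D - F = {}")
    case True
    then have "D \<subseteq> interior F" using insert.prems by (intro interior_maximal) auto
    then show ?thesis using insert.prems(3) by auto
  next
    case False
    then have "\<exists>G\<in>\<F>. interior G \<inter> (D - F) \<noteq> {}"
      using insert.prems by (intro insert.IH) auto
    then show ?thesis by auto
  qed
qed auto

text \<open>On a segment, the parameters where \<open>H\<close> agrees with a given \<psi> form a
  closed set on which \<open>H\<close> keeps distances; finitely many cover the segment, so the
  Lipschitz constants glue. Equality can fail: the absolute value on the line is such a selection.
  Hence the inverse has to be treated too.\<close>

lemma selection_of_isometries_contracts:
  fixes H :: "'a::euclidean_space \<Rightarrow> 'a"
  assumes H: "continuous_on UNIV H" and \<Psi>: "finite \<Psi>" "\<And>\<psi>. \<psi> \<in> \<Psi> \<Longrightarrow> orthogonal_transformation \<psi>"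
    and sel: "\<And>w. \<exists>\<psi>\<in>\<Psi>. H w = \<psi> w"
  shows "dist (H a) (H b) \<le> dist a b"
proof -
  define \<gamma> where "\<gamma> t = a + t *\<^sub>R (b - a)" for t :: real
  define U where "U \<psi> = {t. H (\<gamma> t) = \<psi> (\<gamma> t)}" for \<psi>
  have \<gamma>: "continuous_on S \<gamma>" for S unfolding \<gamma>_def by (intro continuous_intros)
  have "(norm (b - a))-lipschitz_on {0..1} (H \<circ> \<gamma>)"
  proof (rule lipschitz_on_closed_Union[where U = U and I = \<Psi>])
    fix \<psi> assume \<psi>: "\<psi> \<in> \<Psi>"
    then have orth: "orthogonal_transformation \<psi>" using \<Psi> by auto
    have cont: "continuous_on UNIV \<psi>"
      using orth orthogonal_transformation_linear linear_conv_bounded_linear linear_continuous_on by blast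
    show "closed (U \<psi>)"
      unfolding U_def
      by (rule closed_Collect_eq[OF continuous_on_compose2[OF H \<gamma> subset_UNIV]
            continuous_on_compose2[OF cont \<gamma> subset_UNIV]])
    show "(norm (b - a))-lipschitz_on (U \<psi>) (H \<circ> \<gamma>)"
    proof (rule lipschitz_onI)
      fix s t assume st: "s \<in> U \<psi>" "t \<in> U \<psi>"
      have "dist ((H \<circ> \<gamma>) s) ((H \<circ> \<gamma>) t) = dist (\<psi> (\<gamma> s)) (\<psi> (\<gamma> t))"
        using st by (simp add: U_def)
      also have "\<dots> = dist (\<gamma> s) (\<gamma> t)" using orth unfolding orthogonal_transformation_isometry by blast
      also have "\<gamma> s - \<gamma> t = (s - t) *\<^sub>R (b - a)" by (simp add: \<gamma>_def algebra_simps)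
      then have "dist (\<gamma> s) (\<gamma> t) = norm (b - a) * dist s t"
        by (simp add: dist_norm)
      finally show "dist ((H \<circ> \<gamma>) s) ((H \<circ> \<gamma>) t) \<le> norm (b - a) * dist s t" by simp
    qed simp
  qed (use \<Psi>(1) sel in \<open>auto simp: U_def\<close>)
  then have "dist ((H \<circ> \<gamma>) 0) ((H \<circ> \<gamma>) 1) \<le> norm (b - a) * dist (0::real) 1"
    by (rule lipschitz_onD) auto
  then show ?thesis by (simp add: \<gamma>_def dist_norm norm_minus_commute)
qed

section \<open>Linearity of the partner map\<close>

context matched_curves
begin

definition matched_set :: "'d \<Rightarrow> ('d \<Rightarrow> real ^ 'd) \<Rightarrow> ('d \<Rightarrow> real ^ 'd) \<Rightarrow> (real ^ 'd) set" where
  "matched_set k x y = {w. \<forall>i. i \<noteq> k \<longrightarrow> y i \<bullet> partner w = x i \<bullet> w}"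

lemma closed_matched_set: "closed (matched_set k x y)"
proof -
  have "matched_set k x y = (\<Inter>i\<in>- {k}. {w. y i \<bullet> partner w = x i \<bullet> w})"
    by (auto simp: matched_set_def)
  then show ?thesis
    by (simp only:) (intro closed_INT ballI closed_Collect_eq continuous_intros continuous_on_partner)
qed

text \<open>Norm preservation written in both frames. The matched coordinates agree, so the squares
  of the normal coordinates differ by an offset that ignores coordinate \<open>k\<close>.\<close>

lemma partner_square:
  assumes \<alpha>: "\<forall>w. \<alpha> (frame_coords k x n w) = w"
      "\<forall>u. (norm (\<alpha> u))\<^sup>2 = (u $ k)\<^sup>2 + (norm (\<alpha> (drop_coord k u)))\<^sup>2"
    and \<beta>: "\<forall>w. \<beta> (frame_coords k y n' w) = w"
      "\<forall>u. (norm (\<beta> u))\<^sup>2 = (u $ k)\<^sup>2 + (norm (\<beta> (drop_coord k u)))\<^sup>2"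
    and w: "w \<in> matched_set k x y"
  shows "(n' \<bullet> partner w)\<^sup>2 = (n \<bullet> w)\<^sup>2 + ((norm (\<alpha> (drop_coord k (frame_coords k x n w))))\<^sup>2
      - (norm (\<beta> (drop_coord k (frame_coords k x n w))))\<^sup>2)"
proof -
  have drop: "drop_coord k (frame_coords k y n' (partner w)) = drop_coord k (frame_coords k x n w)"
    using w by (auto simp: matched_set_def drop_coord_def frame_coords_def vec_eq_iff)
  have "(norm (partner w))\<^sup>2 = (n' \<bullet> partner w)\<^sup>2 + (norm (\<beta> (drop_coord k (frame_coords k x n w))))\<^sup>2"
    using \<beta>(2)[rule_format, of "frame_coords k y n' (partner w)"] \<beta>(1) drop by (simp add: frame_coords_def)
  moreover have "(norm w)\<^sup>2 = (n \<bullet> w)\<^sup>2 + (norm (\<alpha> (drop_coord k (frame_coords k x n w))))\<^sup>2"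
    using \<alpha>(2)[rule_format, of "frame_coords k x n w"] \<alpha>(1) by (simp add: frame_coords_def)
  ultimately show ?thesis by simp
qed

lemma emeasure_partner_image:
  assumes "S \<in> sets borel"
  shows "emeasure lborel (partner ` S) = emeasure lborel S"
proof -
  interpret inv: matched_curves \<C> \<B> d c p by (rule swap)
  have "inv.partner (partner v) = v" for v
    by (rule inv.partner_unique) (simp_all add: curve_partner)
  moreover have "partner (inv.partner v) = v" for v
    by (rule partner_unique) (simp_all add: inv.curve_partner)
  ultimately have "partner ` S = inv.partner -` S" by (auto intro!: image_eqI)
  moreover have "inv.partner \<in> borel_measurable borel"
    by (rule borel_measurable_continuous_onI) (rule inv.continuous_on_partner)
  ultimately show ?thesis
    using assms arg_cong[OF inv.distr_lborel_partner, of "\<lambda>M. emeasure M S"] by (simp add: emeasure_distr)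
qed

text \<open>The volume argument needs an open set with positive normal coordinates, but the offset
  it kills there is a quadratic form and hence vanishes everywhere. So on the entire matched set the
  normal coordinates agree up to sign, and the two signs give the two orthogonal maps.\<close>

lemma partner_orthogonal_on_matched_set:
  assumes x: "inj_on x (- {k})" "independent (x ` (- {k}))"
    and y: "inj_on y (- {k})" "independent (y ` (- {k}))"
    and int: "interior (matched_set k x y) \<noteq> {}"
  shows "\<exists>\<psi> \<psi>'. orthogonal_transformation \<psi> \<and> orthogonal_transformation \<psi>' \<and>
    (\<forall>w\<in>matched_set k x y. partner w = \<psi> w \<or> partner w = \<psi>' w)"
proof -
  let ?F = "matched_set k x y"
  obtain m where m: "norm m = 1" "\<forall>i. i \<noteq> k \<longrightarrow> x i \<bullet> m = 0" by (rule frame_normal_exists)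
  obtain m' where m': "norm m' = 1" "\<forall>i. i \<noteq> k \<longrightarrow> y i \<bullet> m' = 0" by (rule frame_normal_exists)
  obtain w where w: "w \<in> interior ?F" "m \<bullet> w \<noteq> 0" "m' \<bullet> partner w \<noteq> 0"
  proof -
    obtain w1 where w1: "w1 \<in> interior ?F" using int by auto
    obtain e where e: "0 < e" "ball w1 e \<subseteq> interior ?F"
      using w1 open_contains_ball[of "interior ?F"] by auto
    obtain \<alpha> where \<alpha>: "\<forall>w. \<alpha> (frame_coords k x m w) = w"
      "\<forall>u. (norm (\<alpha> u))\<^sup>2 = (u $ k)\<^sup>2 + (norm (\<alpha> (drop_coord k u)))\<^sup>2"
      by (rule frame_inverse[OF x m]) blast
    obtain \<beta> where \<beta>: "\<forall>w. \<beta> (frame_coords k y m' w) = w"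
      "\<forall>u. (norm (\<beta> u))\<^sup>2 = (u $ k)\<^sup>2 + (norm (\<beta> (drop_coord k u)))\<^sup>2"
      by (rule frame_inverse[OF y m']) blast
    define a where "a = m \<bullet> w1"
    define q where "q = (norm (\<alpha> (drop_coord k (frame_coords k x m w1))))\<^sup>2
      - (norm (\<beta> (drop_coord k (frame_coords k x m w1))))\<^sup>2"
    \<comment> \<open>Moving by \<tau> along \<open>m\<close> changes the normal coordinate to
      \<open>a + \<tau>\<close> and leaves the offset \<open>q\<close> fixed. The listed values
      contain every \<tau> for which \<open>a + \<tau>\<close> or
      \<open>(a + \<tau>)\<^sup>2 + q\<close> vanishes.\<close>
    let ?bad = "{- a, - a + sqrt (- q), - a - sqrt (- q)}"
    have "infinite {0<..<e}" using e(1) by simp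
    then have "infinite ({0<..<e} - ?bad)" by (intro Diff_infinite_finite) auto
    then obtain \<tau> where \<tau>: "0 < \<tau>" "\<tau> < e" "\<tau> \<notin> ?bad"
      by (metis (no_types, lifting) DiffE finite.emptyI ex_in_conv greaterThanLessThan_iff)
    have in_F: "w1 + \<tau> *\<^sub>R m \<in> interior ?F"
      using e(2) \<tau> m(1) by (auto simp: dist_norm subset_iff)
    have mw: "m \<bullet> (w1 + \<tau> *\<^sub>R m) = a + \<tau>"
      using m(1) by (simp add: a_def inner_add_right dot_square_norm)
    have "drop_coord k (frame_coords k x m (w1 + \<tau> *\<^sub>R m)) = drop_coord k (frame_coords k x m w1)"
      using m(2) by (auto simp: drop_coord_def frame_coords_def vec_eq_iff inner_add_right)
    then have sq: "(m' \<bullet> partner (w1 + \<tau> *\<^sub>R m))\<^sup>2 = (a + \<tau>)\<^sup>2 + q"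
      using partner_square[OF \<alpha> \<beta>, of "w1 + \<tau> *\<^sub>R m"] in_F interior_subset mw by (auto simp: q_def)
    have "(a + \<tau>)\<^sup>2 + q \<noteq> 0"
    proof
      assume "(a + \<tau>)\<^sup>2 + q = 0"
      then have "\<bar>a + \<tau>\<bar> = sqrt (- q)" by (metis add.commute add_eq_0_iff real_sqrt_abs)
      then show False using \<tau>(3) by (auto simp: abs_if split: if_splits)
    qed
    then have "m' \<bullet> partner (w1 + \<tau> *\<^sub>R m) \<noteq> 0" using sq by auto
    moreover have "a + \<tau> \<noteq> 0" using \<tau>(3) by auto
    ultimately show thesis using that[OF in_F] mw by simp
  qed
  \<comment> \<open>Orient both normals so that the normal coordinates at \<open>w\<close>, and
    hence nearby, are positive.\<close>
  define n where "n = (if 0 < m \<bullet> w then m else - m)"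
  define n' where "n' = (if 0 < m' \<bullet> partner w then m' else - m')"
  have n: "norm n = 1" "\<forall>i. i \<noteq> k \<longrightarrow> x i \<bullet> n = 0" "0 < n \<bullet> w"
    using m w(2) by (auto simp: n_def)
  have n': "norm n' = 1" "\<forall>i. i \<noteq> k \<longrightarrow> y i \<bullet> n' = 0" "0 < n' \<bullet> partner w"
    using m' w(3) by (auto simp: n'_def)
  let ?X = "frame_coords k x n" and ?Y = "frame_coords k y n'"
  obtain \<alpha> where \<alpha>: "linear \<alpha>" "\<forall>w. \<alpha> (?X w) = w" "\<forall>u. ?X (\<alpha> u) = u"
    "\<forall>u. (norm (\<alpha> u))\<^sup>2 = (u $ k)\<^sup>2 + (norm (\<alpha> (drop_coord k u)))\<^sup>2"
    by (rule frame_inverse[OF x n(1,2)])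
  obtain \<beta> where \<beta>: "linear \<beta>" "\<forall>w. \<beta> (?Y w) = w" "\<forall>u. ?Y (\<beta> u) = u"
    "\<forall>u. (norm (\<beta> u))\<^sup>2 = (u $ k)\<^sup>2 + (norm (\<beta> (drop_coord k u)))\<^sup>2"
    by (rule frame_inverse[OF y n'(1,2)])
  have cont: "continuous_on S f" if "linear f" for f :: "real ^ 'd \<Rightarrow> real ^ 'd" and S
    using that by (simp add: linear_continuous_on linear_conv_bounded_linear)
  note linX = linear_frame_coords[of k x n] and linY = linear_frame_coords[of k y n']
  define Q where "Q u = (norm (\<alpha> (drop_coord k u)))\<^sup>2 - (norm (\<beta> (drop_coord k u)))\<^sup>2" for u
  have square: "(n' \<bullet> partner w)\<^sup>2 = (n \<bullet> w)\<^sup>2 + Q (?X w)" if "w \<in> ?F" for w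
    unfolding Q_def by (rule partner_square[OF \<alpha>(2,4) \<beta>(2,4) that])
  define U where "U = interior ?F \<inter> {w. 0 < n \<bullet> w} \<inter> {w. 0 < n' \<bullet> partner w}"
  have U: "open U" "U \<subseteq> ?F" "w \<in> U"
    unfolding U_def using w n n' interior_subset
    by (auto intro!: open_Int open_Collect_less continuous_intros continuous_on_partner)
  define W where "W = \<alpha> -` U"
  have W: "open W" "?X w \<in> W"
    using U \<alpha>(2) cont[OF \<alpha>(1)] by (auto simp: W_def intro: open_vimage)
  \<comment> \<open>The partner map in frame coordinates. Its linear factors scale volume by
    constants and \<open>partner\<close> preserves it, so \<open>G\<close> scales it by a
    constant.\<close>
  define G where "G = ?Y \<circ> partner \<circ> \<alpha>"
  have contG: "continuous_on S G" for S
    unfolding G_def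
    by (intro continuous_on_compose cont \<alpha>(1) linY continuous_on_partner)
  obtain c\<alpha> where c\<alpha>: "0 < c\<alpha>" "\<And>S. S \<in> sets borel \<Longrightarrow> emeasure lborel (\<alpha> ` S) = ennreal c\<alpha> * emeasure lborel S"
    using lborel_linear_image[OF \<alpha>(1)] \<alpha>(3) by (metis inj_on_def)
  obtain cY where cY: "0 < cY" "\<And>S. S \<in> sets borel \<Longrightarrow> emeasure lborel (?Y ` S) = ennreal cY * emeasure lborel S"
    using lborel_linear_image[OF linY] \<beta>(2) by (metis inj_on_def)
  have scale: "emeasure lborel (G ` cbox a b) = ennreal (cY * c\<alpha>) * emeasure lborel (cbox a b)" for a b
  proof -
    have 1: "compact (\<alpha> ` cbox a b)" by (rule compact_continuous_image[OF cont[OF \<alpha>(1)] compact_cbox])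
    have "compact (partner ` \<alpha> ` cbox a b)" by (rule compact_continuous_image[OF continuous_on_partner 1])
    with 1 have "\<alpha> ` cbox a b \<in> sets borel" "partner ` \<alpha> ` cbox a b \<in> sets borel"
      by (auto simp: compact_imp_closed)
    moreover have "G ` cbox a b = ?Y ` partner ` \<alpha> ` cbox a b" by (auto simp: G_def)
    ultimately show ?thesis
      using cY c\<alpha> by (simp only: emeasure_partner_image ennreal_mult less_imp_le sets_lborel borel_closed closed_cbox mult.assoc)
  qed
  have Q_local: "Q z = 0" if z: "z \<in> W" for z
  proof (rule volume_scaling_imp_offset_zero[OF W(1) z contG])
    fix u assume u: "u \<in> W"
    have uF: "\<alpha> u \<in> ?F" using u U(2) by (auto simp: W_def)
    have Xu: "?X (\<alpha> u) = u" using \<alpha>(3) by blast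
    have k: "n \<bullet> \<alpha> u = u $ k" using arg_cong[OF Xu, of "\<lambda>v. v $ k"] by (simp add: frame_coords_def)
    have Gk: "G u $ k = n' \<bullet> partner (\<alpha> u)" by (simp add: G_def frame_coords_def)
    show "0 < u $ k" "0 < G u $ k" using u k Gk by (auto simp: W_def U_def)
    show "(G u $ k)\<^sup>2 = (u $ k)\<^sup>2 + Q u" using square[OF uF] Xu k Gk by simp
    fix i assume i: "i \<noteq> k"
    have "G u $ i = x i \<bullet> \<alpha> u" using uF i by (simp add: G_def frame_coords_def matched_set_def)
    also have "\<dots> = u $ i" using arg_cong[OF Xu, of "\<lambda>v. v $ i"] i by (simp add: frame_coords_def)
    finally show "G u $ i = u $ i" .
  next
    show "continuous_on UNIV Q"
      unfolding Q_def using linear_drop_coord[of k]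
      by (intro continuous_intros continuous_on_compose2[OF cont[OF \<alpha>(1)], of UNIV]
        continuous_on_compose2[OF cont[OF \<beta>(1)], of UNIV] cont) auto
    show "Q u = Q v" if "\<And>i. i \<noteq> k \<Longrightarrow> u $ i = v $ i" for u v
    proof -
      have "drop_coord k u = drop_coord k v" using that by (auto simp: drop_coord_def vec_eq_iff)
      then show ?thesis by (simp add: Q_def)
    qed
    show "0 < cY * c\<alpha>" using cY c\<alpha> by simp
    show "emeasure lborel (G ` cbox a b) = ennreal (cY * c\<alpha>) * emeasure lborel (cbox a b)"
      if "cbox a b \<subseteq> W" for a b by (rule scale)
  qed
  have drop_eq: "norm (\<alpha> (drop_coord k u)) = norm (\<beta> (drop_coord k u))" for u
  proof -
    have "linear (\<lambda>u. \<alpha> (drop_coord k u))" "linear (\<lambda>u. \<beta> (drop_coord k u))"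
      using linear_compose[OF linear_drop_coord \<alpha>(1)] linear_compose[OF linear_drop_coord \<beta>(1)]
      by (simp_all add: o_def)
    then show ?thesis
      by (rule linear_norm_eq_of_open[OF _ _ W]) (use Q_local in \<open>auto simp: Q_def\<close>)
  qed
  then have Q0: "Q u = 0" for u by (simp add: Q_def)
  define flip where "flip u = (\<chi> i. if i = k then - (u $ i) else u $ i)" for u :: "real ^ 'd"
  have flip: "linear flip" by (rule linearI) (auto simp: flip_def vec_eq_iff)
  have norm_\<beta>: "norm (\<beta> u) = norm (\<alpha> u)" for u
  proof (rule power2_eq_imp_eq)
    show "(norm (\<beta> u))\<^sup>2 = (norm (\<alpha> u))\<^sup>2"
      unfolding \<alpha>(4)[rule_format, of u] \<beta>(4)[rule_format, of u] drop_eq[of u] ..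
  qed simp_all
  have drop_flip: "drop_coord k (flip u) = drop_coord k u" for u
    by (auto simp: drop_coord_def flip_def vec_eq_iff)
  have flip_k: "(flip u $ k)\<^sup>2 = (u $ k)\<^sup>2" for u by (simp add: flip_def)
  have norm_flip: "norm (\<beta> (flip u)) = norm (\<beta> u)" for u
  proof (rule power2_eq_imp_eq)
    show "(norm (\<beta> (flip u)))\<^sup>2 = (norm (\<beta> u))\<^sup>2"
      unfolding \<beta>(4)[rule_format, of u] \<beta>(4)[rule_format, of "flip u"] drop_flip flip_k ..
  qed simp_all
  show ?thesis
  proof (intro exI conjI ballI)
    show "orthogonal_transformation (\<beta> \<circ> ?X)"
      unfolding orthogonal_transformation
      using linear_compose[OF linX \<beta>(1)] \<alpha>(2) by (simp add: norm_\<beta>)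
    show "orthogonal_transformation (\<beta> \<circ> (flip \<circ> ?X))"
      unfolding orthogonal_transformation
      using linear_compose[OF linear_compose[OF linX flip] \<beta>(1)] \<alpha>(2) by (simp add: norm_\<beta> norm_flip[unfolded norm_\<beta>])
    fix v assume v: "v \<in> ?F"
    have "(n' \<bullet> partner v)\<^sup>2 = (n \<bullet> v)\<^sup>2" using square[OF v] Q0 by simp
    then consider "n' \<bullet> partner v = n \<bullet> v" | "n' \<bullet> partner v = - (n \<bullet> v)"
      using power2_eq_iff by blast
    then have "?Y (partner v) = ?X v \<or> ?Y (partner v) = flip (?X v)"
      using v by cases (auto simp: frame_coords_def flip_def vec_eq_iff matched_set_def)
    then show "partner v = (\<beta> \<circ> ?X) v \<or> partner v = (\<beta> \<circ> (flip \<circ> ?X)) v"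
      using \<beta>(2) by (metis comp_apply)
  qed
qed

text \<open>Jumps of the common curve are heights of vertices on both sides; distinct heights make
  the chosen vertices of \<open>L\<close> distinct. Setting the value at \<open>k\<close> to 0
  leaves only finitely many pairs of frames.\<close>

lemma matched_set_cover:
  assumes v: "inj_on (\<lambda>x. x \<bullet> v) (\<Union>\<B>)"
  shows "\<exists>x y. x ` (- {k}) \<subseteq> \<Union>\<B> \<and> y ` (- {k}) \<subseteq> \<Union>\<C> \<and> x k = 0 \<and> y k = 0 \<and>
    inj_on x (- {k}) \<and> inj_on y (- {k}) \<and> v \<in> matched_set k x y"
proof -
  obtain A where A: "A \<subseteq> \<Union>\<B>" "DIM(real ^ 'd) - 1 \<le> card A" "\<forall>x\<in>A. jumps_at (K.curve v) (x \<bullet> v)"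
    by (rule K.many_jumps[OF inj_K v])
  have finA: "finite A" using A(1) K.finite_vertices by (rule finite_subset)
  have "card (- {k}) \<le> card A"
    using A(2) by (simp add: Compl_eq_Diff_UNIV card_Diff_singleton)
  then obtain f where f: "f ` (- {k}) \<subseteq> A" "inj_on f (- {k})"
    using card_le_inj[of "- {k}" A] finA by auto
  have "\<forall>i\<in>- {k}. \<exists>z\<in>\<Union>\<C>. z \<bullet> partner v = f i \<bullet> v"
  proof
    fix i assume "i \<in> - {k}"
    then have "jumps_at (L.curve (partner v)) (f i \<bullet> v)" using f A(3) by (auto simp: curve_partner)
    then show "\<exists>z\<in>\<Union>\<C>. z \<bullet> partner v = f i \<bullet> v" by (rule L.jumps_at_vertex)
  qed
  then obtain g where g: "\<And>i. i \<in> - {k} \<Longrightarrow> g i \<in> \<Union>\<C> \<and> g i \<bullet> partner v = f i \<bullet> v"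
    by metis
  have "inj_on g (- {k})"
  proof (rule inj_onI)
    fix i j assume ij: "i \<in> - {k}" "j \<in> - {k}" "g i = g j"
    then have "f i \<bullet> v = f j \<bullet> v" using g by metis
    then have "f i = f j" using ij f(1) A(1) by (intro inj_onD[OF v]) auto
    then show "i = j" using ij f(2) by (auto dest: inj_onD)
  qed
  show ?thesis
  proof (intro exI conjI)
    show "(f(k := 0)) ` (- {k}) \<subseteq> \<Union>\<B>" using f(1) A(1) by (simp add: image_subset_iff) blast
    show "(g(k := 0)) ` (- {k}) \<subseteq> \<Union>\<C>" using g by (simp add: image_subset_iff)
    show "inj_on (f(k := 0)) (- {k})" using f(2) by (rule inj_on_cong[THEN iffD1, rotated]) simp
    show "inj_on (g(k := 0)) (- {k})" using \<open>inj_on g (- {k})\<close> by (rule inj_on_cong[THEN iffD1, rotated]) simp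
    show "v \<in> matched_set k (f(k := 0)) (g(k := 0))" using g by (simp add: matched_set_def)
  qed simp_all
qed

text \<open>The complement of the closed set \<open>T\<close> is covered by finitely many closed
  sets. If it were nonempty, one of them would have interior points there; hyperplanes have no
  interior, and matched sets with interior lie in \<open>T\<close>.\<close>

lemma partner_in_finite_set:
  obtains \<Psi> where "finite \<Psi>" "\<forall>\<psi>\<in>\<Psi>. orthogonal_transformation \<psi>" "\<forall>w. \<exists>\<psi>\<in>\<Psi>. partner w = \<psi> w"
proof -
  obtain k :: 'd where True by simp
  define P where "P = {(x, y). x ` (- {k}) \<subseteq> \<Union>\<B> \<and> y ` (- {k}) \<subseteq> \<Union>\<C> \<and> x k = 0 \<and> y k = 0 \<and>
    inj_on x (- {k}) \<and> inj_on y (- {k})}"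
  have "finite P"
  proof (rule finite_subset)
    let ?fun = "\<lambda>V. PiE UNIV (\<lambda>_. insert 0 V) :: ('d \<Rightarrow> real ^ 'd) set"
    show "P \<subseteq> ?fun (\<Union>\<B>) \<times> ?fun (\<Union>\<C>)" by (auto simp: P_def image_subset_iff)
    show "finite (?fun (\<Union>\<B>) \<times> ?fun (\<Union>\<C>))"
      using K.finite_vertices L.finite_vertices
      by (intro finite_cartesian_product finite_PiE) auto
  qed
  define M where "M q = matched_set k (fst q) (snd q)" for q
  have closedM: "closed (M q)" for q by (simp add: M_def closed_matched_set)
  have "\<exists>\<psi> \<psi>'. orthogonal_transformation \<psi> \<and> orthogonal_transformation \<psi>' \<and>
      (\<forall>w\<in>M q. partner w = \<psi> w \<or> partner w = \<psi>' w)" if "q \<in> P" "interior (M q) \<noteq> {}" for q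
    unfolding M_def
    by (rule partner_orthogonal_on_matched_set)
      (use that general_position_independent[OF gp_K, of "fst q" k] general_position_independent[OF gp_L, of "snd q" k]
        in \<open>auto simp: P_def M_def\<close>)
  then obtain \<psi> \<psi>' where \<psi>: "\<And>q. q \<in> P \<Longrightarrow> interior (M q) \<noteq> {} \<Longrightarrow> orthogonal_transformation (\<psi> q) \<and>
      orthogonal_transformation (\<psi>' q) \<and> (\<forall>w\<in>M q. partner w = \<psi> q w \<or> partner w = \<psi>' q w)"
    by metis
  define P' where "P' = {q \<in> P. interior (M q) \<noteq> {}}"
  define \<Psi> where "\<Psi> = \<psi> ` P' \<union> \<psi>' ` P'"
  have \<Psi>: "finite \<Psi>" "\<forall>\<psi>\<in>\<Psi>. orthogonal_transformation \<psi>"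
    using \<open>finite P\<close> \<psi> by (auto simp: \<Psi>_def P'_def)
  define T where "T = (\<Union>\<psi>\<in>\<Psi>. {w. partner w = \<psi> w})"
  have "closed T"
    unfolding T_def
  proof (intro closed_UN \<Psi> ballI closed_Collect_eq continuous_on_partner)
    fix \<psi> assume "\<psi> \<in> \<Psi>"
    then show "continuous_on UNIV \<psi>"
      using \<Psi>(2) orthogonal_transformation_linear linear_conv_bounded_linear linear_continuous_on by blast
  qed
  \<comment> \<open>Hyperplanes of directions giving two vertices of \<open>K\<close> the same
    height, where \<open>matched_set_cover\<close> does not apply.\<close>
  define \<H> where "\<H> = (\<lambda>(x, y). {w. (x - y) \<bullet> w = 0}) ` {(x, y). x \<in> \<Union>\<B> \<and> y \<in> \<Union>\<B> \<and> x \<noteq> y}"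
  have "finite {(x, y). x \<in> \<Union>\<B> \<and> y \<in> \<Union>\<B> \<and> x \<noteq> y}"
    by (rule finite_subset[of _ "\<Union>\<B> \<times> \<Union>\<B>"]) (use K.finite_vertices in auto)
  then have "finite \<H>" by (simp add: \<H>_def)
  have \<H>: "closed F \<and> interior F = {}" if "F \<in> \<H>" for F
    using that by (auto simp: \<H>_def closed_hyperplane interior_hyperplane)
  have "T = UNIV"
  proof (rule ccontr)
    assume "T \<noteq> UNIV"
    then have "open (- T)" "- T \<noteq> {}" using \<open>closed T\<close> by auto
    moreover have "- T \<subseteq> \<Union>(M ` P \<union> \<H>)"
    proof
      fix v
      show "v \<in> \<Union>(M ` P \<union> \<H>)"
      proof (cases "inj_on (\<lambda>x. x \<bullet> v) (\<Union>\<B>)")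
        case True
        then obtain x y where "(x, y) \<in> P" "v \<in> M (x, y)"
          using matched_set_cover[of v k] by (auto simp: P_def M_def)
        then show ?thesis by blast
      next
        case False
        then obtain x y where "x \<in> \<Union>\<B>" "y \<in> \<Union>\<B>" "x \<noteq> y" "x \<bullet> v = y \<bullet> v"
          unfolding inj_on_def by blast
        then have "v \<in> {w. (x - y) \<bullet> w = 0}" "{w. (x - y) \<bullet> w = 0} \<in> \<H>"
          by (auto simp: \<H>_def inner_diff_left)
        then show ?thesis by blast
      qed
    qed
    moreover have "finite (M ` P \<union> \<H>)" "\<And>F. F \<in> M ` P \<union> \<H> \<Longrightarrow> closed F"
      using \<open>finite P\<close> \<open>finite \<H>\<close> closedM \<H> by auto
    ultimately have "\<exists>F\<in>M ` P \<union> \<H>. interior F \<inter> - T \<noteq> {}"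
      by (intro finite_closed_cover_interior)
    then obtain F where F: "F \<in> M ` P \<union> \<H>" "interior F \<inter> - T \<noteq> {}" by (elim bexE)
    then obtain q where q: "q \<in> P" "F = M q" using \<H> by auto
    have "interior F \<subseteq> T"
    proof
      fix w assume w: "w \<in> interior F"
      then have "q \<in> P'" using q by (auto simp: P'_def)
      moreover have "partner w = \<psi> q w \<or> partner w = \<psi>' q w"
        using \<psi>[OF q(1)] w q interior_subset by blast
      ultimately show "w \<in> T" by (auto simp: T_def \<Psi>_def)
    qed
    then show False using F by blast
  qed
  then have "\<forall>w. \<exists>\<psi>\<in>\<Psi>. partner w = \<psi> w" by (auto simp: T_def)
  then show thesis using that \<Psi> by blast
qed

lemma partner_contracts: "dist (partner a) (partner b) \<le> dist a b"
proof -
  obtain \<Psi> where "finite \<Psi>" "\<forall>\<psi>\<in>\<Psi>. orthogonal_transformation \<psi>" "\<forall>w. \<exists>\<psi>\<in>\<Psi>. partner w = \<psi> w"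
    by (rule partner_in_finite_set)
  then show ?thesis
    by (intro selection_of_isometries_contracts[of partner \<Psi>] continuous_on_partner) auto
qed

text \<open>The map and its inverse both contract distances, so both preserve them; an isometry
  fixing the origin is orthogonal.\<close>

lemma orthogonal_transformation_partner: "orthogonal_transformation partner"
proof -
  interpret inv: matched_curves \<C> \<B> d c p by (rule swap)
  have inv: "inv.partner (partner v) = v" for v
    by (rule inv.partner_unique) (simp_all add: curve_partner)
  have "dist (partner a) (partner b) = dist a b" for a b
    using partner_contracts[of a b] inv.partner_contracts[of "partner a" "partner b"] inv by simp
  moreover have "partner 0 = 0" using norm_partner[of 0] by (simp only: norm_zero norm_eq_zero)
  ultimately show ?thesis by (simp add: orthogonal_transformation_isometry)
qed

text \<open>Orthogonality turns the height of \<open>y\<close> in direction \<open>v\<close> into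
  that of \<open>partner y\<close> in direction \<open>partner v\<close>. So the sets of \<C> and
  the images of those of \<B> have equal curves in every direction, and inversion applies to their
  difference.\<close>

lemma hull_sums_partner:
  "(\<Sum>C\<in>\<C>. d C * indicator (convex hull C) (partner z)) = (\<Sum>B\<in>\<B>. c B * indicator (convex hull B) z)"
proof -
  note orth = orthogonal_transformation_partner
  have lin: "linear partner" and inj: "inj partner"
    using orth orthogonal_transformation_linear orthogonal_transformation_inj by auto
  let ?e = "case_sum d (\<lambda>B. - c B)" and ?S = "case_sum (\<lambda>C. C) (\<lambda>B. partner ` B)"
  have "(\<Sum>i\<in>\<C> <+> \<B>. ?e i * indicator (convex hull (?S i)) (partner z)) = 0"
  proof (rule hull_weights_inversion)
    show "finite (\<C> <+> \<B>)" using K.finite_sets L.finite_sets by simp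
    show "finite (?S i) \<and> ?S i \<noteq> {}" if "i \<in> \<C> <+> \<B>" for i
      using that K.finite_set L.finite_set K.nonempty_set L.nonempty_set by auto
    fix w t
    obtain v where v: "w = partner v" using orthogonal_transformation_surj[OF orth] by (metis surjE)
    have "(\<Sum>i\<in>\<C> <+> \<B>. ?e i * of_bool (\<exists>y\<in>?S i. y \<bullet> w \<le> t))
        = (\<Sum>C\<in>\<C>. d C * of_bool (\<exists>y\<in>C. y \<bullet> w \<le> t)) - (\<Sum>B\<in>\<B>. c B * of_bool (\<exists>y\<in>partner ` B. y \<bullet> w \<le> t))"
      using K.finite_sets L.finite_sets by (subst sum.Plus) (simp_all add: sum_negf)
    also have "\<dots> = L.curve w t - K.curve v t"
      using orth by (simp add: L.curve_alt K.curve_alt v orthogonal_transformation_def)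
    also have "\<dots> = 0" by (simp add: v curve_partner)
    finally show "(\<Sum>i\<in>\<C> <+> \<B>. ?e i * of_bool (\<exists>y\<in>?S i. y \<bullet> w \<le> t)) = 0" .
  qed
  moreover have "(\<Sum>i\<in>\<C> <+> \<B>. ?e i * indicator (convex hull (?S i)) (partner z))
      = (\<Sum>C\<in>\<C>. d C * indicator (convex hull C) (partner z))
        - (\<Sum>B\<in>\<B>. c B * indicator (convex hull (partner ` B)) (partner z))"
    using K.finite_sets L.finite_sets by (subst sum.Plus) (simp_all add: sum_negf)
  moreover have "indicator (convex hull (partner ` B)) (partner z) = (indicator (convex hull B) z :: int)" for B
    by (simp add: convex_hull_linear_image[OF lin, symmetric] indicator_def inj_image_mem_iff[OF inj])
  ultimately show ?thesis by simp
qed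

end

theorem theorem6p7:
  fixes K L :: "(real ^ 'd) set set" and p :: real
  assumes "1 \<le> p"
    and "simplicial_complex K" and "generic K"
    and "simplicial_complex L" and "generic L"
    and "distr sphere_measure (euler_curve_borel p) (ECT (\<Union>K)) =
         distr sphere_measure (euler_curve_borel p) (ECT (\<Union>L))"
  shows "\<exists>\<phi> :: real ^ 'd \<Rightarrow> real ^ 'd. orthogonal_transformation \<phi> \<and> \<Union>L = \<phi> ` \<Union>K"
proof -
  obtain \<B> c where c: "hull_weights (\<Union>K) \<B> c" "\<Union>\<B> \<subseteq> complex_vertices K"
    using hull_weights_simplicial_complex[OF assms(2)] by metis
  obtain \<C> d where d: "hull_weights (\<Union>L) \<C> d" "\<Union>\<C> \<subseteq> complex_vertices L"
    using hull_weights_simplicial_complex[OF assms(4)] by metis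
  interpret K: vertex_weights \<B> c
    using c(1) by unfold_locales (auto simp: hull_weights_def)
  interpret L: vertex_weights \<C> d
    using d(1) by unfold_locales (auto simp: hull_weights_def)
  have ECT: "ECT (\<Union>K) = K.curve" "ECT (\<Union>L) = L.curve"
    using ECT_hull_weights[OF assms(2) c(1)] ECT_hull_weights[OF assms(4) d(1)]
    by (auto simp: K.curve_alt L.curve_alt fun_eq_iff)
  interpret matched_curves \<B> \<C> c d p
  proof
    show "inj_on K.curve (sphere 0 1)" "inj_on L.curve (sphere 0 1)"
      using assms(3,5) by (simp_all add: generic_def ECT)
    show "general_position (\<Union>\<B>)" "general_position (\<Union>\<C>)"
      using assms(3,5) c(2) d(2) unfolding generic_def general_position_def by (meson order_trans)+
  qed (use assms in \<open>simp_all add: ECT\<close>)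
  have iff: "partner z \<in> \<Union>L \<longleftrightarrow> z \<in> \<Union>K" for z
  proof -
    have "(indicator (\<Union>L) (partner z) :: int) = indicator (\<Union>K) z"
      using c(1) d(1) hull_sums_partner[of z] unfolding hull_weights_def by metis
    then show ?thesis unfolding indicator_def by (simp only: of_bool_eq_iff)
  qed
  have "partner -` \<Union>L = \<Union>K" unfolding set_eq_iff vimage_eq using iff by blast
  moreover have "surj partner"
    using orthogonal_transformation_partner by (rule orthogonal_transformation_surj)
  ultimately have "\<Union>L = partner ` \<Union>K"
    using surj_image_vimage_eq[of partner "\<Union>L"] by simp
  then show ?thesis using orthogonal_transformation_partner by blast
qed

end
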